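(* There exists a constant $C>0$ such that the following holds. Let $\epsilon>0$. There is $N(\epsilon)>0$ such that for every $a\in C^\infty(\mathbb{T}^2)$, every choice of widths $\delta(N)\in(0,1/4)$ with $\delta(N)\geq\min(N^{-\epsilon/4},1/10)$, every even integer $N\geq N(\epsilon)$ and every $n\in\mathbb{Z}$ with $|n|\leq(1-\epsilon)T_{\mathrm E}(N)$, where $T_{\mathrm E}(N)=\frac{\log N}{\log 2}$, the "good part" $a_n:=a\,\chi_{\delta(N),n}$ of $a$ satisfies $$\big\|\hat B_N^{n}\,\mathrm{Op}^{\mathrm W}_N(a_n)\,\hat B_N^{-n}-\mathrm{Op}^{\mathrm W}_N(a_n\circ B^{-n})\big\|\leq C\Big(\|a\|_{C^0}\,N^{3/2}\,e^{-\pi N^{\epsilon/2}}+\frac{\|a\|_{C^4}}{N^{\epsilon/2}}\Big).$$ The constant $C$ is independent of $a$ and $\epsilon$ (and of $N$, $n$).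
   Context: $\mathbb{T}^2=\mathbb{R}^2/\mathbb{Z}^2\cong[0,1)^2$, with points $\mathbf{x}=(q,p)$. Classical baker's map: the bijection $B:\mathbb{T}^2\to\mathbb{T}^2$, $B(q,p)=(2q,p/2)$ if $q\in[0,1/2)$, and $B(q,p)=(2q-1,(p+1)/2)$ if $q\in[1/2,1)$. Cutoffs: fix once and for all a family $(\tilde\chi_\delta)_{0<\delta<1/4}$ of $\mathbb{Z}$-periodic functions $\tilde\chi_\delta\in C^\infty(\mathbb{R})$ such that $\tilde\chi_\delta=0$ on $[-\delta,\delta]+\mathbb{Z}$, $\tilde\chi_\delta=1$ on $[2\delta,1-2\delta]+\mathbb{Z}$, and $\sup_{x}|\tilde\chi_\delta^{(k)}(x)|\le c_k\delta^{-k}$ for all $k\ge0$, with $c_k$ independent of $\delta$. For $n\ge0$ set $\chi_{\delta,n}(q,p):=\tilde\chi_\delta(2^nq)\,\tilde\chi_\delta(p)$ and $\chi_{\delta,-n}(q,p):=\tilde\chi_\delta(2^np)\,\tilde\chi_\delta(q)$. (The constant $C$ may depend on this fixed family.) Norms: $\|f\|_{C^0}$ is the sup norm, $\|f\|_{C^j}:=\sum_{|\gamma|\le j}\|\partial^{\gamma}f\|_{C^0}$ over multiindices $\gamma\in\mathbb{N}_0^2$; $\|\cdot\|$ is the operator norm on $\mathcal{H}_N$. For an integer $N\ge1$, $\mathcal{H}_N$ is an $N$-dimensional complex Hilbert space identified with $\mathbb{C}^N$ through an orthonormal "position" basis $\{\mathbf{q}_j\}_{j=0}^{N-1}$ (indices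 understood mod $N$). $\hat F_N$ is the unitary matrix $(\hat F_N)_{kj}=N^{-1/2}e^{-2\pi i kj/N}$, $0\le k,j\le N-1$. For $N$ even, the quantum baker's map is, in the basis $\{\mathbf{q}_j\}$, $$\hat B_N:=\hat F_N^{-1}\begin{pmatrix}\hat F_{N/2}&0\\0&\hat F_{N/2}\end{pmatrix}.$$ Weyl quantisation: for $\mathbf{k}=(k_1,k_2)\in\mathbb{Z}^2$ let $T(\mathbf{k})\mathbf{q}_j=e^{i\pi k_1k_2/N}e^{2\pi i k_2 j/N}\,\mathbf{q}_{j+k_1}$. For $f\in C^\infty(\mathbb{T}^2)$ with Fourier expansion $f(q,p)=\sum_{\mathbf{k}}\tilde f(\mathbf{k})e^{2\pi i(qk_2-pk_1)}$, $\mathrm{Op}^{\mathrm W}_N(f):=\sum_{\mathbf{k}\in\mathbb{Z}^2}\tilde f(\mathbf{k})\,T(\mathbf{k})$. *)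

theory Defs
  imports
    "HOL-Analysis.Analysis"
    "Jordan_Normal_Form.Matrix"
begin

section \<open>The torus and its function spaces\<close>

text \<open>Functions on \<open>\<real>\<^sup>2/\<int>\<^sup>2\<close> are represented by functions on \<open>\<real>\<^sup>2\<close> that are
  1-periodic in both variables.\<close>

definition fund_dom :: "(real \<times> real) set" where
  "fund_dom = {0..<1} \<times> {0..<1}"

definition torus_rep :: "real \<times> real \<Rightarrow> real \<times> real" where
  "torus_rep x = (frac (fst x), frac (snd x))"

definition periodic2 :: "(real \<times> real \<Rightarrow> complex) \<Rightarrow> bool" where
  "periodic2 f \<longleftrightarrow> (\<forall>q p. f (q + 1, p) = f (q, p) \<and> f (q, p + 1) = f (q, p))"

definition partial_q :: "(real \<times> real \<Rightarrow> complex) \<Rightarrow> real \<times> real \<Rightarrow> complex" where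
  "partial_q f = (\<lambda>(q, p). vector_derivative (\<lambda>t. f (t, p)) (at q))"

definition partial_p :: "(real \<times> real \<Rightarrow> complex) \<Rightarrow> real \<times> real \<Rightarrow> complex" where
  "partial_p f = (\<lambda>(q, p). vector_derivative (\<lambda>t. f (q, t)) (at p))"

text \<open>In \<open>C_k\<close>, total differentiability guarantees that the
  \<^const>\<open>vector_derivative\<close>s above are genuine derivatives.\<close>

primrec C_k :: "nat \<Rightarrow> (real \<times> real \<Rightarrow> complex) \<Rightarrow> bool" where
  "C_k 0 f \<longleftrightarrow> continuous_on UNIV f"
| "C_k (Suc k) f \<longleftrightarrow> f differentiable_on UNIV \<and> C_k k (partial_q f) \<and> C_k k (partial_p f)"

definition smooth_torus :: "(real \<times> real \<Rightarrow> complex) set" where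
  "smooth_torus = {f. periodic2 f \<and> (\<forall>k. C_k k f)}"

definition partial :: "nat \<times> nat \<Rightarrow> (real \<times> real \<Rightarrow> complex) \<Rightarrow> real \<times> real \<Rightarrow> complex" where
  "partial \<gamma> f = (partial_q ^^ fst \<gamma>) ((partial_p ^^ snd \<gamma>) f)"

definition C0_norm :: "(real \<times> real \<Rightarrow> complex) \<Rightarrow> real" where
  "C0_norm f = (SUP x. norm (f x))"

definition Cj_norm :: "nat \<Rightarrow> (real \<times> real \<Rightarrow> complex) \<Rightarrow> real" where
  "Cj_norm j f = (\<Sum>\<gamma> | fst \<gamma> + snd \<gamma> \<le> j. C0_norm (partial \<gamma> f))"

section \<open>The classical baker's map\<close>

definition baker :: "real \<times> real \<Rightarrow> real \<times> real" where
  "baker x = (let (q, p) = torus_rep x in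
     if q < 1/2 then (2 * q, p / 2) else (2 * q - 1, (p + 1) / 2))"

lemma bij_betw_baker: "bij_betw baker fund_dom fund_dom"
proof (rule bij_betw_byWitness
    [where f' = "\<lambda>(q, p). if p < 1/2 then (q / 2, 2 * p) else ((q + 1) / 2, 2 * p - 1)"])
  have [simp]: "torus_rep x = x" if "x \<in> fund_dom" for x
    using that by (cases x) (auto simp: torus_rep_def fund_dom_def frac_eq)
  let ?g = "\<lambda>(q, p). if p < 1/2 then (q / 2, 2 * p) else ((q + 1) / 2, 2 * p - 1) :: real \<times> real"
  have g: "?g y \<in> fund_dom" if "y \<in> fund_dom" for y
    using that by (cases y) (auto simp: fund_dom_def)
  show "\<forall>x\<in>fund_dom. ?g (baker x) = x"
    by (auto simp: baker_def fund_dom_def Let_def torus_rep_def frac_eq[THEN iffD2] field_simps)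
  show "\<forall>y\<in>fund_dom. baker (?g y) = y"
  proof
    fix y assume y: "y \<in> fund_dom"
    have "torus_rep (?g y) = ?g y" using g[OF y] by simp
    then show "baker (?g y) = y"
      using y by (cases y) (auto simp: baker_def fund_dom_def field_simps)
  qed
  show "baker ` fund_dom \<subseteq> fund_dom"
    by (auto simp: baker_def fund_dom_def Let_def torus_rep_def frac_eq[THEN iffD2])
  show "?g ` fund_dom \<subseteq> fund_dom"
    using g by blast
qed

text \<open>\<open>baker_pow n\<close> is \<open>B\<^sup>n\<close> for \<open>n \<in> \<int>\<close>, as a map that depends only on the class
  of its argument modulo \<open>\<int>\<^sup>2\<close>.\<close>

definition baker_pow :: "int \<Rightarrow> real \<times> real \<Rightarrow> real \<times> real" where
  "baker_pow n x = (if 0 \<le> n then (baker ^^ nat n) (torus_rep x)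
     else (inv_into fund_dom baker ^^ nat (- n)) (torus_rep x))"

section \<open>Cutoffs\<close>

definition cutoff_family :: "(real \<Rightarrow> real \<Rightarrow> real) \<Rightarrow> bool" where
  "cutoff_family ct \<longleftrightarrow>
     (\<forall>\<delta>. 0 < \<delta> \<and> \<delta> < 1/4 \<longrightarrow>
        (\<forall>x. ct \<delta> (x + 1) = ct \<delta> x) \<and>
        (\<forall>k x. (deriv ^^ k) (ct \<delta>) differentiable (at x)) \<and>
        (\<forall>x\<in>{-\<delta>..\<delta>}. \<forall>m::int. ct \<delta> (x + of_int m) = 0) \<and>
        (\<forall>x\<in>{2 * \<delta>..1 - 2 * \<delta>}. \<forall>m::int. ct \<delta> (x + of_int m) = 1)) \<and>
     (\<exists>c :: nat \<Rightarrow> real. \<forall>\<delta>. 0 < \<delta> \<and> \<delta> < 1/4 \<longrightarrow>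
        (\<forall>k x. \<bar>(deriv ^^ k) (ct \<delta>) x\<bar> \<le> c k / \<delta> ^ k))"

definition cutoff :: "(real \<Rightarrow> real \<Rightarrow> real) \<Rightarrow> real \<Rightarrow> int \<Rightarrow> real \<times> real \<Rightarrow> real" where
  "cutoff ct \<delta> n = (\<lambda>(q, p).
     if 0 \<le> n then ct \<delta> (2 ^ nat n * q) * ct \<delta> p
     else ct \<delta> (2 ^ nat (- n) * p) * ct \<delta> q)"

definition good_part ::
  "(real \<Rightarrow> real \<Rightarrow> real) \<Rightarrow> real \<Rightarrow> int \<Rightarrow> (real \<times> real \<Rightarrow> complex) \<Rightarrow> real \<times> real \<Rightarrow> complex"
  where "good_part ct \<delta> n a = (\<lambda>x. a x * complex_of_real (cutoff ct \<delta> n x))"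

section \<open>Operators on the quantum state space\<close>

text \<open>Operators on the \<open>N\<close>-dimensional state space are complex \<open>N \<times> N\<close> matrices in the
  position basis, indexed from 0. Inverses and integer powers are those of the matrix ring.\<close>

abbreviation mat_ring :: "nat \<Rightarrow> complex mat ring" where
  "mat_ring N \<equiv> ring_mat TYPE(complex) N ()"

definition vec_norm2 :: "complex vec \<Rightarrow> real" where
  "vec_norm2 v = L2_set (\<lambda>i. cmod (vec_index v i)) {..<dim_vec v}"

definition op_norm :: "complex mat \<Rightarrow> real" where
  "op_norm A = Sup {vec_norm2 (A *\<^sub>v v) | v. v \<in> carrier_vec (dim_col A) \<and> vec_norm2 v \<le> 1}"

definition dft :: "nat \<Rightarrow> complex mat" where
  "dft N = Matrix.mat N N
     (\<lambda>(k, j). complex_of_real (1 / sqrt (real N)) * cis (- 2 * pi * real k * real j / real N))"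

definition quantum_baker :: "nat \<Rightarrow> complex mat" where
  "quantum_baker N = inv\<^bsub>mat_ring N\<^esub> (dft N) *
     four_block_mat (dft (N div 2)) (0\<^sub>m (N div 2) (N div 2))
                    (0\<^sub>m (N div 2) (N div 2)) (dft (N div 2))"

text \<open>Column \<open>j\<close> of \<open>translation N k\<close> is the image of the \<open>j\<close>-th basis vector.\<close>

definition translation :: "nat \<Rightarrow> int \<times> int \<Rightarrow> complex mat" where
  "translation N = (\<lambda>(k1, k2). Matrix.mat N N (\<lambda>(i, j).
     if int i = (int j + k1) mod int N
     then cis (pi * real_of_int k1 * real_of_int k2 / real N) *
          cis (2 * pi * real_of_int k2 * real j / real N)
     else 0))"

text \<open>Coefficients of the expansion \<open>f(q,p) = \<Sum>\<^sub>k f\<^sub>k exp(2\<pi>i(q k\<^sub>2 - p k\<^sub>1))\<close>.\<close>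

definition fourier_coeff :: "(real \<times> real \<Rightarrow> complex) \<Rightarrow> int \<times> int \<Rightarrow> complex" where
  "fourier_coeff f = (\<lambda>(k1, k2). set_lebesgue_integral lborel fund_dom
     (\<lambda>(q, p). f (q, p) * cis (- 2 * pi * (q * real_of_int k2 - p * real_of_int k1))))"

text \<open>The operator-valued series is summed entrywise.\<close>

definition weyl_op :: "nat \<Rightarrow> (real \<times> real \<Rightarrow> complex) \<Rightarrow> complex mat" where
  "weyl_op N f = Matrix.mat N N
     (\<lambda>(i, j). \<Sum>\<^sub>\<infinity>k\<in>UNIV. fourier_coeff f k * (translation N k $$ (i, j)))"

definition ehrenfest_time :: "nat \<Rightarrow> real" where
  "ehrenfest_time N = ln (real N) / ln 2"

end

theory Submission
  imports Defs
begin

text \<open>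
  On the support of the cutoff the map is linear, so Weyl quantisation should be transported exactly
  up to Fourier tails. The fundamental domain of the \<open>n\<close>-th iterate splits into \<open>2\<^sup>n\<close> strips, and \<open>a\<close>
  is a superposition of plane waves; a plane wave times the cutoff, restricted to one strip, is a product
  \<open>u(q) v(p)\<close> of dilated bumps. One step of the map sends such a product to another one. Its
  quantisation is a sum over \<open>k\<close> of shifts by \<open>k\<close> with amplitude \<open>v\<^sub>k\<close>, the Fourier coefficients of \<open>v\<close>;
  shifts shorter than twice the distance of the support of \<open>u\<close> to the discontinuity do not leave the
  block to which \<open>u\<close> belongs, and there the quantum step is exactly \<open>F\<^sub>N\<inverse> (F\<^bsub>N/2\<^esub> \<oplus> F\<^bsub>N/2\<^esub>)\<close> acting on
  a block matrix. What remains are the coefficients with \<open>|k|\<close> large, which below the Ehrenfest time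
  are smaller than any power of \<open>N\<close>.

  Since only \<open>\<parallel>a\<parallel>\<^sub>C\<^sub>4\<close> is available, this is applied to Fourier modes of \<open>a\<close> up to \<open>N\<close> to the power \<open>2\<epsilon>/3\<close>. The
  other modes are bounded trivially, by \<open>\<delta>\<^sup>-\<^sup>2\<close> each, and the decay of the Fourier coefficients of \<open>a\<close>
  absorbs this.
\<close>

section \<open>Fourier series\<close>

text \<open>The constant must not depend on \<epsilon>, whereas the number \<open>L\<close> of
  integrations by parts that beats the tails grows like 1/\<epsilon>. Constants of order
  \<open>L\<close> therefore appear only in the estimate for the low modes, where a spare factor N
  absorbs them once N is large; the high modes see \<open>c 0\<close> and \<open>c 2\<close> only.

  The power loss in the tails is the same at every step. Before step number j the position factor
  has scale 2^-r and the momentum factor scale 2^-t with r + t fixed. Frequencies of one factor grow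
  as the distance of the other to the discontinuity shrinks, so the relevant ratio is always 2^n /
  (4 M \<delta>), at most N^(-3\<epsilon>/4) below the Ehrenfest time.

  Errors are kept in the form P A - B P. They telescope along the orbit, and conjugation enters only
  at the end, for either sign of n.

  The number 2^n of strips can be paid for by the tails, but not by the trivial bound. The latter is
  proved for the whole sum over strips: a product u(q) v(p) is bounded by the sup norm of one factor
  and the coefficient sum of the other, and at either end of the orbit one factor is not cut into
  strips.\<close>

definition ee :: "real \<Rightarrow> complex" where "ee x = cis (2 * pi * x)"

lemma ee_add: "ee (x + y) = ee x * ee y"
  by (simp add: ee_def cis_mult distrib_left)

lemma ee_0 [simp]: "ee 0 = 1"
  by (simp add: ee_def)

lemma ee_minus: "ee (- x) = cnj (ee x)"
  by (simp add: ee_def cis_cnj)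

lemma norm_ee [simp]: "norm (ee x) = 1"
  by (simp add: ee_def)

lemma ee_of_int [simp]: "ee (of_int m) = 1"
  unfolding ee_def using cis_multiple_2pi[of "of_int m"] by (simp add: mult.commute)

lemma ee_eq_1_iff: "ee x = 1 \<longleftrightarrow> x \<in> \<int>"
proof
  assume "ee x = 1"
  then have "cos (2 * pi * x) = 1" by (simp add: ee_def complex_eq_iff)
  then obtain n :: int where "2 * pi * x = of_int n * 2 * pi"
    using cos_one_2pi_int by blast
  then have "x = of_int n" by simp
  then show "x \<in> \<int>" by simp
qed (auto elim: Ints_cases)

lemma continuous_on_ee [continuous_intros]:
  "continuous_on S f \<Longrightarrow> continuous_on S (\<lambda>x. ee (f x))"
  unfolding ee_def by (intro continuous_intros)

lemma ee_add_int [simp]: "ee (x + of_int m) = ee x"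
  by (simp add: ee_add)

lemma has_vector_derivative_ee:
  "((\<lambda>x. ee (c * x)) has_vector_derivative (2 * pi * \<i> * c * ee (c * x))) (at x within S)"
proof -
  have "((\<lambda>x. exp (\<i> * of_real (2 * pi * c) * of_real x)) has_vector_derivative
     (exp (\<i> * of_real (2 * pi * c) * of_real x)) * (\<i> * of_real (2 * pi * c))) (at x within S)"
    by (rule has_vector_derivative_real_field) (auto intro!: derivative_eq_intros)
  then show ?thesis
    by (simp add: ee_def cis_conv_exp mult_ac)
qed

section \<open>Uniqueness of Fourier coefficients on the circle\<close>

definition per1 :: "(real \<Rightarrow> 'a) \<Rightarrow> bool" where
  "per1 f \<longleftrightarrow> (\<forall>x. f (x + 1) = f x)"

lemma per1_add_int: assumes "per1 f" shows "f (x + of_int m) = f x"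
proof (induction m rule: int_induct[where k = 0])
  case (step1 i)
  then show ?case using assms[unfolded per1_def, rule_format, of "x + of_int i"] by (simp add: add.assoc)
next
  case (step2 i)
  then show ?case using assms[unfolded per1_def, rule_format, of "x + of_int (i - 1)"] by (simp add: add.assoc)
qed auto

lemma per1_diff_int: "per1 f \<Longrightarrow> f (x - of_int m) = f x"
  using per1_add_int[of f x "- m"] by simp

lemma per1_frac: "per1 f \<Longrightarrow> f (frac x) = f x"
  by (simp add: frac_def per1_diff_int)

text \<open>The gauge integral gives direct access to the fundamental theorem of calculus and to
  integration of uniform limits. \<open>fund_dom_lborel\<close> connects it with the Lebesgue
  integral in \<open>fourier_coeff\<close>.\<close>

definition fc1 :: "(real \<Rightarrow> complex) \<Rightarrow> int \<Rightarrow> complex" where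
  "fc1 w k = integral {0..1} (\<lambda>t. w t * ee (- (of_int k * t)))"

text \<open>\<open>Arg\<close> jumps on the negative axis and \<open>Arg2pi\<close> on the positive
  one. The two branches differ by a multiple of 2 pi, which a periodic \<open>f\<close> does not
  see, so at each point a continuous branch can be chosen.\<close>

lemma continuous_on_circle_lift:
  assumes cont: "continuous_on UNIV (f :: real \<Rightarrow> complex)" and per: "per1 f"
  shows "continuous_on (sphere 0 1) (\<lambda>z. f (Arg z / (2 * pi)))"
proof -
  have eq: "f (Arg z / (2 * pi)) = f (Arg2pi z / (2 * pi))" for z
  proof (cases "z = 0")
    case False
    obtain n :: int where "Arg2pi z = Arg z + 2 * pi * of_int n"
    proof -
      have "cis (Arg z) = cis (Arg2pi z)"
      proof -
        have "z = of_real (norm z) * cis (Arg2pi z)"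
          using Arg2pi[of z] by (simp add: cis_conv_exp is_Arg_def)
        then have "sgn z = cis (Arg2pi z)"
          using False by (simp add: sgn_eq divide_eq_eq mult.commute)
        then show ?thesis using False cis_Arg by simp
      qed
      then have "sin (Arg2pi z) = sin (Arg z) \<and> cos (Arg2pi z) = cos (Arg z)"
        by (simp add: complex_eq_iff)
      then show thesis using that sin_cos_eq_iff by blast
    qed
    then have "Arg2pi z / (2 * pi) = Arg z / (2 * pi) + of_int n" by (simp add: field_simps)
    then show ?thesis using per1_add_int[OF per] by metis
  qed (simp add: Arg_zero Arg2pi_def)
  have "isCont (\<lambda>z. f (Arg z / (2 * pi))) z" if "z \<in> sphere 0 1" for z
  proof (cases "z \<in> \<real>\<^sub>\<le>\<^sub>0")
    case False
    show ?thesis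
      by (rule continuous_at_compose[of z "\<lambda>z. Arg z / (2 * pi)" f, unfolded o_def])
        (use cont False in \<open>auto intro!: continuous_intros continuous_at_Arg simp: continuous_on_eq_continuous_at\<close>)
  next
    case True
    then have "z \<notin> \<real>\<^sub>\<ge>\<^sub>0"
      using that by (auto simp: complex_nonpos_Reals_iff complex_nonneg_Reals_iff cmod_def)
    then have "isCont (\<lambda>z. f (Arg2pi z / (2 * pi))) z"
      by (intro continuous_at_compose[of z "\<lambda>z. Arg2pi z / (2 * pi)" f, unfolded o_def])
        (use cont in \<open>auto intro!: continuous_intros continuous_at_Arg2pi simp: continuous_on_eq_continuous_at\<close>)
    then show ?thesis by (simp add: eq)
  qed
  then show ?thesis by (simp add: continuous_at_imp_continuous_on)
qed

text \<open>The functions orthogonal to all \<open>ee (k t)\<close> form a module over the trigonometric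
  polynomials, so by Stone-Weierstrass on the circle they are orthogonal to themselves.\<close>

lemma fourier_unique:
  assumes cont: "continuous_on UNIV (f :: real \<Rightarrow> complex)" and per: "per1 f"
    and zero: "\<And>k. fc1 f k = 0"
  shows "f x = 0"
proof -
  define Z where "Z = {h. continuous_on UNIV h \<and> (\<forall>k. fc1 h k = 0)}"
  have int: "(\<lambda>t. h t * ee (- (of_int k * t))) integrable_on {0..1}" if "continuous_on UNIV h" for h k
    by (intro integrable_continuous_real continuous_intros continuous_on_subset[OF that]) auto
  have Zadd: "(\<lambda>t. h t + h' t) \<in> Z" if "h \<in> Z" "h' \<in> Z" for h h'
    using that unfolding Z_def fc1_def
    by (auto intro!: continuous_intros simp: distrib_right integral_add int)
  have Zmul: "(\<lambda>t. c * h t) \<in> Z" if "h \<in> Z" for c h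
    using that unfolding Z_def fc1_def
    by (auto intro!: continuous_intros simp: mult.assoc integral_mult_right)
  have Zee: "(\<lambda>t. ee (of_int m * t) * h t) \<in> Z" if "h \<in> Z" for m h
  proof -
    have "fc1 (\<lambda>t. ee (of_int m * t) * h t) k = fc1 h (k - m)" for k
      unfolding fc1_def
      by (rule arg_cong[where f = "integral {0..1}"]) (auto simp: fun_eq_iff ee_add[symmetric] algebra_simps)
    then show ?thesis using that by (auto simp: Z_def intro!: continuous_intros)
  qed
  \<comment> \<open>The induction keeps \<open>h\<close> arbitrary because a product of polynomials
    is applied one factor after the other. A real linear form of \<open>ee t\<close> is a
    combination of \<open>ee t\<close> and \<open>ee (- t)\<close>, which shift the frequency by
    one.\<close>
  have step: "(\<lambda>t. complex_of_real (p (ee t)) * h t) \<in> Z"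
    if "real_polynomial_function p" "h \<in> Z" for p :: "complex \<Rightarrow> real" and h
    using that
  proof (induction arbitrary: h)
    case (linear g)
    have g: "g z = Re z * g 1 + Im z * g \<i>" for z
    proof -
      interpret bounded_linear g by fact
      have "z = Re z *\<^sub>R 1 + Im z *\<^sub>R \<i>" by (simp add: complex_eq_iff)
      then have "g z = g (Re z *\<^sub>R 1 + Im z *\<^sub>R \<i>)" by simp
      then show ?thesis by (simp only: add scaleR real_scaleR_def)
    qed
    have e: "complex_of_real (g (ee t)) = (g 1 / 2 + g \<i> / (2 * \<i>)) * ee (of_int 1 * t)
        + (g 1 / 2 - g \<i> / (2 * \<i>)) * ee (of_int (-1) * t)" for t
      by (subst g) (simp add: ee_minus complex_eq_iff field_simps)
    have "(\<lambda>t. complex_of_real (g (ee t)) * h t) =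
      (\<lambda>t. (g 1 / 2 + g \<i> / (2 * \<i>)) * (ee (of_int 1 * t) * h t)
        + (g 1 / 2 - g \<i> / (2 * \<i>)) * (ee (of_int (-1) * t) * h t))"
      unfolding e by (simp add: algebra_simps)
    also have "\<dots> \<in> Z" by (intro Zadd Zmul Zee linear)
    finally show ?case .
  next
    case (const c)
    then show ?case by (simp add: Zmul)
  next
    case (add p q)
    then have "(\<lambda>t. complex_of_real (p (ee t)) * h t + complex_of_real (q (ee t)) * h t) \<in> Z"
      by (intro Zadd)
    then show ?case by (simp add: distrib_right)
  next
    case (mult p q)
    have "(\<lambda>t. complex_of_real (p (ee t)) * (complex_of_real (q (ee t)) * h t)) \<in> Z"
      using mult.IH(2)[OF mult.prems] by (rule mult.IH(1))
    then show ?case by (simp add: mult.assoc)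
  qed
  have fZ: "f \<in> Z" using cont zero by (simp add: Z_def)
  have cont01: "continuous_on {0..1} f" by (rule continuous_on_subset[OF cont]) auto
  obtain B where B0: "\<forall>y\<in>f ` {0..1}. norm y \<le> B" and "B > 0"
    using compact_imp_bounded[OF compact_continuous_image[OF cont01 compact_Icc]] bounded_pos by blast
  then have B: "norm (f t) \<le> B" if "t \<in> {0..1}" for t using that by blast
  have contg: "continuous_on (sphere 0 1) (\<lambda>z. cnj (f (Arg z / (2 * pi))))"
    by (intro continuous_intros continuous_on_circle_lift cont per)
  have lift: "f (Arg (ee t) / (2 * pi)) = f t" for t
  proof -
    have "cis (Arg (ee t)) = cis (2 * pi * t)"
      using cis_Arg[of "ee t"] by (simp add: ee_def sgn_div_norm)
    then have "sin (Arg (ee t)) = sin (2 * pi * t) \<and> cos (Arg (ee t)) = cos (2 * pi * t)"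
      by (simp add: complex_eq_iff)
    then obtain n :: int where "Arg (ee t) = 2 * pi * t + 2 * pi * of_int n"
      using sin_cos_eq_iff by blast
    then have "Arg (ee t) / (2 * pi) = t + of_int n" by (simp add: field_simps)
    then show ?thesis using per1_add_int[OF per] by simp
  qed
  let ?I = "integral {0..1} (\<lambda>t. f t * cnj (f t))"
  have int_ff: "(\<lambda>t. f t * cnj (f t)) integrable_on {0..1}"
    by (intro integrable_continuous_real continuous_intros cont01)
  \<comment> \<open>If \<open>p\<close> approximates the conjugate of \<open>f\<close> within
    \<open>e\<close>, then subtracting the vanishing integral of \<open>p f\<close> from that of
    |f|^2 leaves at most \<open>B * e\<close>.\<close>
  have *: "norm ?I \<le> B * e" if "e > 0" for e
  proof -
    obtain p where p: "polynomial_function p"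
      and pe: "\<And>z. z \<in> sphere 0 1 \<Longrightarrow> norm (cnj (f (Arg z / (2 * pi))) - p z) < e"
      using Stone_Weierstrass_polynomial_function[OF compact_sphere contg \<open>e > 0\<close>] by blast
    have "(\<lambda>t. complex_of_real (((\<lambda>z. Re (p z)) (ee t))) * f t) \<in> Z"
      by (intro step fZ) (use p in \<open>auto simp: polynomial_function_iff_Basis_inner Basis_complex_def\<close>)
    moreover have "(\<lambda>t. complex_of_real (((\<lambda>z. Im (p z)) (ee t))) * f t) \<in> Z"
      by (intro step fZ) (use p in \<open>auto simp: polynomial_function_iff_Basis_inner Basis_complex_def\<close>)
    ultimately have "(\<lambda>t. complex_of_real (Re (p (ee t))) * f t + \<i> * (complex_of_real (Im (p (ee t))) * f t)) \<in> Z"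
      by (intro Zadd Zmul) auto
    moreover have "(\<lambda>t. complex_of_real (Re (p (ee t))) * f t + \<i> * (complex_of_real (Im (p (ee t))) * f t))
        = (\<lambda>t. p (ee t) * f t)"
      by (auto simp: fun_eq_iff complex_eq_iff)
    ultimately have pf: "(\<lambda>t. p (ee t) * f t) \<in> Z" by simp
    then have "fc1 (\<lambda>t. p (ee t) * f t) 0 = 0" by (simp add: Z_def)
    then have p0: "integral {0..1} (\<lambda>t. p (ee t) * f t) = 0" by (simp add: fc1_def)
    have int_pf: "(\<lambda>t. p (ee t) * f t) integrable_on {0..1}"
      using pf int[of "\<lambda>t. p (ee t) * f t" 0] by (simp add: Z_def)
    have "?I = integral {0..1} (\<lambda>t. f t * cnj (f t) - p (ee t) * f t)"
      using p0 by (simp add: integral_diff int_ff int_pf)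
    also have "norm \<dots> \<le> integral {0..1} (\<lambda>t::real. B * e)"
    proof (rule integral_norm_bound_integral)
      show "(\<lambda>t. f t * cnj (f t) - p (ee t) * f t) integrable_on {0..1}"
        by (intro integrable_diff int_ff int_pf)
      fix t :: real assume t: "t \<in> {0..1}"
      have "norm (f t * cnj (f t) - p (ee t) * f t) = norm (f t) * norm (cnj (f t) - p (ee t))"
        by (simp add: norm_mult[symmetric] algebra_simps)
      also have "\<dots> \<le> B * e"
        using B[OF t] pe[of "ee t"] \<open>B > 0\<close> by (intro mult_mono) (auto simp: lift)
      finally show "norm (f t * cnj (f t) - p (ee t) * f t) \<le> B * e" .
    qed (auto intro!: integrable_continuous_real continuous_intros)
    finally show ?thesis by simp
  qed
  have "norm ?I \<le> 0"
  proof (rule field_le_epsilon)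
    fix e :: real assume "e > 0"
    then have "norm ?I \<le> B * (e / B)" using \<open>B > 0\<close> by (intro *) auto
    then show "norm ?I \<le> 0 + e" using \<open>B > 0\<close> by simp
  qed
  then have I0: "?I = 0" by simp
  have "integral {0..1} (\<lambda>t. (norm (f t))\<^sup>2) = 0"
  proof -
    have "complex_of_real (integral {0..1} (\<lambda>t. (norm (f t))\<^sup>2)) = integral {0..1} (\<lambda>t. complex_of_real ((norm (f t))\<^sup>2))"
      by (rule integral_linear[OF _ bounded_linear_of_real, unfolded o_def, symmetric])
        (auto intro!: integrable_continuous_real continuous_intros cont01)
    also have "\<dots> = ?I" by (simp only: complex_norm_square)
    finally show ?thesis using I0 by simp
  qed
  then have "\<forall>t\<in>{0..1}. (norm (f t))\<^sup>2 = 0"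
    by (subst (asm) integral_eq_0_iff) (intro continuous_intros cont01 | simp)+
  moreover have "frac x \<in> {0..1}" using frac_lt_1[of x] by (simp add: less_imp_le)
  ultimately have "f (frac x) = 0" by auto
  then show ?thesis using per1_frac[OF per] by simp
qed

section \<open>Absolutely convergent Fourier series on the circle\<close>

lemma wseries_continuous:
  fixes c :: "'k \<Rightarrow> complex" and \<phi> :: "'k \<Rightarrow> 'a::topological_space \<Rightarrow> complex"
  assumes c: "(\<lambda>k. norm (c k)) summable_on UNIV" and b: "\<And>k x. norm (\<phi> k x) \<le> 1"
    and cont: "\<And>k. continuous_on S (\<phi> k)"
    and s: "\<And>x. x \<in> S \<Longrightarrow> ((\<lambda>k. c k * \<phi> k x) has_sum s x) UNIV"
  shows "continuous_on S s"
proof -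
  have "uniform_limit S (\<lambda>X x. \<Sum>k\<in>X. c k * \<phi> k x) s (finite_subsets_at_top UNIV)"
    by (rule Weierstrass_m_test_general'[OF _ s c])
      (use b in \<open>auto simp: norm_mult intro!: mult_left_le\<close>)
  then show ?thesis
    by (rule uniform_limit_theorem[rotated]) (auto intro!: always_eventually continuous_intros cont)
qed

text \<open>Termwise integration by uniform convergence of unordered sums. The index type and the
  box are arbitrary, so that frequencies in one and in two dimensions are covered at once.\<close>

lemma wseries_integral:
  fixes c :: "'k \<Rightarrow> complex" and \<phi> :: "'k \<Rightarrow> 'a::euclidean_space \<Rightarrow> complex"
  assumes c: "(\<lambda>k. norm (c k)) summable_on UNIV" and b: "\<And>k x. norm (\<phi> k x) \<le> 1"
    and cont: "\<And>k. continuous_on (cbox a b) (\<phi> k)"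
    and s: "\<And>x. x \<in> cbox a b \<Longrightarrow> ((\<lambda>k. c k * \<phi> k x) has_sum s x) UNIV"
  shows "((\<lambda>k. c k * integral (cbox a b) (\<phi> k)) has_sum integral (cbox a b) s) UNIV"
proof -
  have u: "uniform_limit (cbox a b) (\<lambda>X x. \<Sum>k\<in>X. c k * \<phi> k x) s (finite_subsets_at_top UNIV)"
    by (rule Weierstrass_m_test_general'[OF _ s c])
      (use b in \<open>auto simp: norm_mult intro!: mult_left_le\<close>)
  obtain I J where I: "\<And>X. ((\<lambda>x. \<Sum>k\<in>X. c k * \<phi> k x) has_integral I X) (cbox a b)"
    and J: "(s has_integral J) (cbox a b)" and lim: "(I \<longlongrightarrow> J) (finite_subsets_at_top UNIV)"
    by (rule uniform_limit_integral_cbox[OF u]) (auto intro!: continuous_intros cont)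
  have "I X = (\<Sum>k\<in>X. c k * integral (cbox a b) (\<phi> k))" if "finite X" for X
  proof -
    have "((\<lambda>x. \<Sum>k\<in>X. c k * \<phi> k x) has_integral (\<Sum>k\<in>X. c k * integral (cbox a b) (\<phi> k))) (cbox a b)"
      by (intro has_integral_sum that has_integral_mult_right integrable_integral integrable_continuous cont)
    then show ?thesis using I has_integral_unique by blast
  qed
  then have "(sum (\<lambda>k. c k * integral (cbox a b) (\<phi> k)) \<longlongrightarrow> J) (finite_subsets_at_top UNIV)"
    using lim by (auto elim!: Lim_transform_eventually intro!: eventually_finite_subsets_at_top_weakI)
  then show ?thesis using J by (simp add: has_sum_def integral_unique)
qed

lemma integral_ee_int:
  "integral {0..1} (\<lambda>t. ee (of_int m * t)) = (if m = 0 then 1 else 0)"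
proof (cases "m = 0")
  case False
  let ?F = "\<lambda>t::real. ee (of_int m * t) / (2 * pi * \<i> * of_int m)"
  have "((\<lambda>t. ee (of_int m * t)) has_integral (?F 1 - ?F 0)) {0..1}"
  proof (rule fundamental_theorem_of_calculus)
    fix x :: real
    have "((\<lambda>t. ee (of_int m * t) / (2 * pi * \<i> * of_int m)) has_vector_derivative
        (2 * pi * \<i> * of_int m * ee (of_int m * x)) / (2 * pi * \<i> * of_int m)) (at x within {0..1})"
      using has_vector_derivative_divide[OF has_vector_derivative_ee[of "of_int m" x "{0..1}"], of "2 * pi * \<i> * of_int m"]
      by simp
    then show "(?F has_vector_derivative ee (of_int m * x)) (at x within {0..1})"
      using False by simp
  qed simp
  then show ?thesis using False by (simp add: integral_unique)
qed simp

text \<open>Membership in the Wiener algebra as a relation: coefficients can be produced by algebra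
  on series and are identified with \<open>fc1 u\<close> afterwards, by
  \<open>wiener_fc1\<close>.\<close>

definition wiener :: "(real \<Rightarrow> complex) \<Rightarrow> (int \<Rightarrow> complex) \<Rightarrow> bool" where
  "wiener u U \<longleftrightarrow> (\<lambda>k. norm (U k)) summable_on UNIV \<and>
     (\<forall>x. ((\<lambda>k. U k * ee (of_int k * x)) has_sum u x) UNIV)"

lemma wiener_continuous: "wiener u U \<Longrightarrow> continuous_on S u"
  unfolding wiener_def
  by (rule wseries_continuous[where c = U and \<phi> = "\<lambda>k x. ee (of_int k * x)"]) (auto intro!: continuous_intros)

lemma wiener_per1: assumes "wiener u U" shows "per1 u"
  unfolding per1_def
proof
  fix x
  have "((\<lambda>k. U k * ee (of_int k * (x + 1))) has_sum u (x + 1)) UNIV"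
    using assms by (simp add: wiener_def)
  then have "((\<lambda>k. U k * ee (of_int k * x)) has_sum u (x + 1)) UNIV"
    by (simp add: distrib_left)
  then show "u (x + 1) = u x"
    using assms has_sum_unique unfolding wiener_def by blast
qed

lemma wiener_fc1: assumes "wiener u U" shows "fc1 u = U"
proof
  fix k
  have "((\<lambda>j. U j * integral (cbox 0 1) (\<lambda>t. ee (of_int j * t) * ee (- (of_int k * t)))) has_sum
     integral (cbox 0 1) (\<lambda>t. u t * ee (- (of_int k * t)))) UNIV"
    using assms unfolding wiener_def
    by (intro wseries_integral)
      (auto simp: norm_mult mult.assoc[symmetric] intro!: continuous_intros has_sum_cmult_left)
  moreover have "integral {0..1} (\<lambda>t. ee (of_int j * t) * ee (- (of_int k * t))) = (if j = k then 1 else 0)" for j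
    using integral_ee_int[of "j - k"] by (simp add: ee_add[symmetric] algebra_simps)
  ultimately have "((\<lambda>j. if j = k then U j else 0) has_sum fc1 u k) UNIV"
    by (simp add: fc1_def if_distrib cong: if_cong)
  moreover have "((\<lambda>j. if j = k then U j else 0) has_sum U k) UNIV"
    using has_sum_finite_neutralI[of "{k}" UNIV "\<lambda>j. if j = k then U j else 0" "U k"] by simp
  ultimately show "fc1 u k = U k" by (rule has_sum_unique)
qed

lemma wiener_series:
  assumes "(\<lambda>k. norm (U k)) summable_on (UNIV :: int set)"
  shows "wiener (\<lambda>x. \<Sum>\<^sub>\<infinity>k. U k * ee (of_int k * x)) U"
  unfolding wiener_def
proof (intro conjI allI assms)
  fix x
  have "(\<lambda>k. norm (U k * ee (of_int k * x))) summable_on UNIV" using assms by (simp add: norm_mult)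
  then show "((\<lambda>k. U k * ee (of_int k * x)) has_sum (\<Sum>\<^sub>\<infinity>k. U k * ee (of_int k * x))) UNIV"
    by (rule has_sum_infsum[OF abs_summable_summable])
qed

lemma fc1_diff:
  assumes "continuous_on UNIV u" "continuous_on UNIV v"
  shows "fc1 (\<lambda>t. u t - v t) k = fc1 u k - fc1 v k"
  unfolding fc1_def left_diff_distrib
  by (rule integral_diff; intro integrable_continuous_real continuous_intros continuous_on_subset[OF assms(1)]
      continuous_on_subset[OF assms(2)]) auto

text \<open>The sum of the Fourier series of \<open>w\<close> is continuous and has the same
  coefficients as \<open>w\<close>, so \<open>fourier_unique\<close> applies to the
  difference.\<close>

lemma fourier_inversion:
  assumes cont: "continuous_on UNIV w" and per: "per1 w" and sum: "(\<lambda>k. norm (fc1 w k)) summable_on UNIV"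
  shows "wiener w (fc1 w)"
proof -
  define s where "s = (\<lambda>x. \<Sum>\<^sub>\<infinity>k. fc1 w k * ee (of_int k * x))"
  have s: "wiener s (fc1 w)" unfolding s_def by (rule wiener_series[OF sum])
  have "w x - s x = 0" for x
    by (rule fourier_unique[of "\<lambda>x. w x - s x"])
      (use per wiener_per1[OF s] in \<open>auto intro!: continuous_intros cont wiener_continuous[OF s]
        simp: fc1_diff cont wiener_continuous[OF s] wiener_fc1[OF s] per1_def\<close>)
  then have "w = s" by auto
  then show ?thesis using s by simp
qed

lemma wiener_norm_le:
  assumes "wiener u U" shows "norm (u x) \<le> (\<Sum>\<^sub>\<infinity>k. norm (U k))"
proof -
  have "((\<lambda>k. U k * ee (of_int k * x)) has_sum u x) UNIV" "(\<lambda>k. norm (U k)) summable_on UNIV"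
    using assms by (auto simp: wiener_def)
  then have "norm (\<Sum>\<^sub>\<infinity>k. U k * ee (of_int k * x)) \<le> (\<Sum>\<^sub>\<infinity>k. norm (U k * ee (of_int k * x)))"
    by (intro norm_infsum_bound) (simp add: norm_mult)
  then show ?thesis using infsumI[OF \<open>((\<lambda>k. U k * ee (of_int k * x)) has_sum u x) UNIV\<close>] by (simp add: norm_mult)
qed

section \<open>Absolutely convergent Fourier series on the torus\<close>

definition wiener2 :: "(real \<times> real \<Rightarrow> complex) \<Rightarrow> (int \<times> int \<Rightarrow> complex) \<Rightarrow> bool" where
  "wiener2 f c \<longleftrightarrow> (\<lambda>k. norm (c k)) summable_on UNIV \<and>
     (\<forall>q p. ((\<lambda>k. c k * ee (q * of_int (snd k) - p * of_int (fst k))) has_sum f (q, p)) UNIV)"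

text \<open>The half-open and the closed unit square differ by two edges of measure zero, and on the
  closed square a continuous function has the same Lebesgue and gauge integral.\<close>

lemma fund_dom_lborel: "set_lebesgue_integral lborel fund_dom g = integral (cbox (0, 0) (1, 1)) g"
  if cont: "continuous_on UNIV g" for g :: "real \<times> real \<Rightarrow> complex"
proof -
  have fd: "fund_dom \<in> sets borel"
  proof -
    have "fund_dom = cbox (0, 0) (1, 1) - (cbox (1, 0) (1, 1) \<union> cbox (0, 1) (1, 1))"
      by (auto simp: fund_dom_def cbox_Pair_eq)
    show ?thesis unfolding \<open>fund_dom = _\<close> by (intro sets.Diff sets.Un borel_closed closed_cbox)
  qed
  have gm: "g \<in> borel_measurable borel" using cont by (rule borel_measurable_continuous_onI)
  have null: "cbox (1, 0) (1, 1) \<union> cbox (0, 1) (1, 1) \<in> null_sets (lborel :: (real \<times> real) measure)"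
    by (intro null_sets.Un; simp add: null_sets_def emeasure_lborel_cbox_eq Basis_prod_def)
  have "(LINT x:cbox (0,0) (1,1)|lborel. g x) = (LINT x:fund_dom|lborel. g x)"
  proof (rule set_integral_cong_set)
    show "AE x in lborel. (x \<in> fund_dom) = (x \<in> cbox (0, 0) (1, 1))"
      by (rule AE_I'[OF null]) (auto simp: fund_dom_def cbox_Pair_eq)
  qed (use gm fd in \<open>simp_all add: set_borel_measurable_def\<close>)
  moreover have "set_integrable lborel (cbox (0,0) (1,1)) g"
    unfolding set_integrable_def
    by (rule borel_integrable_compact) (auto intro: continuous_on_subset[OF cont])
  ultimately show ?thesis using set_borel_integral_eq_integral(2) by metis
qed

lemma fourier_coeff_cbox:
  assumes "continuous_on UNIV f"
  shows "fourier_coeff f (k1, k2) =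
    integral (cbox (0, 0) (1, 1)) (\<lambda>x. f x * ee (- (fst x * of_int k2 - snd x * of_int k1)))"
proof -
  have "(\<lambda>(q, p). f (q, p) * cis (- 2 * pi * (q * real_of_int k2 - p * real_of_int k1))) =
    (\<lambda>x. f x * ee (- (fst x * of_int k2 - snd x * of_int k1)))"
    by (auto simp: ee_def fun_eq_iff algebra_simps)
  then show ?thesis unfolding fourier_coeff_def prod.case
    by (simp only:) (rule fund_dom_lborel, intro continuous_intros assms)
qed

lemma fourier_coeff_fc1:
  assumes cont: "continuous_on UNIV f"
  shows "fourier_coeff f (k1, k2) = fc1 (\<lambda>p. fc1 (\<lambda>q. f (q, p)) k2) (- k1)"
proof -
  have c: "continuous_on S (\<lambda>x. f (g x, h x))" if "continuous_on S g" "continuous_on S h" for g h :: "'b::topological_space \<Rightarrow> real" and S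
    by (rule continuous_on_compose2[OF cont]) (auto intro!: continuous_intros that)
  let ?h = "\<lambda>x. f x * ee (- (fst x * of_int k2 - snd x * of_int k1))"
  have "integral (cbox (0, 0) (1, 1)) ?h = integral (cbox 0 1) (\<lambda>q. integral (cbox 0 1) (\<lambda>p. ?h (q, p)))"
    by (rule integral_prod_continuous) (auto intro!: continuous_intros continuous_on_subset[OF cont])
  also have "\<dots> = integral (cbox 0 1) (\<lambda>p. integral (cbox 0 1) (\<lambda>q. ?h (q, p)))"
    by (rule integral_swap_continuous) (simp only: case_prod_unfold fst_conv snd_conv, intro continuous_intros c)
  also have "\<dots> = fc1 (\<lambda>p. fc1 (\<lambda>q. f (q, p)) k2) (- k1)"
    unfolding fc1_def integral_mult_left[symmetric]
    by (simp add: ee_add[symmetric] mult.assoc algebra_simps)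
  finally show ?thesis by (simp add: fourier_coeff_cbox cont)
qed

lemma continuous_on_pair:
  assumes "continuous_on UNIV f" "continuous_on S g" "continuous_on S h"
  shows "continuous_on S (\<lambda>x. f (g x, h x))"
  by (rule continuous_on_compose2[OF assms(1)]) (auto intro!: continuous_intros assms)

lemma wiener2_abs: "wiener2 f c \<Longrightarrow> (\<lambda>k. norm (c k)) summable_on UNIV"
  by (simp add: wiener2_def)

lemma wiener2_has_sum:
  "wiener2 f c \<Longrightarrow> ((\<lambda>k. c k * ee (fst x * of_int (snd k) - snd x * of_int (fst k))) has_sum f x) UNIV"
  by (cases x) (simp add: wiener2_def)

lemma wiener2_continuous: "wiener2 f c \<Longrightarrow> continuous_on S f"
  by (rule wseries_continuous[OF wiener2_abs _ _ wiener2_has_sum])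
    (simp, simp, intro continuous_intros, simp)

lemma wiener2_periodic2: assumes "wiener2 f c" shows "periodic2 f"
  unfolding periodic2_def
proof (intro allI conjI)
  fix q p
  have e1: "ee ((q + 1) * of_int a - p * of_int b) = ee (q * of_int a - p * of_int b)" for a b
    using ee_add_int[of "q * of_int a - p * of_int b" a] by (simp add: algebra_simps)
  have e2: "ee (q * of_int a - (p + 1) * of_int b) = ee (q * of_int a - p * of_int b)" for a b
    using ee_add_int[of "q * of_int a - p * of_int b" "- b"] by (simp add: algebra_simps)
  have h: "((\<lambda>k. c k * ee (q * of_int (snd k) - p * of_int (fst k))) has_sum f (q, p)) UNIV" for q p
    using assms by (simp add: wiener2_def)
  show "f (q + 1, p) = f (q, p)" using has_sum_unique[OF h[of "q + 1" p, unfolded e1] h] .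
  show "f (q, p + 1) = f (q, p)" using has_sum_unique[OF h[of q "p + 1", unfolded e2] h] .
qed

lemma wiener2_fourier_coeff: assumes "wiener2 f c" shows "fourier_coeff f = c"
proof (rule ext)
  fix m :: "int \<times> int"
  obtain k1 k2 where m: "m = (k1, k2)" by force
  let ?\<psi> = "\<lambda>x :: real \<times> real. ee (- (fst x * of_int k2 - snd x * of_int k1))"
  let ?\<phi> = "\<lambda>(j :: int \<times> int) (x :: real \<times> real). ee (fst x * of_int (snd j) - snd x * of_int (fst j)) * ?\<psi> x"
  have "((\<lambda>j. c j * integral (cbox (0, 0) (1, 1)) (?\<phi> j)) has_sum
     integral (cbox (0, 0) (1, 1)) (\<lambda>x. f x * ?\<psi> x)) UNIV"
    by (rule wseries_integral[OF wiener2_abs[OF assms]])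
      (simp add: norm_mult, intro continuous_intros,
        simp only: mult.assoc[symmetric], intro has_sum_cmult_left wiener2_has_sum[OF assms])
  moreover have "integral (cbox (0, 0) (1, 1)) (?\<phi> j) = (if j = (k1, k2) then 1 else 0)" for j
  proof -
    have "integral (cbox (0, 0) (1, 1)) (?\<phi> j) = integral (cbox 0 1) (\<lambda>q. integral (cbox 0 1) (\<lambda>p. ?\<phi> j (q, p)))"
      by (rule integral_prod_continuous) (auto intro!: continuous_intros)
    also have "\<dots> = integral (cbox 0 1) (\<lambda>q. integral (cbox 0 1) (\<lambda>p. ee (of_int (snd j - k2) * q) * ee (of_int (k1 - fst j) * p)))"
      by (simp add: ee_add[symmetric] algebra_simps)
    also have "\<dots> = (if snd j = k2 then 1 else 0) * (if fst j = k1 then 1 else 0)"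
      using integral_ee_int[of "snd j - k2"] integral_ee_int[of "k1 - fst j"]
      by (auto simp: integral_mult_right integral_mult_left)
    finally show ?thesis by (auto simp: prod_eq_iff)
  qed
  ultimately have "((\<lambda>j. c j * (if j = (k1, k2) then 1 else 0)) has_sum fourier_coeff f m) UNIV"
    by (simp only: m fourier_coeff_cbox[OF wiener2_continuous[OF assms]])
  then have "((\<lambda>j. if j = m then c j else 0) has_sum fourier_coeff f m) UNIV"
    by (simp add: m if_distrib cong: if_cong)
  moreover have "((\<lambda>j. if j = m then c j else 0) has_sum c m) UNIV"
    using has_sum_finite_neutralI[of "{m}" UNIV "\<lambda>j. if j = m then c j else 0" "c m"] by simp
  ultimately show "fourier_coeff f m = c m" by (rule has_sum_unique)
qed

lemma fc1_param_continuous: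
  assumes "continuous_on UNIV f"
  shows "continuous_on UNIV (\<lambda>p. fc1 (\<lambda>q. f (q, p)) k)"
  unfolding fc1_def interval_cbox
  by (rule integral_continuous_on_param)
    (auto simp: case_prod_unfold intro!: continuous_intros continuous_on_pair assms)

text \<open>Uniqueness in one variable is used twice: first for the q-coefficients as functions of
  \<open>p\<close>, then in \<open>q\<close> for each fixed \<open>p\<close>.\<close>

lemma fourier_unique2:
  assumes cont: "continuous_on UNIV f" and per: "periodic2 f" and zero: "\<And>k. fourier_coeff f k = 0"
  shows "f x = 0"
proof -
  have 1: "fc1 (\<lambda>q. f (q, p)) k2 = 0" for p k2
  proof (rule fourier_unique[of "\<lambda>p. fc1 (\<lambda>q. f (q, p)) k2"])
    show "per1 (\<lambda>p. fc1 (\<lambda>q. f (q, p)) k2)" using per by (simp add: per1_def periodic2_def)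
    show "fc1 (\<lambda>p. fc1 (\<lambda>q. f (q, p)) k2) k = 0" for k
      using fourier_coeff_fc1[OF cont, of "- k" k2] zero by simp
  qed (intro fc1_param_continuous cont)
  have "f (q, p) = 0" for q p
    by (rule fourier_unique[of "\<lambda>q. f (q, p)"])
      (use per 1 in \<open>auto simp: per1_def periodic2_def intro!: continuous_on_pair cont continuous_intros\<close>)
  then show ?thesis by (cases x) auto
qed

lemma fourier_coeff_diff:
  assumes "continuous_on UNIV u" "continuous_on UNIV v"
  shows "fourier_coeff (\<lambda>t. u t - v t) k = fourier_coeff u k - fourier_coeff v k"
proof -
  obtain k1 k2 where k: "k = (k1, k2)" by force
  have c: "continuous_on UNIV (\<lambda>t. u t - v t)" by (intro continuous_intros assms)
  show ?thesis unfolding k fourier_coeff_cbox[OF assms(1)] fourier_coeff_cbox[OF assms(2)] fourier_coeff_cbox[OF c]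
    left_diff_distrib
    by (rule integral_diff; intro integrable_continuous continuous_intros continuous_on_subset[OF assms(1)]
      continuous_on_subset[OF assms(2)]) auto
qed

lemma wiener2_series:
  assumes "(\<lambda>k. norm (c k)) summable_on (UNIV :: (int \<times> int) set)"
  shows "wiener2 (\<lambda>x. \<Sum>\<^sub>\<infinity>k. c k * ee (fst x * of_int (snd k) - snd x * of_int (fst k))) c"
  unfolding wiener2_def
proof (intro conjI allI assms)
  fix q p
  have "(\<lambda>k. norm (c k * ee (q * of_int (snd k) - p * of_int (fst k)))) summable_on UNIV"
    using assms by (simp add: norm_mult)
  from has_sum_infsum[OF abs_summable_summable[OF this]]
  show "((\<lambda>k. c k * ee (q * of_int (snd k) - p * of_int (fst k))) has_sum
    (\<Sum>\<^sub>\<infinity>k. c k * ee (fst (q, p) * of_int (snd k) - snd (q, p) * of_int (fst k)))) UNIV" by simp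
qed

lemma fourier_inversion2:
  assumes cont: "continuous_on UNIV f" and per: "periodic2 f"
    and sum: "(\<lambda>k. norm (fourier_coeff f k)) summable_on UNIV"
  shows "wiener2 f (fourier_coeff f)"
proof -
  define s where "s = (\<lambda>x. \<Sum>\<^sub>\<infinity>k. fourier_coeff f k * ee (fst x * of_int (snd k) - snd x * of_int (fst k)))"
  have s: "wiener2 s (fourier_coeff f)" unfolding s_def by (rule wiener2_series[OF sum])
  have "f x - s x = 0" for x
    by (rule fourier_unique2[of "\<lambda>x. f x - s x"])
      (use per wiener2_periodic2[OF s] in \<open>auto intro!: continuous_intros cont wiener2_continuous[OF s]
        simp: fourier_coeff_diff cont wiener2_continuous[OF s] wiener2_fourier_coeff[OF s] periodic2_def\<close>)
  then have "f = s" by auto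
  then show ?thesis using s by simp
qed

text \<open>The phase q k2 - p k1 is the symplectic pairing of the Weyl quantisation. This is why
  \<open>U\<close> is read at the second index and \<open>V\<close> at minus the first.\<close>

lemma wiener2_tensor:
  assumes u: "wiener u U" and v: "wiener v V"
  shows "wiener2 (\<lambda>(q, p). u q * v p) (\<lambda>(k1, k2). V (- k1) * U k2)"
proof -
  have V': "(\<lambda>k. norm (V (- k))) summable_on UNIV"
    using v summable_on_reindex_bij_betw[of uminus UNIV UNIV "\<lambda>k. norm (V k)"]
    by (auto simp: wiener_def bij_uminus)
  have vs: "((\<lambda>k. V (- k) * ee (- (p * of_int k))) has_sum v p) UNIV" for p
    using v has_sum_reindex_bij_betw[of uminus UNIV UNIV "\<lambda>k. V k * ee (of_int k * p)" "v p"]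
    by (auto simp: wiener_def bij_uminus mult.commute)
  have us: "((\<lambda>k. U k * ee (q * of_int k)) has_sum u q) UNIV" for q
    using u by (simp add: wiener_def mult.commute)
  have U': "(\<lambda>k. norm (U k)) summable_on UNIV" using u by (simp add: wiener_def)
  have abs: "(\<lambda>k. norm (V (- fst k) * U (snd k))) summable_on UNIV"
  proof -
    have "(\<lambda>k. norm (V (- fst k) * U (snd k))) summable_on Sigma UNIV (\<lambda>_. UNIV)"
      unfolding Infinite_Sum.abs_summable_on_Sigma_iff
      by (auto simp: norm_mult infsum_cmult_right' abs_mult intro!: summable_on_cmult_right summable_on_cmult_left U' V')
    then show ?thesis by simp
  qed
  show ?thesis unfolding wiener2_def
  proof (intro conjI allI)
    show "(\<lambda>k. norm (case k of (k1, k2) \<Rightarrow> V (- k1) * U k2)) summable_on UNIV"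
      using abs by (simp add: case_prod_unfold)
    fix q p
    have e: "V (- a) * U b * ee (q * of_int b - p * of_int a) =
       (V (- a) * ee (- (p * of_int a))) * (U b * ee (q * of_int b))" for a b
      by (simp add: ee_add[of "q * of_int b" "- (p * of_int a)", simplified])
    have "(\<lambda>k. norm ((case k of (k1, k2) \<Rightarrow> V (- k1) * U k2) * ee (q * of_int (snd k) - p * of_int (fst k)))) summable_on UNIV"
      using abs by (simp add: norm_mult case_prod_unfold)
    then have s: "(\<lambda>k. ((case k of (k1, k2) \<Rightarrow> V (- k1) * U k2) * ee (q * of_int (snd k) - p * of_int (fst k)))) summable_on UNIV"
      by (rule abs_summable_summable)
    then have s': "(\<lambda>(a, b). V (- a) * U b * ee (q * of_int b - p * of_int a)) summable_on UNIV \<times> UNIV"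
      by (simp add: case_prod_unfold)
    have "((\<lambda>(a, b). V (- a) * U b * ee (q * of_int b - p * of_int a)) has_sum (v p * u q)) (Sigma UNIV (\<lambda>_. UNIV))"
    proof (rule has_sum_SigmaI)
      show "((\<lambda>b. case (a, b) of (a, b) \<Rightarrow> V (- a) * U b * ee (q * of_int b - p * of_int a)) has_sum
          (V (- a) * ee (- (p * of_int a))) * u q) UNIV" for a
        unfolding prod.case e by (rule has_sum_cmult_right[OF us])
      show "((\<lambda>a. V (- a) * ee (- (p * of_int a)) * u q) has_sum v p * u q) UNIV"
        by (rule has_sum_cmult_left[OF vs])
    qed (use s' in simp)
    then show "((\<lambda>k. (case k of (k1, k2) \<Rightarrow> V (- k1) * U k2) * ee (q * of_int (snd k) - p * of_int (fst k))) has_sum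
        (case (q, p) of (q, p) \<Rightarrow> u q * v p)) UNIV"
      by (simp add: case_prod_unfold mult.commute[of "u q"])
  qed
qed

section \<open>Norm bounds for matrices\<close>

lemma mult_mat_vec_index:
  assumes "A \<in> carrier_mat N N" "v \<in> carrier_vec N" "i < N"
  shows "vec_index (A *\<^sub>v v) i = (\<Sum>j<N. A $$ (i, j) * vec_index v j)"
  using assms by (simp add: scalar_prod_def lessThan_atLeast0)

lemma vec_norm2_carrier: "v \<in> carrier_vec N \<Longrightarrow> vec_norm2 v = L2_set (\<lambda>i. cmod (vec_index v i)) {..<N}"
  by (auto simp: vec_norm2_def)

lemma vec_norm2_nonneg [simp]: "0 \<le> vec_norm2 v"
  by (simp add: vec_norm2_def L2_set_nonneg)

lemma vec_norm2_add:
  assumes "u \<in> carrier_vec N" "v \<in> carrier_vec N"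
  shows "vec_norm2 (u + v) \<le> vec_norm2 u + vec_norm2 v"
proof -
  have "vec_norm2 (u + v) = L2_set (\<lambda>i. cmod (vec_index u i + vec_index v i)) {..<N}"
    using assms by (subst vec_norm2_carrier[of _ N]) (auto intro!: L2_set_cong)
  also have "\<dots> \<le> L2_set (\<lambda>i. cmod (vec_index u i) + cmod (vec_index v i)) {..<N}"
    by (rule L2_set_mono) (auto simp: norm_triangle_ineq)
  also have "\<dots> \<le> vec_norm2 u + vec_norm2 v"
    unfolding vec_norm2_carrier[OF assms(1)] vec_norm2_carrier[OF assms(2)] by (rule L2_set_triangle_ineq)
  finally show ?thesis .
qed

lemma vec_norm2_smult: "vec_norm2 (a \<cdot>\<^sub>v v) = cmod a * vec_norm2 v"
  by (auto simp: vec_norm2_def norm_mult L2_set_right_distrib intro!: L2_set_cong)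

text \<open>\<open>op_norm\<close> is a supremum of reals, which is awkward to handle before
  boundedness is known. An inequality with an explicit constant composes directly under sums and
  products, and \<open>op_norm_le\<close> converts it at the end.\<close>

definition op_bound :: "nat \<Rightarrow> complex mat \<Rightarrow> real \<Rightarrow> bool" where
  "op_bound N A c \<longleftrightarrow> A \<in> carrier_mat N N \<and> 0 \<le> c \<and>
     (\<forall>v\<in>carrier_vec N. vec_norm2 (A *\<^sub>v v) \<le> c * vec_norm2 v)"

lemma op_bound_carrier: "op_bound N A c \<Longrightarrow> A \<in> carrier_mat N N"
  by (simp add: op_bound_def)

lemma op_bound_nonneg: "op_bound N A c \<Longrightarrow> 0 \<le> c"
  by (simp add: op_bound_def)

lemma bdD: "op_bound N A c \<Longrightarrow> v \<in> carrier_vec N \<Longrightarrow> vec_norm2 (A *\<^sub>v v) \<le> c * vec_norm2 v"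
  by (simp add: op_bound_def)

lemma op_bound_mono: "op_bound N A c \<Longrightarrow> c \<le> d \<Longrightarrow> op_bound N A d"
  unfolding op_bound_def by (meson mult_right_mono order_trans vec_norm2_nonneg)

lemma op_norm_le: assumes "op_bound N A c" shows "op_norm A \<le> c"
  unfolding op_norm_def
proof (rule cSup_least)
  have "0\<^sub>v N \<in> carrier_vec (dim_col A) \<and> vec_norm2 (0\<^sub>v N) \<le> 1"
    using op_bound_carrier[OF assms] by (simp add: vec_norm2_def L2_set_def)
  then show "{vec_norm2 (A *\<^sub>v v) | v. v \<in> carrier_vec (dim_col A) \<and> vec_norm2 v \<le> 1} \<noteq> {}"
    by blast
next
  fix x assume "x \<in> {vec_norm2 (A *\<^sub>v v) | v. v \<in> carrier_vec (dim_col A) \<and> vec_norm2 v \<le> 1}"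
  then obtain v where v: "x = vec_norm2 (A *\<^sub>v v)" "v \<in> carrier_vec (dim_col A)" "vec_norm2 v \<le> 1" by blast
  then have "x \<le> c * vec_norm2 v" using op_bound_carrier[OF assms] by (auto intro!: bdD[OF assms])
  also have "\<dots> \<le> c" using v(3) op_bound_nonneg[OF assms] by (simp add: mult_left_le)
  finally show "x \<le> c" .
qed

lemma op_bound_add: assumes "op_bound N A c" "op_bound N B d" shows "op_bound N (A + B) (c + d)"
  unfolding op_bound_def
proof (intro conjI ballI)
  fix v :: "complex vec" assume v: "v \<in> carrier_vec N"
  note c = op_bound_carrier[OF assms(1)] op_bound_carrier[OF assms(2)]
  have "vec_norm2 ((A + B) *\<^sub>v v) = vec_norm2 (A *\<^sub>v v + B *\<^sub>v v)"
    using c v by (simp add: add_mult_distrib_mat_vec)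
  also have "\<dots> \<le> vec_norm2 (A *\<^sub>v v) + vec_norm2 (B *\<^sub>v v)"
    by (rule vec_norm2_add[of _ N]) (use c v in auto)
  also have "\<dots> \<le> (c + d) * vec_norm2 v"
    using bdD[OF assms(1) v] bdD[OF assms(2) v] by (simp add: distrib_right)
  finally show "vec_norm2 ((A + B) *\<^sub>v v) \<le> (c + d) * vec_norm2 v" .
qed (use assms in \<open>auto simp: op_bound_def\<close>)

lemma op_bound_mult: assumes "op_bound N A c" "op_bound N B d" shows "op_bound N (A * B) (c * d)"
  unfolding op_bound_def
proof (intro conjI ballI)
  fix v :: "complex vec" assume v: "v \<in> carrier_vec N"
  note car = op_bound_carrier[OF assms(1)] op_bound_carrier[OF assms(2)]
  have "vec_norm2 ((A * B) *\<^sub>v v) = vec_norm2 (A *\<^sub>v (B *\<^sub>v v))"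
    using car v by (simp add: assoc_mult_mat_vec[of _ N N _ N])
  also have "\<dots> \<le> c * vec_norm2 (B *\<^sub>v v)"
    by (rule bdD[OF assms(1)]) (use car v in auto)
  also have "\<dots> \<le> c * (d * vec_norm2 v)"
    by (rule mult_left_mono[OF bdD[OF assms(2) v] op_bound_nonneg[OF assms(1)]])
  finally show "vec_norm2 ((A * B) *\<^sub>v v) \<le> c * d * vec_norm2 v" by (simp add: mult.assoc)
qed (use assms in \<open>auto simp: op_bound_def\<close>)

lemma op_bound_smult: assumes "op_bound N A c" shows "op_bound N (a \<cdot>\<^sub>m A) (cmod a * c)"
  unfolding op_bound_def
proof (intro conjI ballI)
  fix v :: "complex vec" assume v: "v \<in> carrier_vec N"
  have "(a \<cdot>\<^sub>m A) *\<^sub>v v = a \<cdot>\<^sub>v (A *\<^sub>v v)"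
    using v op_bound_carrier[OF assms] by auto
  then show "vec_norm2 ((a \<cdot>\<^sub>m A) *\<^sub>v v) \<le> cmod a * c * vec_norm2 v"
    using bdD[OF assms v] by (simp add: vec_norm2_smult mult_left_mono mult.assoc)
qed (use assms in \<open>auto simp: op_bound_def\<close>)

lemma op_bound_uminus: assumes "op_bound N A c" shows "op_bound N (- A) c"
proof -
  have "- A = (-1) \<cdot>\<^sub>m A" by auto
  then show ?thesis using op_bound_smult[OF assms, of "-1"] by simp
qed

lemma op_bound_minus: assumes "op_bound N A c" "op_bound N B d" shows "op_bound N (A - B) (c + d)"
proof -
  have "A - B = A + - B" using op_bound_carrier[OF assms(1)] op_bound_carrier[OF assms(2)] by auto
  then show ?thesis using op_bound_add[OF assms(1) op_bound_uminus[OF assms(2)]] by simp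
qed

lemma op_bound_zero: "op_bound N (0\<^sub>m N N) 0"
  by (auto simp: op_bound_def vec_norm2_def L2_set_def)

lemma op_bound_one: "op_bound N (1\<^sub>m N) 1"
  by (auto simp: op_bound_def)

text \<open>Each row and each column has at most one nonzero entry, so distinct coordinates are sent
  to distinct coordinates and the norm is controlled by the largest entry.\<close>

lemma op_bound_partial_perm:
  assumes J: "J \<subseteq> {..<N}" and inj: "inj_on \<pi> J" and img: "\<pi> ` J \<subseteq> {..<N}"
    and g: "\<And>j. j \<in> J \<Longrightarrow> cmod (g j) \<le> s" and s: "0 \<le> s"
  shows "op_bound N (Matrix.mat N N (\<lambda>(i, j). if j \<in> J \<and> i = \<pi> j then g j else 0)) s"
    (is "op_bound N ?A s")
  unfolding op_bound_def
proof (intro conjI ballI)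
  fix v :: "complex vec" assume v: "v \<in> carrier_vec N"
  have fin: "finite J" using J finite_subset by blast
  have in1: "vec_index (?A *\<^sub>v v) (\<pi> j) = g j * vec_index v j" if "j \<in> J" for j
  proof -
    have *: "(if l \<in> J \<and> \<pi> j = \<pi> l then g l else 0) = (if l = j then g j else 0)" for l
      using inj that by (auto simp: inj_on_def)
    have "vec_index (?A *\<^sub>v v) (\<pi> j) = (\<Sum>l<N. (if l = j then g j else 0) * vec_index v l)"
      by (subst mult_mat_vec_index[of _ N]) (use v that img * in auto)
    also have "\<dots> = (\<Sum>l<N. if l = j then g j * vec_index v l else 0)"
      by (rule sum.cong) auto
    also have "\<dots> = g j * vec_index v j" using that J by (auto simp: sum.delta)
    finally show ?thesis .
  qed
  have in2: "vec_index (?A *\<^sub>v v) i = 0" if "i < N" "i \<notin> \<pi> ` J" for i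
    by (subst mult_mat_vec_index[of _ N]) (use v that in \<open>auto intro!: sum.neutral\<close>)
  have "(vec_norm2 (?A *\<^sub>v v))\<^sup>2 = (\<Sum>i<N. (cmod (vec_index (?A *\<^sub>v v) i))\<^sup>2)"
    by (subst vec_norm2_carrier[of _ N]) (use v mult_mat_vec_carrier[OF mat_carrier v] in \<open>auto simp: L2_set_def sum_nonneg simp del: index_mult_mat_vec\<close>)
  also have "\<dots> = (\<Sum>i\<in>\<pi> ` J. (cmod (vec_index (?A *\<^sub>v v) i))\<^sup>2)"
    by (rule sum.mono_neutral_right) (use img in2 in \<open>auto simp del: index_mult_mat_vec\<close>)
  also have "\<dots> = (\<Sum>j\<in>J. (cmod (g j * vec_index v j))\<^sup>2)"
    by (subst sum.reindex[OF inj]) (auto simp: in1 simp del: index_mult_mat_vec)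
  also have "\<dots> \<le> (\<Sum>j\<in>J. s\<^sup>2 * (cmod (vec_index v j))\<^sup>2)"
    using g by (intro sum_mono) (auto simp: norm_mult power_mult_distrib intro!: mult_right_mono power_mono)
  also have "\<dots> \<le> (\<Sum>j<N. s\<^sup>2 * (cmod (vec_index v j))\<^sup>2)"
    using J by (intro sum_mono2) auto
  also have "\<dots> = (s * vec_norm2 v)\<^sup>2"
    by (simp add: vec_norm2_carrier[OF v] L2_set_def sum_nonneg power_mult_distrib sum_distrib_left)
  finally show "vec_norm2 (?A *\<^sub>v v) \<le> s * vec_norm2 v"
    using s by (auto intro: power2_le_imp_le)
qed (use s in auto)

lemma op_bound_orthonormal_columns:
  assumes A: "A \<in> carrier_mat N N"
    and o: "\<And>j l. j < N \<Longrightarrow> l < N \<Longrightarrow> (\<Sum>i<N. A $$ (i, j) * cnj (A $$ (i, l))) = (if j = l then 1 else 0)"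
  shows "op_bound N A 1"
  unfolding op_bound_def
proof (intro conjI ballI)
  fix v :: "complex vec" assume v: "v \<in> carrier_vec N"
  have "complex_of_real ((vec_norm2 (A *\<^sub>v v))\<^sup>2) = (\<Sum>i<N. vec_index (A *\<^sub>v v) i * cnj (vec_index (A *\<^sub>v v) i))"
    by (subst vec_norm2_carrier[of _ N])
      (use v A in \<open>auto simp: L2_set_def sum_nonneg complex_norm_square[symmetric] simp del: index_mult_mat_vec of_real_power\<close>)
  also have "\<dots> = (\<Sum>i<N. \<Sum>j<N. \<Sum>l<N. (vec_index v j * cnj (vec_index v l)) * (A $$ (i, j) * cnj (A $$ (i, l))))"
    using v A by (intro sum.cong refl) (simp add: mult_mat_vec_index sum_product mult_ac del: index_mult_mat_vec)
  also have "\<dots> = (\<Sum>j<N. \<Sum>l<N. (vec_index v j * cnj (vec_index v l)) * (\<Sum>i<N. A $$ (i, j) * cnj (A $$ (i, l))))"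
    by (subst sum.swap, rule sum.cong[OF refl], subst sum.swap) (simp add: sum_distrib_left)
  also have "\<dots> = (\<Sum>j<N. \<Sum>l<N. if j = l then vec_index v j * cnj (vec_index v l) else 0)"
    by (intro sum.cong refl) (simp add: o)
  also have "\<dots> = (\<Sum>j<N. vec_index v j * cnj (vec_index v j))"
    by (simp add: sum.delta)
  also have "\<dots> = complex_of_real ((vec_norm2 v)\<^sup>2)"
    by (simp add: vec_norm2_carrier[OF v] L2_set_def sum_nonneg complex_norm_square[symmetric] del: of_real_power)
  finally have "(vec_norm2 (A *\<^sub>v v))\<^sup>2 = (vec_norm2 v)\<^sup>2"
    using of_real_eq_iff by blast
  then show "vec_norm2 (A *\<^sub>v v) \<le> 1 * vec_norm2 v"
    by (simp add: power2_eq_iff_nonneg)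
qed (use A in auto)

lemma L2_set_sum_le:
  assumes "finite F"
  shows "L2_set (\<lambda>i. cmod (\<Sum>k\<in>F. f k i)) I \<le> (\<Sum>k\<in>F. L2_set (\<lambda>i. cmod (f k i)) I)"
  using assms
proof (induction F)
  case (insert x F)
  have "L2_set (\<lambda>i. cmod (\<Sum>k\<in>insert x F. f k i)) I \<le> L2_set (\<lambda>i. cmod (f x i) + cmod (\<Sum>k\<in>F. f k i)) I"
    using insert by (intro L2_set_mono) (auto simp: norm_triangle_ineq)
  also have "\<dots> \<le> L2_set (\<lambda>i. cmod (f x i)) I + L2_set (\<lambda>i. cmod (\<Sum>k\<in>F. f k i)) I"
    by (rule L2_set_triangle_ineq)
  finally show ?case using insert by simp
qed (simp add: L2_set_def)

text \<open>The series of \<open>weyl_op\<close> converges entrywise only. For a fixed vector this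
  gives convergence of the finite partial sums in each coordinate, and their norms obey the bound
  uniformly, so the limit does too.\<close>

lemma op_bound_has_sum:
  assumes A: "A \<in> carrier_mat N N"
    and B: "\<And>k. op_bound N (B k) (b k)"
    and s: "\<And>i j. i < N \<Longrightarrow> j < N \<Longrightarrow> ((\<lambda>k. B k $$ (i, j)) has_sum A $$ (i, j)) UNIV"
    and b: "b summable_on UNIV" "infsum b UNIV \<le> c"
  shows "op_bound N A c"
proof -
  have b0: "0 \<le> b k" for k using B op_bound_nonneg by blast
  have fin: "sum b F \<le> c" if "finite F" for F
    using finite_sum_le_infsum[OF b(1) that] b0 b(2) by fastforce
  show ?thesis unfolding op_bound_def
  proof (intro conjI ballI A)
    show "0 \<le> c" using fin[of "{}"] by simp
    fix v :: "complex vec" assume v: "v \<in> carrier_vec N"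
    have t: "((\<lambda>F. \<Sum>k\<in>F. vec_index (B k *\<^sub>v v) i) \<longlongrightarrow> vec_index (A *\<^sub>v v) i) (finite_subsets_at_top UNIV)"
      if i: "i < N" for i
    proof -
      have "((\<lambda>F. \<Sum>j<N. (\<Sum>k\<in>F. B k $$ (i, j)) * vec_index v j) \<longlongrightarrow> (\<Sum>j<N. A $$ (i, j) * vec_index v j))
        (finite_subsets_at_top UNIV)"
        using s i by (intro tendsto_intros) (auto simp: has_sum_def)
      also have "(\<lambda>F. \<Sum>j<N. (\<Sum>k\<in>F. B k $$ (i, j)) * vec_index v j) = (\<lambda>F. \<Sum>k\<in>F. vec_index (B k *\<^sub>v v) i)"
      proof
        fix F
        have "(\<Sum>k\<in>F. vec_index (B k *\<^sub>v v) i) = (\<Sum>k\<in>F. \<Sum>j<N. B k $$ (i, j) * vec_index v j)"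
          by (intro sum.cong refl mult_mat_vec_index[of _ N] op_bound_carrier[OF B] v i)
        also have "\<dots> = (\<Sum>j<N. (\<Sum>k\<in>F. B k $$ (i, j)) * vec_index v j)"
          by (subst sum.swap) (simp add: sum_distrib_right)
        finally show "(\<Sum>j<N. (\<Sum>k\<in>F. B k $$ (i, j)) * vec_index v j) = (\<Sum>k\<in>F. vec_index (B k *\<^sub>v v) i)" ..
      qed
      finally show ?thesis using mult_mat_vec_index[OF A v i] by simp
    qed
    have "((\<lambda>F. L2_set (\<lambda>i. cmod (\<Sum>k\<in>F. vec_index (B k *\<^sub>v v) i)) {..<N}) \<longlongrightarrow>
      L2_set (\<lambda>i. cmod (vec_index (A *\<^sub>v v) i)) {..<N}) (finite_subsets_at_top UNIV)"
      unfolding L2_set_def by (intro tendsto_intros t) auto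
    moreover have "\<forall>\<^sub>F F in finite_subsets_at_top UNIV.
      L2_set (\<lambda>i. cmod (\<Sum>k\<in>F. vec_index (B k *\<^sub>v v) i)) {..<N} \<le> c * vec_norm2 v"
    proof (intro eventually_finite_subsets_at_top_weakI)
      fix F :: "'a set" assume F: "finite F"
      have "L2_set (\<lambda>i. cmod (\<Sum>k\<in>F. vec_index (B k *\<^sub>v v) i)) {..<N} \<le> (\<Sum>k\<in>F. vec_norm2 (B k *\<^sub>v v))"
        using L2_set_sum_le[OF F, of "\<lambda>k i. vec_index (B k *\<^sub>v v) i" "{..<N}"]
        by (simp only: vec_norm2_carrier[OF mult_mat_vec_carrier[OF op_bound_carrier[OF B] v]])
      also have "\<dots> \<le> (\<Sum>k\<in>F. b k * vec_norm2 v)" by (intro sum_mono bdD[OF B v])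
      also have "\<dots> \<le> c * vec_norm2 v"
        using fin[OF F] by (simp add: sum_distrib_right[symmetric] mult_right_mono)
      finally show "L2_set (\<lambda>i. cmod (\<Sum>k\<in>F. vec_index (B k *\<^sub>v v) i)) {..<N} \<le> c * vec_norm2 v" .
    qed
    ultimately have "L2_set (\<lambda>i. cmod (vec_index (A *\<^sub>v v) i)) {..<N} \<le> c * vec_norm2 v"
      by (rule tendsto_upperbound) simp
    then show "vec_norm2 (A *\<^sub>v v) \<le> c * vec_norm2 v"
      using A v by (subst vec_norm2_carrier[of _ N]) (auto simp del: index_mult_mat_vec)
  qed
qed

section \<open>Quantisation of product symbols\<close>

definition idft :: "nat \<Rightarrow> complex mat" where
  "idft N = Matrix.mat N N (\<lambda>(k, j). complex_of_real (1 / sqrt (real N)) * ee (real k * real j / real N))"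

lemma dft_index: "k < N \<Longrightarrow> j < N \<Longrightarrow>
    dft N $$ (k, j) = complex_of_real (1 / sqrt (real N)) * ee (- (real k * real j / real N))"
  by (simp add: dft_def ee_def algebra_simps)

lemma dft_carrier [simp]: "dft N \<in> carrier_mat N N"
  by (simp add: dft_def)

lemma idft_carrier [simp]: "idft N \<in> carrier_mat N N"
  by (simp add: idft_def)

lemma ee_power: "ee x ^ n = ee (of_nat n * x)"
  by (induction n) (auto simp: ee_add[symmetric] distrib_right)

lemma ee_minus_mult: "ee (- x) * ee y = ee (y - x)" "ee y * ee (- x) = ee (y - x)"
  by (simp_all add: ee_add[symmetric])

lemma sum_ee_roots:
  assumes "N > 0"
  shows "(\<Sum>l<N. ee (real l * of_int m / real N)) = (if int N dvd m then of_nat N else 0)"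
proof -
  let ?z = "ee (of_int m / real N)"
  have e: "ee (real l * of_int m / real N) = ?z ^ l" for l by (simp add: ee_power)
  have z: "?z = 1 \<longleftrightarrow> int N dvd m"
  proof
    assume "?z = 1"
    then obtain t :: int where "of_int m / real N = of_int t" by (auto simp: ee_eq_1_iff elim: Ints_cases)
    then have "real_of_int m = of_int (t * int N)" using assms by (simp add: field_simps)
    then have "m = t * int N" using of_int_eq_iff by blast
    then show "int N dvd m" by simp
  next
    assume "int N dvd m"
    then obtain t where "m = int N * t" by blast
    then have "of_int m / real N = of_int t" using assms by simp
    then show "?z = 1" by simp
  qed
  have "?z ^ N = 1" using assms by (simp add: ee_power)
  then show ?thesis unfolding e using z by (auto simp: sum_gp_strict)
qed

lemma int_dvd_diff_less: "i < N \<Longrightarrow> j < N \<Longrightarrow> int N dvd int i - int j \<longleftrightarrow> i = j"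
  by (metis diff_self dvd_0_right int_ops(6) mod_eq_dvd_iff mod_less nat_int of_nat_mod)

lemma dft_idft:
  assumes "N > 0"
  shows "dft N * idft N = 1\<^sub>m N" "idft N * dft N = 1\<^sub>m N"
proof -
  have sq: "complex_of_real (1 / sqrt (real N)) * complex_of_real (1 / sqrt (real N)) = 1 / of_nat N"
    by (simp add: of_real_mult[symmetric] del: of_real_mult)
  have 1: "(\<Sum>l<N. ee (- (real i * real l / real N)) * ee (real l * real j / real N)) = (if i = j then of_nat N else 0)"
    if "i < N" "j < N" for i j
  proof -
    have "ee (- (real i * real l / real N)) * ee (real l * real j / real N) = ee (real l * of_int (int j - int i) / real N)" for l
      by (simp add: ee_minus_mult algebra_simps diff_divide_distrib)
    then show ?thesis using sum_ee_roots[OF assms, of "int j - int i"] int_dvd_diff_less[OF that(2,1)] by auto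
  qed
  have 2: "(\<Sum>l<N. ee (real i * real l / real N) * ee (- (real l * real j / real N))) = (if i = j then of_nat N else 0)"
    if "i < N" "j < N" for i j
  proof -
    have "ee (real i * real l / real N) * ee (- (real l * real j / real N)) = ee (real l * of_int (int i - int j) / real N)" for l
      by (simp add: ee_minus_mult algebra_simps diff_divide_distrib)
    then show ?thesis using sum_ee_roots[OF assms, of "int i - int j"] int_dvd_diff_less[OF that] by auto
  qed
  have m: "(c * a) * (c * b) = c * c * (a * b)" for a b c :: complex by simp
  show "dft N * idft N = 1\<^sub>m N"
    by (rule eq_matI)
      (auto simp: scalar_prod_def lessThan_atLeast0[symmetric] dft_index idft_def m sq sum_distrib_left[symmetric] sum_divide_distrib[symmetric] 1
        assms dft_carrier[THEN carrier_matD(1)] dft_carrier[THEN carrier_matD(2)] simp del: of_real_divide)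
  show "idft N * dft N = 1\<^sub>m N"
    by (rule eq_matI)
      (auto simp: scalar_prod_def lessThan_atLeast0[symmetric] dft_index idft_def m sq sum_distrib_left[symmetric] sum_divide_distrib[symmetric] 2
        assms dft_carrier[THEN carrier_matD(1)] dft_carrier[THEN carrier_matD(2)] simp del: of_real_divide)
qed

lemma inv_dft: assumes "N > 0" shows "inv\<^bsub>mat_ring N\<^esub> (dft N) = idft N"
proof -
  interpret R: ring "mat_ring N" by (rule ring_mat)
  show ?thesis
    by (rule R.inv_char) (use dft_idft[OF assms] in \<open>auto simp: ring_mat_simps\<close>)
qed

lemma mat_mult_index:
  assumes "A \<in> carrier_mat N N" "B \<in> carrier_mat N N" "i < N" "j < N"
  shows "(A * B) $$ (i, j) = (\<Sum>l<N. A $$ (i, l) * B $$ (l, j))"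
  using assms by (simp add: scalar_prod_def lessThan_atLeast0)

lemma dft_orthonormal:
  assumes "N > 0" "j < N" "l < N"
  shows "(\<Sum>i<N. dft N $$ (i, j) * cnj (dft N $$ (i, l))) = (if j = l then 1 else 0)"
    and "(\<Sum>i<N. idft N $$ (i, j) * cnj (idft N $$ (i, l))) = (if j = l then 1 else 0)"
proof -
  have d: "cnj (dft N $$ (i, l)) = idft N $$ (l, i)" "cnj (idft N $$ (i, l)) = dft N $$ (l, i)" if "i < N" "l < N" for i l
    using that by (auto simp: dft_index idft_def ee_minus mult_ac)
  have "(\<Sum>i<N. dft N $$ (i, j) * cnj (dft N $$ (i, l))) = (idft N * dft N) $$ (l, j)"
    by (subst mat_mult_index) (use assms d in \<open>auto simp: mult.commute intro!: sum.cong\<close>)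
  then show "(\<Sum>i<N. dft N $$ (i, j) * cnj (dft N $$ (i, l))) = (if j = l then 1 else 0)"
    using assms by (simp add: dft_idft)
  have "(\<Sum>i<N. idft N $$ (i, j) * cnj (idft N $$ (i, l))) = (dft N * idft N) $$ (l, j)"
    by (subst mat_mult_index) (use assms d in \<open>auto simp: mult.commute intro!: sum.cong\<close>)
  then show "(\<Sum>i<N. idft N $$ (i, j) * cnj (idft N $$ (i, l))) = (if j = l then 1 else 0)"
    using assms by (simp add: dft_idft)
qed

lemma op_bound_dft:
  assumes "N > 0" shows "op_bound N (dft N) 1" "op_bound N (idft N) 1"
  using assms by (auto intro!: op_bound_orthonormal_columns dft_orthonormal)

section \<open>Phase-space translations\<close>

lemma translation_index:
  assumes "i < N" "j < N"
  shows "translation N (k1, k2) $$ (i, j) =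
    (if int i = (int j + k1) mod int N then ee (of_int k2 * ((real j + of_int k1 / 2) / real N)) else 0)"
proof -
  have "pi * real_of_int k1 * real_of_int k2 / real N + 2 * pi * real_of_int k2 * real j / real N =
    2 * pi * (of_int k2 * ((real j + of_int k1 / 2) / real N))"
    using assms by (simp add: field_simps)
  then show ?thesis using assms by (simp add: translation_def ee_def cis_mult)
qed

lemma translation_carrier [simp]: "translation N k \<in> carrier_mat N N"
  by (cases k) (simp add: translation_def)

lemma ee_int_cong: "x - y = of_int m \<Longrightarrow> ee x = ee y"
  by (metis add_diff_cancel_left' diff_add_cancel ee_add_int add.commute)

text \<open>The Fourier transform rotates phase space by a quarter turn.\<close>

lemma dft_translation:
  assumes N: "N > 0"
  shows "dft N * translation N (k1, k2) = translation N (k2, - k1) * dft N"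
proof (rule eq_matI)
  fix i j assume "i < dim_row (translation N (k2, - k1) * dft N)" "j < dim_col (translation N (k2, - k1) * dft N)"
  then have i: "i < N" and j: "j < N"
    by (simp_all add: dft_carrier[THEN carrier_matD(2)] translation_carrier[THEN carrier_matD(1)])
  let ?r = "complex_of_real (1 / sqrt (real N))"
  define l0 where "l0 = nat ((int j + k1) mod int N)"
  define l1 where "l1 = nat ((int i - k2) mod int N)"
  have l0: "l0 < N" "int l0 = (int j + k1) mod int N" using N by (auto simp: l0_def nat_less_iff)
  have l1: "l1 < N" "int l1 = (int i - k2) mod int N" using N by (auto simp: l1_def nat_less_iff)
  have l1_iff: "int i = (int l + k2) mod int N \<longleftrightarrow> l = l1" if "l < N" for l
  proof
    assume a: "int i = (int l + k2) mod int N"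
    have "int l = int l mod int N" using that by simp
    also have "\<dots> = ((int l + k2) mod int N - k2) mod int N" by (simp add: mod_diff_left_eq)
    finally show "l = l1" using a l1 by simp
  next
    assume "l = l1"
    then have "(int l + k2) mod int N = int i mod int N" using l1 by (simp add: mod_add_left_eq)
    then show "int i = (int l + k2) mod int N" using i by simp
  qed
  obtain a where a: "real l0 = real j + of_int k1 + of_int a * real N"
  proof -
    have "(int j + k1) mod int N = int j + k1 + (- ((int j + k1) div int N)) * int N"
      by (simp add: minus_div_mult_eq_mod[symmetric])
    then have "real_of_int (int l0) = real_of_int (int j + k1 + (- ((int j + k1) div int N)) * int N)"
      using l0 by simp
    then show thesis using that[of "- ((int j + k1) div int N)"] by simp
  qed
  obtain b where b: "real l1 = real i - of_int k2 + of_int b * real N"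
  proof -
    have "(int i - k2) mod int N = int i - k2 + (- ((int i - k2) div int N)) * int N"
      by (simp add: minus_div_mult_eq_mod[symmetric])
    then have "real_of_int (int l1) = real_of_int (int i - k2 + (- ((int i - k2) div int N)) * int N)"
      using l1 by simp
    then show thesis using that[of "- ((int i - k2) div int N)"] by simp
  qed
  have "(dft N * translation N (k1, k2)) $$ (i, j) = (\<Sum>l<N. if l = l0 then dft N $$ (i, l) * ee (of_int k2 * ((real j + of_int k1 / 2) / real N)) else 0)"
    unfolding mat_mult_index[OF dft_carrier translation_carrier i j]
    by (intro sum.cong refl) (use j l0 in \<open>auto simp: translation_index simp flip: l0(2)\<close>)
  also have "\<dots> = dft N $$ (i, l0) * ee (of_int k2 * ((real j + of_int k1 / 2) / real N))"
    using l0 by (simp add: sum.delta)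
  also have "\<dots> = ?r * ee (- (real i * real l0 / real N) + of_int k2 * ((real j + of_int k1 / 2) / real N))"
    using i l0 by (simp add: dft_index ee_minus_mult)
  \<comment> \<open>The indices \<open>l0\<close> and \<open>l1\<close> are reduced mod N at the
    cost of multiples \<open>a\<close> and \<open>b\<close> of N. Both phases are equal up to the
    integer that these wraparounds contribute.\<close>
  also have "ee (- (real i * real l0 / real N) + of_int k2 * ((real j + of_int k1 / 2) / real N)) =
    ee (of_int (- k1) * ((real l1 + of_int k2 / 2) / real N) + - (real l1 * real j / real N))"
    by (rule ee_int_cong[where m = "b * (k1 + int j) - int i * a"]) (use N in \<open>simp add: a b field_simps\<close>)
  also have "?r * \<dots> = ee (of_int (- k1) * ((real l1 + of_int k2 / 2) / real N)) * dft N $$ (l1, j)"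
    unfolding dft_index[OF l1(1) j] ee_add by (simp add: mult_ac)
  also have "\<dots> = (\<Sum>l<N. if l = l1 then ee (of_int (- k1) * ((real l + of_int k2 / 2) / real N)) * dft N $$ (l, j) else 0)"
    using l1 by (simp add: sum.delta)
  also have "\<dots> = (translation N (k2, - k1) * dft N) $$ (i, j)"
    unfolding mat_mult_index[OF translation_carrier dft_carrier i j]
    by (intro sum.cong refl) (use i l1_iff in \<open>auto simp: translation_index\<close>)
  finally show "(dft N * translation N (k1, k2)) $$ (i, j) = (translation N (k2, - k1) * dft N) $$ (i, j)" .
qed (auto simp: dft_carrier[THEN carrier_matD(1)] dft_carrier[THEN carrier_matD(2)]
    translation_carrier[THEN carrier_matD(1)] translation_carrier[THEN carrier_matD(2)])

text \<open>The amplitude is sampled at the midpoint of the jump from \<open>j\<close> to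
  \<open>j + k\<close>, which is Weyl ordering. The midpoint uses the unreduced \<open>k\<close>:
  jumps that agree mod N may carry different amplitudes.\<close>

definition piece :: "nat \<Rightarrow> (real \<Rightarrow> complex) \<Rightarrow> int \<Rightarrow> complex mat" where
  "piece N u k = Matrix.mat N N (\<lambda>(i, j). if int i = (int j + k) mod int N
     then u ((real j + of_int k / 2) / real N) else 0)"

text \<open>\<open>opt N u V\<close> quantises the symbol \<open>u(q) v(p)\<close> with \<open>v(p) = \<Sum>\<^sub>k V(k) ee (- k p)\<close>.\<close>

definition opt :: "nat \<Rightarrow> (real \<Rightarrow> complex) \<Rightarrow> (int \<Rightarrow> complex) \<Rightarrow> complex mat" where
  "opt N u V = Matrix.mat N N (\<lambda>(i, j). \<Sum>\<^sub>\<infinity>k. V k * piece N u k $$ (i, j))"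

lemma opt_carrier [simp]: "opt N u V \<in> carrier_mat N N"
  by (simp add: opt_def)

lemma piece_carrier [simp]: "piece N u k \<in> carrier_mat N N"
  by (simp add: piece_def)

lemma piece_entry_le:
  assumes "\<And>x. cmod (u x) \<le> s" "i < N" "j < N"
  shows "cmod (piece N u k $$ (i, j)) \<le> s"
  using assms order_trans[OF norm_ge_zero assms(1)] by (auto simp: piece_def)

lemma op_bound_piece:
  assumes "N > 0" "\<And>x. cmod (u x) \<le> s"
  shows "op_bound N (piece N u k) s"
proof -
  have s: "0 \<le> s" using order_trans[OF norm_ge_zero assms(2)] by simp
  have inj: "inj_on (\<lambda>j. nat ((int j + k) mod int N)) {..<N}"
  proof (rule inj_onI)
    fix x y assume xy: "x \<in> {..<N}" "y \<in> {..<N}" "nat ((int x + k) mod int N) = nat ((int y + k) mod int N)"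
    then have "(int x + k) mod int N = (int y + k) mod int N"
      using assms(1) by (metis nat_eq_iff2 of_nat_0_less_iff pos_mod_sign nat_0_le)
    then have "int N dvd int x - int y" by (simp add: mod_eq_dvd_iff)
    then show "x = y" using xy int_dvd_diff_less by auto
  qed
  have "piece N u k = Matrix.mat N N (\<lambda>(i, j). if j \<in> {..<N} \<and> i = nat ((int j + k) mod int N)
     then u ((real j + of_int k / 2) / real N) else 0)"
    unfolding piece_def by (rule eq_matI) (use assms(1) in auto)
  also have "op_bound N \<dots> s"
    by (rule op_bound_partial_perm[OF _ inj]) (use assms s in \<open>auto simp: nat_less_iff\<close>)
  finally show ?thesis .
qed

lemma opt_has_sum:
  assumes V: "(\<lambda>k. norm (V k)) summable_on UNIV" and u: "\<And>x. cmod (u x) \<le> s" and ij: "i < N" "j < N"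
  shows "((\<lambda>k. V k * piece N u k $$ (i, j)) has_sum opt N u V $$ (i, j)) UNIV"
proof -
  have "(\<lambda>k. norm (V k * piece N u k $$ (i, j))) summable_on UNIV"
    by (rule summable_on_comparison_test[OF summable_on_cmult_left[OF V, of s]])
      (auto simp: norm_mult intro!: mult_left_mono piece_entry_le u ij)
  then have "(\<lambda>k. V k * piece N u k $$ (i, j)) summable_on UNIV" by (rule abs_summable_summable)
  then show ?thesis using ij by (simp add: opt_def has_sum_infsum)
qed

text \<open>The position factor enters through its sup norm alone. A sum of bumps with disjoint
  supports therefore costs no more than one bump.\<close>

lemma op_bound_opt:
  assumes N: "N > 0" and V: "(\<lambda>k. norm (V k)) summable_on UNIV" and u: "\<And>x. cmod (u x) \<le> s"
  shows "op_bound N (opt N u V) (s * (\<Sum>\<^sub>\<infinity>k. norm (V k)))"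
proof (rule op_bound_has_sum[where B = "\<lambda>k. V k \<cdot>\<^sub>m piece N u k" and b = "\<lambda>k. cmod (V k) * s"])
  show "op_bound N (V k \<cdot>\<^sub>m piece N u k) (cmod (V k) * s)" for k
    by (rule op_bound_smult[OF op_bound_piece[OF N u]])
  show "((\<lambda>k. (V k \<cdot>\<^sub>m piece N u k) $$ (i, j)) has_sum opt N u V $$ (i, j)) UNIV" if "i < N" "j < N" for i j
    using opt_has_sum[OF V u that] that by (simp add: piece_carrier[THEN carrier_matD(1)] piece_carrier[THEN carrier_matD(2)])
qed (auto simp: infsum_cmult_left' intro!: summable_on_cmult_left V)

text \<open>Expanding the position factor as well resolves the operator into Weyl translations, the
  form on which the Fourier matrix acts explicitly.\<close>

lemma opt_has_sum2:
  assumes V: "(\<lambda>k. norm (V k)) summable_on UNIV" and u: "wiener u U" and ij: "i < N" "j < N"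
  shows "((\<lambda>k. V (fst k) * U (snd k) * translation N k $$ (i, j)) has_sum opt N u V $$ (i, j)) UNIV"
proof -
  have U: "(\<lambda>k. norm (U k)) summable_on UNIV" using u by (simp add: wiener_def)
  have us: "((\<lambda>k. U k * ee (of_int k * x)) has_sum u x) UNIV" for x using u by (simp add: wiener_def)
  let ?y = "\<lambda>a. (real j + of_int a / 2) / real N"
  have "((\<lambda>k. V (fst k) * U (snd k) * translation N k $$ (i, j)) has_sum opt N u V $$ (i, j)) (Sigma UNIV (\<lambda>_. UNIV))"
  proof (rule has_sum_SigmaI)
    fix a :: int
    show "((\<lambda>b. V (fst (a, b)) * U (snd (a, b)) * translation N (a, b) $$ (i, j)) has_sum V a * piece N u a $$ (i, j)) UNIV"
    proof (cases "int i = (int j + a) mod int N")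
      case True
      have "((\<lambda>b. V a * (U b * ee (of_int b * ?y a))) has_sum V a * u (?y a)) UNIV"
        by (rule has_sum_cmult_right[OF us])
      then show ?thesis using True ij by (simp add: translation_index piece_def mult.assoc)
    next
      case False
      then show ?thesis using ij by (simp add: translation_index piece_def)
    qed
  next
    show "((\<lambda>a. V a * piece N u a $$ (i, j)) has_sum opt N u V $$ (i, j)) UNIV"
      by (rule opt_has_sum[OF V wiener_norm_le[OF u] ij])
  next
    have 1: "(\<lambda>k. norm (V (fst k) * U (snd k))) summable_on Sigma UNIV (\<lambda>_. UNIV)"
      unfolding Infinite_Sum.abs_summable_on_Sigma_iff
      by (auto simp: norm_mult infsum_cmult_right' abs_mult intro!: summable_on_cmult_right summable_on_cmult_left U V)
    have "(\<lambda>k. norm (V (fst k) * U (snd k) * translation N k $$ (i, j))) summable_on Sigma UNIV (\<lambda>_. UNIV)"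
      by (rule summable_on_comparison_test[OF 1])
        (use ij in \<open>auto simp: norm_mult translation_index\<close>)
    then show "(\<lambda>k. V (fst k) * U (snd k) * translation N k $$ (i, j)) summable_on Sigma UNIV (\<lambda>_. UNIV)"
      by (rule abs_summable_summable)
  qed
  then show ?thesis by simp
qed

lemma has_sum_finite_sum:
  fixes f :: "'l \<Rightarrow> 'm \<Rightarrow> complex"
  assumes "\<And>l. l \<in> I \<Longrightarrow> (f l has_sum F l) UNIV"
  shows "((\<lambda>k. \<Sum>l\<in>I. f l k) has_sum (\<Sum>l\<in>I. F l)) UNIV"
proof -
  have "((\<lambda>X. \<Sum>l\<in>I. sum (f l) X) \<longlongrightarrow> (\<Sum>l\<in>I. F l)) (finite_subsets_at_top UNIV)"
    using assms by (intro tendsto_intros) (auto simp: has_sum_def)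
  moreover have "(\<lambda>X. \<Sum>l\<in>I. sum (f l) X) = sum (\<lambda>k. \<Sum>l\<in>I. f l k)"
    by (rule ext) (rule sum.swap)
  ultimately show ?thesis by (simp add: has_sum_def)
qed

lemma summable_on_neg_iff: "(\<lambda>k. f (- k)) summable_on (UNIV :: int set) \<longleftrightarrow> f summable_on UNIV"
  using summable_on_reindex_bij_betw[of uminus "UNIV :: int set" UNIV f] by (simp add: bij_uminus)

lemma weyl_op_tensor:
  assumes u: "wiener u U" and v: "wiener v V"
  shows "weyl_op N (\<lambda>(q, p). u q * v p) = opt N u (\<lambda>k. V (- k))"
proof (rule eq_matI)
  fix i j assume "i < dim_row (opt N u (\<lambda>k. V (- k)))" "j < dim_col (opt N u (\<lambda>k. V (- k)))"
  then have ij: "i < N" "j < N"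
    by (simp_all add: opt_carrier[THEN carrier_matD(1)] opt_carrier[THEN carrier_matD(2)])
  have V': "(\<lambda>k. norm (V (- k))) summable_on UNIV"
    using v summable_on_neg_iff[of "\<lambda>k. norm (V k)"] by (simp add: wiener_def)
  have fc: "fourier_coeff (\<lambda>(q, p). u q * v p) = (\<lambda>k. V (- fst k) * U (snd k))"
    unfolding wiener2_fourier_coeff[OF wiener2_tensor[OF u v]] by auto
  show "weyl_op N (\<lambda>(q, p). u q * v p) $$ (i, j) = opt N u (\<lambda>k. V (- k)) $$ (i, j)"
    using infsumI[OF opt_has_sum2[OF V' u ij]] ij
    by (simp add: weyl_op_def fc)
qed (simp_all add: weyl_op_def opt_def)

text \<open>The quarter turn of \<open>dft_translation\<close> is applied to each translation, and
  the frequencies are reindexed accordingly. It is needed both in dimension \<open>M\<close>, inside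
  a block, and in dimension \<open>2 * M\<close>.\<close>

lemma dft_opt:
  assumes N: "N > 0" and u: "wiener u U" and v: "wiener v V"
  shows "dft N * opt N u (\<lambda>k. V (- k)) = opt N v U * dft N"
proof (rule eq_matI)
  fix i j assume "i < dim_row (opt N v U * dft N)" "j < dim_col (opt N v U * dft N)"
  then have ij: "i < N" "j < N"
    by (simp_all add: opt_carrier[THEN carrier_matD(1)] dft_carrier[THEN carrier_matD(2)])
  have V': "(\<lambda>k. norm (V (- k))) summable_on UNIV"
    using v summable_on_neg_iff[of "\<lambda>k. norm (V k)"] by (simp add: wiener_def)
  have U': "(\<lambda>k. norm (U k)) summable_on UNIV" using u by (simp add: wiener_def)
  have "((\<lambda>k. \<Sum>l<N. dft N $$ (i, l) * (V (- fst k) * U (snd k) * translation N k $$ (l, j))) has_sum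
      (\<Sum>l<N. dft N $$ (i, l) * opt N u (\<lambda>k. V (- k)) $$ (l, j))) UNIV"
    by (intro has_sum_finite_sum has_sum_cmult_right opt_has_sum2[OF V' u] ij) auto
  also have "(\<lambda>k. \<Sum>l<N. dft N $$ (i, l) * (V (- fst k) * U (snd k) * translation N k $$ (l, j))) =
     (\<lambda>k. V (- fst k) * U (snd k) * (dft N * translation N k) $$ (i, j))"
    by (rule ext, subst mat_mult_index) (use ij in \<open>auto simp: sum_distrib_left mult_ac\<close>)
  also have "(\<Sum>l<N. dft N $$ (i, l) * opt N u (\<lambda>k. V (- k)) $$ (l, j)) = (dft N * opt N u (\<lambda>k. V (- k))) $$ (i, j)"
    by (subst mat_mult_index) (use ij in auto)
  finally have 1: "((\<lambda>k. V (- fst k) * U (snd k) * (dft N * translation N k) $$ (i, j)) has_sum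
     (dft N * opt N u (\<lambda>k. V (- k))) $$ (i, j)) UNIV" .
  have vs: "\<And>i j. i < N \<Longrightarrow> j < N \<Longrightarrow> ((\<lambda>k. U (fst k) * V (snd k) * translation N k $$ (i, j)) has_sum opt N v U $$ (i, j)) UNIV"
    by (rule opt_has_sum2[OF U' v])
  have "((\<lambda>k. \<Sum>l<N. (U (fst k) * V (snd k) * translation N k $$ (i, l)) * dft N $$ (l, j)) has_sum
      (\<Sum>l<N. opt N v U $$ (i, l) * dft N $$ (l, j))) UNIV"
    by (intro has_sum_finite_sum has_sum_cmult_left vs ij) auto
  also have "(\<lambda>k. \<Sum>l<N. (U (fst k) * V (snd k) * translation N k $$ (i, l)) * dft N $$ (l, j)) =
     (\<lambda>k. U (fst k) * V (snd k) * (translation N k * dft N) $$ (i, j))"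
    by (rule ext, subst mat_mult_index) (use ij in \<open>auto simp: sum_distrib_left mult_ac\<close>)
  also have "(\<Sum>l<N. opt N v U $$ (i, l) * dft N $$ (l, j)) = (opt N v U * dft N) $$ (i, j)"
    by (subst mat_mult_index) (use ij in auto)
  finally have 2: "((\<lambda>k. U (fst k) * V (snd k) * (translation N k * dft N) $$ (i, j)) has_sum (opt N v U * dft N) $$ (i, j)) UNIV" .
  have bij: "bij_betw (\<lambda>k :: int \<times> int. (snd k, - fst k)) UNIV UNIV"
    by (rule bij_betwI[where g = "\<lambda>k. (- snd k, fst k)"]) auto
  have dt: "dft N * translation N k = translation N (snd k, - fst k) * dft N" for k
    by (cases k) (simp add: dft_translation[OF N])
  have "((\<lambda>k. V (- fst k) * U (snd k) * (dft N * translation N k) $$ (i, j)) has_sum (opt N v U * dft N) $$ (i, j)) UNIV"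
    using 2 has_sum_reindex_bij_betw[OF bij, of "\<lambda>k. U (fst k) * V (snd k) * (translation N k * dft N) $$ (i, j)"]
    by (simp add: mult.commute[of "V _"] dt)
  with 1 show "(dft N * opt N u (\<lambda>k. V (- k))) $$ (i, j) = (opt N v U * dft N) $$ (i, j)"
    by (rule has_sum_unique)
qed (simp_all add: opt_def dft_def)

section \<open>One step of the quantum map\<close>

definition emb :: "nat \<Rightarrow> nat \<Rightarrow> complex mat \<Rightarrow> complex mat" where
  "emb M off A = Matrix.mat (2 * M) (2 * M) (\<lambda>(i, j).
     if off \<le> i \<and> i < off + M \<and> off \<le> j \<and> j < off + M then A $$ (i - off, j - off) else 0)"

lemma emb_carrier [simp]: "emb M off A \<in> carrier_mat (2 * M) (2 * M)"
  by (simp add: emb_def)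

lemmas mat_dims = emb_carrier[THEN carrier_matD(1)] emb_carrier[THEN carrier_matD(2)]
  opt_carrier[THEN carrier_matD(1)] opt_carrier[THEN carrier_matD(2)]
  piece_carrier[THEN carrier_matD(1)] piece_carrier[THEN carrier_matD(2)]

lemma op_bound_emb_piece:
  assumes M: "M > 0" and off: "off \<le> M" and u: "\<And>x. cmod (u x) \<le> s"
  shows "op_bound (2 * M) (emb M off (piece M u k)) s"
proof -
  have s: "0 \<le> s" using order_trans[OF norm_ge_zero u] by simp
  let ?\<pi> = "\<lambda>j. off + nat ((int (j - off) + k) mod int M)"
  have lt: "nat (x mod int M) < M" for x using M by (simp add: nat_less_iff)
  have inj: "inj_on ?\<pi> {off..<off + M}"
  proof (rule inj_onI)
    fix x y assume xy: "x \<in> {off..<off + M}" "y \<in> {off..<off + M}" "?\<pi> x = ?\<pi> y"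
    then have "(int (x - off) + k) mod int M = (int (y - off) + k) mod int M"
      using M by (metis add_left_cancel nat_eq_iff2 of_nat_0_less_iff pos_mod_sign nat_0_le)
    then have "int M dvd int (x - off) - int (y - off)" by (simp add: mod_eq_dvd_iff)
    moreover have "x - off < M" "y - off < M" using xy by auto
    ultimately have "x - off = y - off" using int_dvd_diff_less by blast
    then show "x = y" using xy by auto
  qed
  have "emb M off (piece M u k) = Matrix.mat (2 * M) (2 * M) (\<lambda>(i, j). if j \<in> {off..<off + M} \<and> i = ?\<pi> j
     then u ((real (j - off) + of_int k / 2) / real M) else 0)"
    unfolding emb_def
  proof (rule eq_matI)
    fix i j
    assume "i < dim_row (Matrix.mat (2 * M) (2 * M) (\<lambda>(i, j). if j \<in> {off..<off + M} \<and> i = ?\<pi> j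
       then u ((real (j - off) + of_int k / 2) / real M) else 0))"
      and "j < dim_col (Matrix.mat (2 * M) (2 * M) (\<lambda>(i, j). if j \<in> {off..<off + M} \<and> i = ?\<pi> j
       then u ((real (j - off) + of_int k / 2) / real M) else 0))"
    then have ij: "i < 2 * M" "j < 2 * M" by auto
    have "off \<le> ?\<pi> j \<and> ?\<pi> j < off + M" using lt by auto
    moreover have "int (i - off) = (int (j - off) + k) mod int M \<longleftrightarrow> i = ?\<pi> j" if "off \<le> i"
      using that M by (auto simp: nat_eq_iff)
    ultimately show "Matrix.mat (2 * M) (2 * M) (\<lambda>(i, j). if off \<le> i \<and> i < off + M \<and> off \<le> j \<and> j < off + M
         then piece M u k $$ (i - off, j - off) else 0) $$ (i, j) =
      Matrix.mat (2 * M) (2 * M) (\<lambda>(i, j). if j \<in> {off..<off + M} \<and> i = ?\<pi> j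
       then u ((real (j - off) + of_int k / 2) / real M) else 0) $$ (i, j)"
      using ij by (auto simp: piece_def)
  qed auto
  also have "op_bound (2 * M) \<dots> s"
    by (rule op_bound_partial_perm[OF _ inj]) (use off u s add_le_less_mono[OF off lt] in \<open>auto simp: mult_2 of_nat_diff\<close>)
  finally show ?thesis .
qed

lemma frac_shift_cases:
  fixes y :: real
  assumes "- 1 \<le> y" "y < 2"
  shows "frac y = (if y < 0 then y + 1 else if y < 1 then y else y - 1)"
proof -
  have "\<lfloor>y\<rfloor> = (if y < 0 then -1 else if y < 1 then 0 else 1)"
    using assms by (auto simp: floor_eq_iff)
  then show ?thesis by (auto simp: frac_def)
qed

text \<open>If \<open>u\<close> lives well inside one half of the circle, short jumps of the quantisation
  cannot leave the corresponding diagonal block.\<close>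

lemma piece_eq_emb:
  fixes b :: nat
  assumes M: "M > 0" and b: "b \<le> 1" and per: "per1 u" and \<eta>: "0 < \<eta>"
    and u1: "\<And>x. u1 x = u (real b / 2 + frac x / 2)"
    and supp: "\<And>x. u x \<noteq> 0 \<Longrightarrow> real b / 2 + \<eta> < frac x \<and> frac x < real b / 2 + 1 / 2 - \<eta>"
    and k: "\<bar>of_int k\<bar> < 4 * real M * \<eta>" and \<eta>4: "4 * \<eta> \<le> 1"
  shows "piece (2 * M) u k = emb M (b * M) (piece M u1 k)"
proof (rule eq_matI)
  fix i j assume "i < dim_row (emb M (b * M) (piece M u1 k))" "j < dim_col (emb M (b * M) (piece M u1 k))"
  then have i: "i < 2 * M" and j: "j < 2 * M" by (simp_all add: emb_def)
  define y where "y = (real j + of_int k / 2) / real (2 * M)"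
  define x where "x = (real j - real (b * M) + of_int k / 2) / real M"
  \<comment> \<open>In units of the circle the jump goes from \<open>y - c\<close> to
    \<open>y + c\<close>. The threshold on \<open>k\<close> says exactly that the half-jump
    \<open>c\<close> is shorter than the margin \<eta>.\<close>
  define c where "c = of_int k / (4 * real M)"
  have M': "real M > 0" using M by simp
  have c: "\<bar>c\<bar> < \<eta>" using k M' by (simp add: c_def abs_divide divide_less_eq mult_ac)
  have yj: "y = real j / (2 * real M) + c" using M' by (simp add: y_def c_def field_simps)
  have xj: "x = (real j - real (b * M)) / real M + 2 * c" using M' by (simp add: x_def c_def field_simps)
  have yx: "y = real b / 2 + x / 2" using M' by (simp add: y_def x_def field_simps)
  let ?in = "\<lambda>t::int. int (b * M) \<le> t \<and> t < int (b * M) + int M"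
  have jk: "of_int (int j + k) = 2 * real M * (y + c)" using M' by (simp add: y_def c_def field_simps)
  have jkx: "of_int (int j + k) = real (b * M) + real M * (x + 2 * c)" using M' by (simp add: x_def c_def field_simps)
  define z where "z = real j / (2 * real M)"
  have yz: "y = z + c" using yj by (simp add: z_def)
  have z01: "0 \<le> z" "z < 1" using j M' by (auto simp: z_def divide_less_eq)
  have bb: "b = 0 \<or> b = 1" and b1: "real b \<le> 1" using b by auto
  \<comment> \<open>\<open>A\<close> excludes entries of the large matrix outside the block,
    including wraparound mod \<open>2 * M\<close>. \<open>B\<close> excludes wraparound mod
    \<open>M\<close> in the small matrix, and \<open>C\<close> identifies the amplitudes of the
    jumps that remain. The position \<open>j + k\<close> is not reduced here.\<close>
  have A: "?in (int j) \<and> ?in (int j + k)" if "u y \<noteq> 0"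
  proof -
    have f: "real b / 2 + \<eta> < frac y" "frac y < real b / 2 + 1 / 2 - \<eta>" using supp[OF that] by auto
    have "- 1 \<le> y" "y < 2" using yz z01 c \<eta>4 by linarith+
    from frac_shift_cases[OF this] have fy: "frac y = y"
      using f yz z01 c b1 by (auto split: if_splits)
    have 1: "real b / 2 < y - c" "y - c < real b / 2 + 1 / 2" "real b / 2 < y + c" "y + c < real b / 2 + 1 / 2"
      using f fy c by auto
    have "real j = 2 * real M * (y - c)" using yj M' by simp
    moreover have "2 * real M * (real b / 2) < 2 * real M * (y - c)" "2 * real M * (y - c) < 2 * real M * (real b / 2 + 1 / 2)"
      "2 * real M * (real b / 2) < 2 * real M * (y + c)" "2 * real M * (y + c) < 2 * real M * (real b / 2 + 1 / 2)"
      using 1 M' by (intro mult_strict_left_mono; simp)+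
    ultimately have "real b * real M < real j" "real j < real b * real M + real M"
      "real b * real M < of_int (int j + k)" "of_int (int j + k) < real b * real M + real M"
      using jk by (auto simp: algebra_simps)
    then have "real_of_int (int (b * M)) < of_int (int j)" "real_of_int (int j) < of_int (int (b * M) + int M)"
      "real_of_int (int (b * M)) < of_int (int j + k)" "real_of_int (int j + k) < of_int (int (b * M) + int M)"
      by auto
    then show ?thesis unfolding of_int_less_iff by auto
  qed
  have B: "?in (int j + k)" if "?in (int j)" "u1 x \<noteq> 0"
  proof -
    have "u (real b / 2 + frac x / 2) \<noteq> 0" using that u1 by simp
    moreover have "frac (real b / 2 + frac x / 2) = real b / 2 + frac x / 2"
      using frac_lt_1[of x] bb by (auto simp: frac_eq)
    ultimately have f: "2 * \<eta> < frac x" "frac x < 1 - 2 * \<eta>" using supp[of "real b / 2 + frac x / 2"] by auto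
    have "real (b * M) \<le> real j" "real j < real (b * M) + real M" using that(1) by linarith+
    then have j01: "0 \<le> (real j - real (b * M)) / real M" "(real j - real (b * M)) / real M < 1"
      using M' by (auto simp: divide_less_eq)
    have "- 1 \<le> x" "x < 2" using xj j01 c \<eta>4 by linarith+
    from frac_shift_cases[OF this] have fx: "frac x = x"
      using f xj j01 c by (auto split: if_splits)
    have "0 < x + 2 * c" "x + 2 * c < 1" using f fx c by auto
    then have "0 < real M * (x + 2 * c)" "real M * (x + 2 * c) < real M * 1"
      using M' by (auto intro!: mult_strict_left_mono)
    then have "real_of_int (int (b * M)) < of_int (int j + k)" "real_of_int (int j + k) < of_int (int (b * M) + int M)"
      using jkx by auto
    then show ?thesis unfolding of_int_less_iff by auto
  qed
  have C: "u1 x = u y" if "?in (int j)" "?in (int j + k)"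
  proof -
    have "real (b * M) \<le> real j" "real j < real (b * M) + real M" using that(1) by linarith+
    moreover have "real_of_int (int (b * M)) \<le> of_int (int j + k)" "real_of_int (int j + k) < of_int (int (b * M) + int M)"
      using that(2) unfolding of_int_less_iff of_int_le_iff by auto
    ultimately have "0 \<le> real j - real (b * M) + of_int k / 2" "real j - real (b * M) + of_int k / 2 < real M"
      by auto
    then have "0 \<le> x" "x < 1" using M' by (auto simp: x_def divide_less_eq)
    then have "frac x = x" by (simp add: frac_eq)
    then show ?thesis by (simp add: u1 yx)
  qed
  have inn: "?in (int t) \<longleftrightarrow> b * M \<le> t \<and> t < b * M + M" for t
    by (simp only: of_nat_le_iff of_nat_less_iff of_nat_add[symmetric])
  have L: "piece (2 * M) u k $$ (i, j) = (if int i = (int j + k) mod int (2 * M) then u y else 0)"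
    using i j by (simp add: piece_def y_def)
  have R: "emb M (b * M) (piece M u1 k) $$ (i, j) =
    (if ?in (int i) \<and> ?in (int j) \<and> int i - int (b * M) = (int j - int (b * M) + k) mod int M then u1 x else 0)"
    unfolding inn using i j by (auto simp: emb_def piece_def x_def of_nat_diff)
  have b2: "int (b * M) + int M \<le> int (2 * M)" using bb by auto
  show "piece (2 * M) u k $$ (i, j) = emb M (b * M) (piece M u1 k) $$ (i, j)"
  proof (cases "?in (int j) \<and> ?in (int j + k)")
    case True
    then have m1: "(int j + k) mod int (2 * M) = int j + k"
      using b2 of_nat_0_le_iff[of "b * M"] by (intro mod_pos_pos_trivial) linarith+
    have m2: "(int j - int (b * M) + k) mod int M = int j - int (b * M) + k"
      using True by (intro mod_pos_pos_trivial) linarith+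
    show ?thesis unfolding L R m1 m2 using True C by auto
  next
    case False
    have "u y = 0" using A False by blast
    moreover have "?in (int j) \<Longrightarrow> u1 x = 0" using B False by blast
    ultimately show ?thesis unfolding L R by auto
  qed
qed (simp_all add: emb_def piece_def)

text \<open>Jumps below the threshold cancel exactly by \<open>piece_eq_emb\<close>. Each of the
  others costs at most \<open>2 * s\<close> times its coefficient, by the triangle
  inequality.\<close>

lemma emb_opt_approx:
  fixes b :: nat
  assumes M: "M > 0" and b: "b \<le> 1" and per: "per1 u" and \<eta>: "0 < \<eta>" "4 * \<eta> \<le> 1"
    and u1: "\<And>x. u1 x = u (real b / 2 + frac x / 2)"
    and supp: "\<And>x. u x \<noteq> 0 \<Longrightarrow> real b / 2 + \<eta> < frac x \<and> frac x < real b / 2 + 1 / 2 - \<eta>"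
    and u: "\<And>x. cmod (u x) \<le> s" and V: "(\<lambda>k. norm (V k)) summable_on UNIV"
    and T: "infsum (\<lambda>k. norm (V k)) {k. 4 * real M * \<eta> \<le> \<bar>of_int k\<bar>} \<le> T"
  shows "op_bound (2 * M) (opt (2 * M) u V - emb M (b * M) (opt M u1 V)) (2 * s * T)"
proof (rule op_bound_has_sum[where B = "\<lambda>k. V k \<cdot>\<^sub>m (piece (2 * M) u k - emb M (b * M) (piece M u1 k))"
      and b = "\<lambda>k. if 4 * real M * \<eta> \<le> \<bar>of_int k\<bar> then 2 * s * norm (V k) else 0"])
  have u1s: "cmod (u1 x) \<le> s" for x using u u1 by simp
  have M2: "2 * M > 0" using M by simp
  have off: "b * M \<le> M" using b by (cases b) auto
  show "opt (2 * M) u V - emb M (b * M) (opt M u1 V) \<in> carrier_mat (2 * M) (2 * M)"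
    by (rule minus_carrier_mat) simp
  show "op_bound (2 * M) (V k \<cdot>\<^sub>m (piece (2 * M) u k - emb M (b * M) (piece M u1 k)))
     (if 4 * real M * \<eta> \<le> \<bar>of_int k\<bar> then 2 * s * norm (V k) else 0)" for k
  proof (cases "4 * real M * \<eta> \<le> \<bar>of_int k\<bar>")
    case True
    have "op_bound (2 * M) (V k \<cdot>\<^sub>m (piece (2 * M) u k - emb M (b * M) (piece M u1 k))) (cmod (V k) * (s + s))"
      by (intro op_bound_smult op_bound_minus op_bound_piece[OF M2 u] op_bound_emb_piece[OF M off u1s])
    then show ?thesis using True by (simp add: mult_ac)
  next
    case False
    then have "piece (2 * M) u k = emb M (b * M) (piece M u1 k)"
      by (intro piece_eq_emb[OF M b per \<eta>(1) u1 supp _ \<eta>(2)]) auto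
    then have "V k \<cdot>\<^sub>m (piece (2 * M) u k - emb M (b * M) (piece M u1 k)) = 0\<^sub>m (2 * M) (2 * M)"
      by (auto simp: emb_def)
    then show ?thesis using False op_bound_zero by simp
  qed
  have o2: "((\<lambda>k. V k * piece M u1 k $$ (i, j)) has_sum opt M u1 V $$ (i, j)) UNIV" if "i < M" "j < M" for i j
    by (rule opt_has_sum[OF V u1s that])
  show "((\<lambda>k. (V k \<cdot>\<^sub>m (piece (2 * M) u k - emb M (b * M) (piece M u1 k))) $$ (i, j)) has_sum
     (opt (2 * M) u V - emb M (b * M) (opt M u1 V)) $$ (i, j)) UNIV" if ij: "i < 2 * M" "j < 2 * M" for i j
  proof -
    have "((\<lambda>k. V k * emb M (b * M) (piece M u1 k) $$ (i, j)) has_sum emb M (b * M) (opt M u1 V) $$ (i, j)) UNIV"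
    proof (cases "b * M \<le> i \<and> i < b * M + M \<and> b * M \<le> j \<and> j < b * M + M")
      case True
      then show ?thesis using o2[of "i - b * M" "j - b * M"] ij by (auto simp: emb_def)
    next
      case False
      then show ?thesis using ij by (auto simp: emb_def)
    qed
    note h2 = has_sum_cmult_right[OF this, of "-1"]
    have h1: "((\<lambda>k. V k * piece (2 * M) u k $$ (i, j)) has_sum opt (2 * M) u V $$ (i, j)) UNIV"
      by (rule opt_has_sum[OF V u ij])
    show ?thesis
      using has_sum_add[OF h1 h2] ij
      by (simp add: right_diff_distrib mat_dims)
  qed
  have n: "(\<lambda>k. if 4 * real M * \<eta> \<le> \<bar>of_int k\<bar> then 2 * s * norm (V k) else 0) summable_on UNIV \<longleftrightarrow>
    (\<lambda>k. 2 * s * norm (V k)) summable_on {k. 4 * real M * \<eta> \<le> \<bar>of_int k\<bar>}"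
    by (rule summable_on_cong_neutral) auto
  show "(\<lambda>k. if 4 * real M * \<eta> \<le> \<bar>of_int k\<bar> then 2 * s * norm (V k) else 0) summable_on UNIV"
    unfolding n by (intro summable_on_cmult_right summable_on_subset_banach[OF V]) auto
  have "infsum (\<lambda>k. if 4 * real M * \<eta> \<le> \<bar>of_int k\<bar> then 2 * s * norm (V k) else 0) UNIV =
    infsum (\<lambda>k. 2 * s * norm (V k)) {k. 4 * real M * \<eta> \<le> \<bar>of_int k\<bar>}"
    by (rule infsum_cong_neutral) auto
  also have "\<dots> = 2 * s * infsum (\<lambda>k. norm (V k)) {k. 4 * real M * \<eta> \<le> \<bar>of_int k\<bar>}"
    by (rule infsum_cmult_right') 
  also have "\<dots> \<le> 2 * s * T"
    using T order_trans[OF norm_ge_zero u] by (intro mult_left_mono) auto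
  finally show "infsum (\<lambda>k. if 4 * real M * \<eta> \<le> \<bar>of_int k\<bar> then 2 * s * norm (V k) else 0) UNIV \<le> 2 * s * T" .
qed

section \<open>Block-diagonal matrices\<close>

definition dbl :: "nat \<Rightarrow> complex mat \<Rightarrow> complex mat" where
  "dbl M D = four_block_mat D (0\<^sub>m M M) (0\<^sub>m M M) D"

lemma dbl_carrier: "D \<in> carrier_mat M M \<Longrightarrow> dbl M D \<in> carrier_mat (2 * M) (2 * M)"
  unfolding dbl_def mult_2 by (rule four_block_carrier_mat)

lemma dbl_index:
  assumes "D \<in> carrier_mat M M" "i < 2 * M" "j < 2 * M"
  shows "dbl M D $$ (i, j) = (if (i < M) = (j < M) then D $$ (if i < M then i else i - M, if j < M then j else j - M) else 0)"
  using assms by (auto simp: dbl_def)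

lemma dbl_mult: assumes "A \<in> carrier_mat M M" "B \<in> carrier_mat M M" shows "dbl M A * dbl M B = dbl M (A * B)"
proof -
  have "dbl M A * dbl M B = four_block_mat (A * B + 0\<^sub>m M M * 0\<^sub>m M M) (A * 0\<^sub>m M M + 0\<^sub>m M M * B)
     (0\<^sub>m M M * B + A * 0\<^sub>m M M) (0\<^sub>m M M * 0\<^sub>m M M + A * B)"
    unfolding dbl_def by (rule mult_four_block_mat) (use assms in auto)
  then show ?thesis using assms by (simp add: dbl_def)
qed

lemma dbl_one: "dbl M (1\<^sub>m M) = 1\<^sub>m (2 * M)"
  by (rule eq_matI) (auto simp: dbl_index, auto simp: dbl_def)

lemma sum_block:
  fixes M :: nat
  assumes "off = 0 \<or> off = M" and z: "\<And>l. l < 2 * M \<Longrightarrow> \<not> (off \<le> l \<and> l < off + M) \<Longrightarrow> f l = 0"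
  shows "(\<Sum>l<2 * M. f l) = (\<Sum>l<M. f (off + l) :: complex)"
proof -
  have "(\<Sum>l<2 * M. f l) = (\<Sum>l\<in>{off..<off + M}. f l)"
    by (rule sum.mono_neutral_right) (use assms in auto)
  also have "\<dots> = (\<Sum>l<M. f (off + l))"
    using sum.shift_bounds_nat_ivl[of f 0 off M] by (simp add: lessThan_atLeast0 add.commute)
  finally show ?thesis .
qed

lemma dbl_emb:
  assumes D: "D \<in> carrier_mat M M" and A: "A \<in> carrier_mat M M" and off: "off = 0 \<or> off = M"
  shows "dbl M D * emb M off A = emb M off (D * A)" "emb M off A * dbl M D = emb M off (A * D)"
proof -
  show "dbl M D * emb M off A = emb M off (D * A)"
  proof (rule eq_matI)
    fix i j assume "i < dim_row (emb M off (D * A))" "j < dim_col (emb M off (D * A))"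
    then have i: "i < 2 * M" and j: "j < 2 * M" by (simp_all add: emb_def)
    have "(dbl M D * emb M off A) $$ (i, j) = (\<Sum>l<2 * M. dbl M D $$ (i, l) * emb M off A $$ (l, j))"
      by (rule mat_mult_index[OF dbl_carrier[OF D] emb_carrier i j])
    also have "\<dots> = (\<Sum>l<M. dbl M D $$ (i, off + l) * emb M off A $$ (off + l, j))"
      by (rule sum_block[OF off]) (use j in \<open>auto simp: emb_def\<close>)
    also have "\<dots> = emb M off (D * A) $$ (i, j)"
    proof (cases "off \<le> i \<and> i < off + M \<and> off \<le> j \<and> j < off + M")
      case True
      have "dbl M D $$ (i, off + l) * emb M off A $$ (off + l, j) = D $$ (i - off, l) * A $$ (l, j - off)" if "l < M" for l
        using True that off i j by (auto simp: dbl_index[OF D] emb_def)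
      moreover have "emb M off (D * A) $$ (i, j) = (\<Sum>l<M. D $$ (i - off, l) * A $$ (l, j - off))"
        using True i j mat_mult_index[OF D A, of "i - off" "j - off"] by (auto simp: emb_def)
      ultimately show ?thesis by simp
    next
      case False
      have "dbl M D $$ (i, off + l) * emb M off A $$ (off + l, j) = 0" if "l < M" for l
        using False that off i j by (auto simp: dbl_index[OF D] emb_def)
      then have "(\<Sum>l<M. dbl M D $$ (i, off + l) * emb M off A $$ (off + l, j)) = 0" by (intro sum.neutral) blast
      moreover have "emb M off (D * A) $$ (i, j) = 0" using False i j by (auto simp: emb_def)
      ultimately show ?thesis by simp
    qed
    finally show "(dbl M D * emb M off A) $$ (i, j) = emb M off (D * A) $$ (i, j)" .
  qed (use dbl_carrier[OF D] in \<open>auto simp: emb_def\<close>)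
  show "emb M off A * dbl M D = emb M off (A * D)"
  proof (rule eq_matI)
    fix i j assume "i < dim_row (emb M off (A * D))" "j < dim_col (emb M off (A * D))"
    then have i: "i < 2 * M" and j: "j < 2 * M" by (simp_all add: emb_def)
    have "(emb M off A * dbl M D) $$ (i, j) = (\<Sum>l<2 * M. emb M off A $$ (i, l) * dbl M D $$ (l, j))"
      by (rule mat_mult_index[OF emb_carrier dbl_carrier[OF D] i j])
    also have "\<dots> = (\<Sum>l<M. emb M off A $$ (i, off + l) * dbl M D $$ (off + l, j))"
      by (rule sum_block[OF off]) (use i in \<open>auto simp: emb_def\<close>)
    also have "\<dots> = emb M off (A * D) $$ (i, j)"
    proof (cases "off \<le> i \<and> i < off + M \<and> off \<le> j \<and> j < off + M")
      case True
      have "emb M off A $$ (i, off + l) * dbl M D $$ (off + l, j) = A $$ (i - off, l) * D $$ (l, j - off)" if "l < M" for l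
        using True that off i j by (auto simp: dbl_index[OF D] emb_def)
      moreover have "emb M off (A * D) $$ (i, j) = (\<Sum>l<M. A $$ (i - off, l) * D $$ (l, j - off))"
        using True i j mat_mult_index[OF A D, of "i - off" "j - off"] by (auto simp: emb_def)
      ultimately show ?thesis by simp
    next
      case False
      have "emb M off A $$ (i, off + l) * dbl M D $$ (off + l, j) = 0" if "l < M" for l
        using False that off i j by (auto simp: dbl_index[OF D] emb_def)
      then have "(\<Sum>l<M. emb M off A $$ (i, off + l) * dbl M D $$ (off + l, j)) = 0" by (intro sum.neutral) blast
      moreover have "emb M off (A * D) $$ (i, j) = 0" using False i j by (auto simp: emb_def)
      ultimately show ?thesis by simp
    qed
    finally show "(emb M off A * dbl M D) $$ (i, j) = emb M off (A * D) $$ (i, j)" .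
  qed (use dbl_carrier[OF D] in \<open>auto simp: emb_def\<close>)
qed

lemma dbl_orthonormal:
  assumes D: "D \<in> carrier_mat M M"
    and o: "\<And>j l. j < M \<Longrightarrow> l < M \<Longrightarrow> (\<Sum>i<M. D $$ (i, j) * cnj (D $$ (i, l))) = (if j = l then 1 else 0)"
  shows "op_bound (2 * M) (dbl M D) 1"
proof (rule op_bound_orthonormal_columns[OF dbl_carrier[OF D]])
  fix j l assume jl: "j < 2 * M" "l < 2 * M"
  let ?f = "\<lambda>i. dbl M D $$ (i, j) * cnj (dbl M D $$ (i, l))"
  show "(\<Sum>i<2 * M. ?f i) = (if j = l then 1 else 0)"
  proof (cases "(j < M) = (l < M)")
    case True
    define off where "off = (if j < M then 0 else M)"
    have "(\<Sum>i<2 * M. ?f i) = (\<Sum>i<M. ?f (off + i))"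
      by (rule sum_block) (use jl True D in \<open>auto simp: off_def dbl_index split: if_splits\<close>)
    also have "\<dots> = (\<Sum>i<M. D $$ (i, j - off) * cnj (D $$ (i, l - off)))"
      by (rule sum.cong) (use jl True D in \<open>auto simp: off_def dbl_index\<close>)
    also have "\<dots> = (if j = l then 1 else 0)"
      by (subst o) (use jl True in \<open>auto simp: off_def split: if_splits\<close>)
    finally show ?thesis .
  next
    case False
    then have "?f i = 0" if "i < 2 * M" for i using that jl D by (auto simp: dbl_index)
    then have "(\<Sum>i<2 * M. ?f i) = 0" by (intro sum.neutral) blast
    then show ?thesis using False by auto
  qed
qed

lemma mat_diff_add_cancel:
  assumes "(Y :: complex mat) \<in> carrier_mat N N" "Z \<in> carrier_mat N N" "W \<in> carrier_mat N N"
  shows "Y - Z + W - Y = W - Z"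
  using assms by (intro eq_matI) auto

section \<open>The quantum baker's map and its inverse as explicit products\<close>

definition qbaker :: "nat \<Rightarrow> complex mat" where
  "qbaker M = idft (2 * M) * dbl M (dft M)"

definition qbaker_inv :: "nat \<Rightarrow> complex mat" where
  "qbaker_inv M = dbl M (idft M) * dft (2 * M)"

lemma quantum_baker_eq: "M > 0 \<Longrightarrow> quantum_baker (2 * M) = qbaker M"
  by (simp add: quantum_baker_def qbaker_def dbl_def inv_dft)

lemma qbaker_carrier [simp]: "qbaker M \<in> carrier_mat (2 * M) (2 * M)" "qbaker_inv M \<in> carrier_mat (2 * M) (2 * M)"
  unfolding qbaker_def qbaker_inv_def
  by (rule mult_carrier_mat[OF idft_carrier dbl_carrier[OF dft_carrier]],
      rule mult_carrier_mat[OF dbl_carrier[OF idft_carrier] dft_carrier])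

lemma qbaker_inverse:
  assumes M: "M > 0"
  shows "qbaker M * qbaker_inv M = 1\<^sub>m (2 * M)" "qbaker_inv M * qbaker M = 1\<^sub>m (2 * M)"
proof -
  note c = dbl_carrier[OF dft_carrier[of M]] dbl_carrier[OF idft_carrier[of M]] dft_carrier[of "2 * M"] idft_carrier[of "2 * M"]
  have "dbl M (dft M) * (dbl M (idft M) * dft (2 * M)) = dft (2 * M)"
    using c M by (simp add: assoc_mult_mat[symmetric, of _ "2 * M" "2 * M" _ "2 * M" _ "2 * M"] dbl_mult dft_idft dbl_one left_mult_one_mat[OF dft_carrier])
  then show "qbaker M * qbaker_inv M = 1\<^sub>m (2 * M)"
    unfolding qbaker_def qbaker_inv_def
    using M assoc_mult_mat[OF c(4) c(1) mult_carrier_mat[OF c(2) c(3)]] by (simp add: dft_idft)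
  have "dft (2 * M) * (idft (2 * M) * dbl M (dft M)) = dbl M (dft M)"
    using c M by (simp add: assoc_mult_mat[symmetric, of _ "2 * M" "2 * M" _ "2 * M" _ "2 * M"] dft_idft)
  then show "qbaker_inv M * qbaker M = 1\<^sub>m (2 * M)"
    unfolding qbaker_def qbaker_inv_def
    using M assoc_mult_mat[OF c(2) c(3) mult_carrier_mat[OF c(4) c(1)]] by (simp add: dft_idft dbl_mult dbl_one)
qed

lemma op_bound_dbl_dft: assumes "M > 0" shows "op_bound (2 * M) (dbl M (dft M)) 1" "op_bound (2 * M) (dbl M (idft M)) 1"
  by (rule dbl_orthonormal; simp add: dft_orthonormal assms)+

lemma op_bound_qbaker: assumes "M > 0" shows "op_bound (2 * M) (qbaker M) 1" "op_bound (2 * M) (qbaker_inv M) 1"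
  using op_bound_mult[OF op_bound_dft(2)[of "2 * M"] op_bound_dbl_dft(1)[OF assms]] op_bound_mult[OF op_bound_dbl_dft(2)[OF assms] op_bound_dft(1)[of "2 * M"]] assms
  by (simp_all add: qbaker_def qbaker_inv_def)

text \<open>One application of the map: the two halves of the position circle become the two halves
  of the momentum circle, up to the Fourier tails of the factors.\<close>

lemma qbaker_step:
  fixes b :: nat
  assumes M: "M > 0" and b: "b \<le> 1"
    and w: "wiener u U" "wiener v V" "wiener u1 U1" "wiener v1 V1"
    and \<eta>: "0 < \<eta>" "4 * \<eta> \<le> 1" and \<eta>': "0 < \<eta>'" "4 * \<eta>' \<le> 1"
    and u1: "\<And>x. u1 x = u (real b / 2 + frac x / 2)" and v1: "\<And>x. v x = v1 (real b / 2 + frac x / 2)"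
    and su: "\<And>x. u x \<noteq> 0 \<Longrightarrow> real b / 2 + \<eta> < frac x \<and> frac x < real b / 2 + 1 / 2 - \<eta>"
    and sv: "\<And>x. v1 x \<noteq> 0 \<Longrightarrow> real b / 2 + \<eta>' < frac x \<and> frac x < real b / 2 + 1 / 2 - \<eta>'"
    and nu: "\<And>x. cmod (u x) \<le> s" and nv: "\<And>x. cmod (v1 x) \<le> s'"
    and T: "infsum (\<lambda>k. norm (V k)) {k. 4 * real M * \<eta> \<le> \<bar>of_int k\<bar>} \<le> T"
    and T': "infsum (\<lambda>k. norm (U1 k)) {k. 4 * real M * \<eta>' \<le> \<bar>of_int k\<bar>} \<le> T'"
  shows "op_bound (2 * M) (qbaker M * opt (2 * M) u (\<lambda>k. V (- k)) - opt (2 * M) u1 (\<lambda>k. V1 (- k)) * qbaker M)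
     (2 * s * T + 2 * s' * T')"
proof -
  let ?N = "2 * M" and ?V = "\<lambda>k. V (- k)" and ?V1 = "\<lambda>k. V1 (- k)" and ?o = "b * M"
  have off: "?o = 0 \<or> ?o = M" using b by (cases b) auto
  have V': "(\<lambda>k. norm (V (- k))) summable_on UNIV"
    using w(2) summable_on_neg_iff[of "\<lambda>k. norm (V k)"] by (simp add: wiener_def)
  have U1': "(\<lambda>k. norm (U1 k)) summable_on UNIV" using w(3) by (simp add: wiener_def)
  have "infsum (\<lambda>k. norm (?V k)) {k. 4 * real M * \<eta> \<le> \<bar>of_int k\<bar>} = infsum (\<lambda>k. norm (V k)) {k. 4 * real M * \<eta> \<le> \<bar>of_int k\<bar>}"
    by (rule infsum_reindex_bij_betw) (rule bij_betwI[where g = uminus]; auto)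
  then have T2: "infsum (\<lambda>k. norm (?V k)) {k. 4 * real M * \<eta> \<le> \<bar>of_int k\<bar>} \<le> T" using T by simp
  define D where "D = dbl M (dft M)"
  define F where "F = idft ?N"
  define E1 where "E1 = opt ?N u ?V - emb M ?o (opt M u1 ?V)"
  define E2 where "E2 = opt ?N v1 U1 - emb M ?o (opt M v U1)"
  have bE1: "op_bound ?N E1 (2 * s * T)" unfolding E1_def
    by (rule emb_opt_approx[OF M b wiener_per1[OF w(1)] \<eta> u1 su nu V' T2])
  have bE2: "op_bound ?N E2 (2 * s' * T')" unfolding E2_def
    by (rule emb_opt_approx[OF M b wiener_per1[OF w(4)] \<eta>' v1 sv nv U1' T'])
  have bD: "op_bound ?N D 1" unfolding D_def by (rule op_bound_dbl_dft(1)[OF M])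
  have bF: "op_bound ?N F 1" unfolding F_def using M by (intro op_bound_dft(2)) simp
  have cD: "D \<in> carrier_mat ?N ?N" and cF: "F \<in> carrier_mat ?N ?N" and cE1: "E1 \<in> carrier_mat ?N ?N"
    and cE2: "E2 \<in> carrier_mat ?N ?N" using bD bF bE1 bE2 op_bound_carrier by blast+
  let ?A = "opt ?N u ?V" and ?A1 = "opt ?N u1 ?V1" and ?P = "emb M ?o (opt M u1 ?V)" and ?Q = "emb M ?o (opt M v U1)"
    and ?R = "opt ?N v1 U1"
  have cA: "?A \<in> carrier_mat ?N ?N" "?A1 \<in> carrier_mat ?N ?N" "?P \<in> carrier_mat ?N ?N" "?Q \<in> carrier_mat ?N ?N" "?R \<in> carrier_mat ?N ?N"
    by auto
  \<comment> \<open>Inside the block, the transform of size \<open>M\<close> makes a quarter turn: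
    \<open>v\<close> becomes the position factor, and the coefficients of \<open>u1\<close> become
    those of the momentum factor.\<close>
  have DP: "D * ?P = ?Q * D"
  proof -
    have "D * ?P = emb M ?o (dft M * opt M u1 ?V)" unfolding D_def by (rule dbl_emb(1)[OF dft_carrier opt_carrier off])
    also have "dft M * opt M u1 ?V = opt M v U1 * dft M" by (rule dft_opt[OF M w(3) w(2)])
    also have "emb M ?o \<dots> = ?Q * D" unfolding D_def by (rule dbl_emb(2)[OF dft_carrier opt_carrier off, symmetric])
    finally show ?thesis .
  qed
  \<comment> \<open>After the block has been replaced by the full matrix with position factor
    \<open>v1\<close>, the inverse transform of size \<open>2 * M\<close> turns back. The errors
    \<open>E1\<close> and \<open>E2\<close> stem from the two passages between block and full
    matrix.\<close>
  have FR: "F * ?R = ?A1 * F"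
  proof -
    have N: "?N > 0" using M by simp
    note inv = dft_idft[OF N]
    have d: "dft ?N * ?A1 = ?R * dft ?N" by (rule dft_opt[OF N w(3) w(4)])
    have "F * ?R = F * (?R * (dft ?N * F))" using inv by (simp add: F_def right_mult_one_mat[OF opt_carrier])
    also have "\<dots> = F * (?R * dft ?N * F)"
      by (subst assoc_mult_mat[OF cA(5) dft_carrier cF]) simp
    also have "\<dots> = F * (dft ?N * (?A1 * F))"
      unfolding d[symmetric] by (subst assoc_mult_mat[OF dft_carrier cA(2) cF]) simp
    also have "\<dots> = (F * dft ?N) * (?A1 * F)"
      by (subst assoc_mult_mat[OF cF dft_carrier mult_carrier_mat[OF cA(2) cF]]) simp
    also have "\<dots> = ?A1 * F" using inv by (simp add: F_def left_mult_one_mat[OF mult_carrier_mat[OF opt_carrier idft_carrier]])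
    finally show ?thesis .
  qed
  have "qbaker M = F * D" by (simp add: qbaker_def F_def D_def)
  have A: "?A = ?P + E1" unfolding E1_def by (intro eq_matI) (auto simp: mat_dims)
  have Q: "?Q = ?R - E2" unfolding E2_def by (intro eq_matI) (auto simp: mat_dims)
  have "F * D * ?A = F * (D * ?P) + F * D * E1"
    unfolding A by (subst mult_add_distrib_mat[OF mult_carrier_mat[OF cF cD] cA(3) cE1])
      (subst assoc_mult_mat[OF cF cD cA(3)], rule refl)
  also have "F * (D * ?P) = F * ?Q * D" unfolding DP by (rule assoc_mult_mat[OF cF cA(4) cD, symmetric])
  also have "F * ?Q = ?A1 * F - F * E2"
    unfolding Q FR[symmetric] by (rule mult_minus_distrib_mat[OF cF cA(5) cE2])
  also have "(?A1 * F - F * E2) * D = ?A1 * (F * D) - F * E2 * D"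
    by (subst minus_mult_distrib_mat[OF mult_carrier_mat[OF cA(2) cF] mult_carrier_mat[OF cF cE2] cD])
      (subst assoc_mult_mat[OF cA(2) cF cD], rule refl)
  finally have "F * D * ?A = ?A1 * (F * D) - F * E2 * D + F * D * E1" .
  moreover have "?A1 * (F * D) \<in> carrier_mat ?N ?N" "F * E2 * D \<in> carrier_mat ?N ?N" "F * D * E1 \<in> carrier_mat ?N ?N"
    by (intro mult_carrier_mat[of _ ?N ?N] cA cF cD cE1 cE2)+
  ultimately have "F * D * ?A - ?A1 * (F * D) = F * D * E1 - F * E2 * D"
    by (simp only: mat_diff_add_cancel)
  moreover have "op_bound ?N (F * D * E1 - F * E2 * D) (1 * 1 * (2 * s * T) + 1 * (2 * s' * T') * 1)"
    by (intro op_bound_minus op_bound_mult bF bD bE1 bE2)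
  ultimately show ?thesis using \<open>qbaker M = F * D\<close> by simp
qed

section \<open>Bumps and cells\<close>

lemma summable_on_int_abs:
  assumes "summable (f :: nat \<Rightarrow> real)" and f0: "\<And>n. 0 \<le> f n"
  shows "(\<lambda>k::int. f (nat \<bar>k\<bar>)) summable_on UNIV"
proof -
  have 1: "(\<lambda>k::int. f (nat \<bar>k\<bar>)) summable_on {0..}"
  proof -
    have "bij_betw int UNIV {0..}" by (rule bij_betwI[where g = nat]) auto
    then have "(\<lambda>k::int. f (nat \<bar>k\<bar>)) summable_on {0..} \<longleftrightarrow> (\<lambda>n. f (nat \<bar>int n\<bar>)) summable_on UNIV"
      by (rule summable_on_reindex_bij_betw[symmetric])
    then show ?thesis using assms by (simp add: norm_summable_imp_summable_on)
  qed
  have 2: "(\<lambda>k::int. f (nat \<bar>k\<bar>)) summable_on {..<0}"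
  proof -
    have "bij_betw (\<lambda>n. - int n - 1) UNIV {..<0}" by (rule bij_betwI[where g = "\<lambda>k. nat (- k - 1)"]) auto
    then have "(\<lambda>k::int. f (nat \<bar>k\<bar>)) summable_on {..<0} \<longleftrightarrow> (\<lambda>n. f (nat \<bar>- int n - 1\<bar>)) summable_on UNIV"
      by (rule summable_on_reindex_bij_betw[symmetric])
    moreover have "nat \<bar>- int n - 1\<bar> = Suc n" for n by auto
    moreover have "summable (\<lambda>n. f (Suc n))" using assms by (simp add: summable_Suc_iff)
    ultimately show ?thesis using f0 by (simp add: norm_summable_imp_summable_on)
  qed
  have "UNIV = {0..} \<union> {..<(0::int)}" by auto
  then show ?thesis using summable_on_union[OF 1 2] by simp
qed

definition lattice_sum :: real where "lattice_sum = (\<Sum>\<^sub>\<infinity>k::int. 1 / (1 + (of_int k)\<^sup>2))"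

lemma lattice_sum_summable: "(\<lambda>k::int. 1 / (1 + (real_of_int k)\<^sup>2)) summable_on UNIV"
proof -
  have "summable (\<lambda>n. 1 / (1 + (real n)\<^sup>2))"
  proof (rule summable_comparison_test'[OF inverse_power_summable[of 2, where 'a = real]])
    show "norm (1 / (1 + (real n)\<^sup>2)) \<le> inverse ((real n)\<^sup>2)" if "n \<ge> 1" for n
    proof -
      have "0 < (real n)\<^sup>2" using that by simp
      then show ?thesis by (simp add: inverse_eq_divide frac_le)
    qed
  qed simp
  from summable_on_int_abs[OF this] show ?thesis by simp
qed

lemma lattice_sum_nonneg: "0 \<le> lattice_sum"
  unfolding lattice_sum_def by (rule infsum_nonneg) simp

text \<open>Uniformity in \<open>x\<close> is the point, since \<open>x\<close> will be the
  frequency of a plane wave. An integer reindexing replaces \<open>x\<close> by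
  \<open>frac x\<close>, and a shift by less than 1 costs a factor 3.\<close>

lemma shifted_lattice_sum:
  fixes x :: real
  shows "(\<lambda>k::int. 1 / (1 + (of_int k - x)\<^sup>2)) summable_on UNIV"
    and "(\<Sum>\<^sub>\<infinity>k::int. 1 / (1 + (of_int k - x)\<^sup>2)) \<le> 3 * lattice_sum"
proof -
  define m where "m = \<lfloor>x\<rfloor>"
  let ?g = "\<lambda>j::int. 1 / (1 + (of_int j - frac x)\<^sup>2)"
  have bij: "bij_betw (\<lambda>k. k - m) UNIV UNIV" by (rule bij_betwI[where g = "\<lambda>k. k + m"]) auto
  have e: "1 / (1 + (of_int k - x)\<^sup>2) = ?g (k - m)" for k :: int by (simp add: frac_def m_def algebra_simps)
  have le: "?g j \<le> 3 * (1 / (1 + (of_int j)\<^sup>2))" for j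
  proof -
    have f: "0 \<le> frac x" "frac x < 1" by (auto simp: frac_lt_1)
    have "0 \<le> (of_int j - 2 * (of_int j - frac x))\<^sup>2" by simp
    then have "(of_int j)\<^sup>2 \<le> 2 * (of_int j - frac x)\<^sup>2 + 2 * (frac x)\<^sup>2"
      by (simp add: power2_eq_square algebra_simps)
    moreover have "(frac x)\<^sup>2 \<le> 1" using f by (simp add: power_le_one)
    moreover have "0 \<le> (of_int j - frac x)\<^sup>2" by simp
    moreover have "1 + J \<le> 3 * (1 + D)" if "J \<le> 2 * D + 2 * F" "F \<le> 1" "0 \<le> D" for J D F :: real
      using that by argo
    ultimately have "1 + (of_int j)\<^sup>2 \<le> 3 * (1 + (of_int j - frac x)\<^sup>2)" by blast
    moreover have "0 < 1 + (of_int j - frac x)\<^sup>2" "0 < 1 + (real_of_int j)\<^sup>2" by (smt (verit) zero_le_power2)+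
    ultimately show ?thesis by (simp add: field_simps)
  qed
  have s: "?g summable_on UNIV"
    by (rule summable_on_comparison_test[OF summable_on_cmult_right[OF lattice_sum_summable, of 3] le]) simp
  show "(\<lambda>k::int. 1 / (1 + (of_int k - x)\<^sup>2)) summable_on UNIV"
    unfolding e using s summable_on_reindex_bij_betw[OF bij, of ?g] by simp
  have "(\<Sum>\<^sub>\<infinity>k::int. 1 / (1 + (of_int k - x)\<^sup>2)) = infsum ?g UNIV"
    unfolding e by (rule infsum_reindex_bij_betw[OF bij])
  also have "\<dots> \<le> (\<Sum>\<^sub>\<infinity>j::int. 3 * (1 / (1 + (of_int j)\<^sup>2)))"
    by (rule infsum_mono[OF s summable_on_cmult_right[OF lattice_sum_summable] le])
  also have "\<dots> = 3 * lattice_sum" unfolding lattice_sum_def by (rule infsum_cmult_right')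
  finally show "(\<Sum>\<^sub>\<infinity>k::int. 1 / (1 + (of_int k - x)\<^sup>2)) \<le> 3 * lattice_sum" .
qed

section \<open>Dilated bumps and their Fourier coefficients\<close>

definition rft :: "(real \<Rightarrow> complex) \<Rightarrow> real \<Rightarrow> complex" where
  "rft W \<xi> = integral {0..1} (\<lambda>x. W x * ee (- (\<xi> * x)))"

definition bump :: "(real \<Rightarrow> complex) \<Rightarrow> nat \<Rightarrow> nat \<Rightarrow> real \<Rightarrow> complex" where
  "bump W r i t = W (2 ^ r * frac t - real i)"

text \<open>The margin \<delta> keeps a bump away from the ends of its cell. At positive levels
  these ends include the discontinuities of the map.\<close>

definition profile :: "real \<Rightarrow> (real \<Rightarrow> complex) \<Rightarrow> bool" where
  "profile \<delta> W \<longleftrightarrow> continuous_on UNIV W \<and> (\<forall>x. W x \<noteq> 0 \<longrightarrow> \<delta> < x \<and> x < 1 - \<delta>)"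

lemma profile_zero: "profile \<delta> W \<Longrightarrow> x \<le> \<delta> \<or> 1 - \<delta> \<le> x \<Longrightarrow> W x = 0"
  unfolding profile_def by (metis linorder_not_less)

lemma two_power_real_le: "i < 2 ^ r \<Longrightarrow> real i + 1 \<le> 2 ^ r"
  by (metis Suc_eq_plus1 Suc_leI of_nat_1 of_nat_add of_nat_le_iff of_nat_numeral of_nat_power)

lemma bump_per1: "per1 (bump W r i)"
  by (simp add: per1_def bump_def frac_1_eq)

lemma bump_supp:
  assumes W: "profile \<delta> W" and "bump W r i x \<noteq> 0"
  shows "(real i + \<delta>) / 2 ^ r < frac x" "frac x < (real i + 1 - \<delta>) / 2 ^ r"
  using assms unfolding bump_def profile_def by (force simp: field_simps)+

text \<open>The only danger is the jump of \<open>frac\<close> at the integers, and near those the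
  bump vanishes within distance \<delta> / 2^r.\<close>

lemma bump_continuous:
  assumes W: "profile \<delta> W" and \<delta>: "0 < \<delta>" and i: "i < 2 ^ r"
  shows "continuous_on UNIV (bump W r i)"
proof -
  have "isCont (bump W r i) t" for t
  proof (cases "t \<in> \<int>")
    case False
    have "isCont (\<lambda>t. 2 ^ r * frac t - real i) t"
      by (intro continuous_intros continuous_frac False)
    moreover have "isCont W x" for x using W by (auto simp: profile_def continuous_on_eq_continuous_at)
    ultimately show ?thesis unfolding bump_def by (rule isCont_o2)
  next
    case True
    then obtain m :: int where m: "t = of_int m" by (auto elim: Ints_cases)
    have z: "bump W r i s = 0" if "dist s t < \<delta> / 2 ^ r" for s
    proof (rule ccontr)
      assume nz: "bump W r i s \<noteq> 0"
      have f: "\<delta> / 2 ^ r \<le> (real i + \<delta>) / 2 ^ r" by (intro divide_right_mono) auto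
      have "real i + 1 \<le> 2 ^ r" by (rule two_power_real_le[OF i])
      then have "(real i + 1) / 2 ^ r \<le> 1" by simp
      then have h: "(real i + 1 - \<delta>) / 2 ^ r \<le> 1 - \<delta> / 2 ^ r" by (simp add: diff_divide_distrib)
      have g: "\<delta> / 2 ^ r < frac s" "frac s < 1 - \<delta> / 2 ^ r"
        using bump_supp[OF W nz] f h by linarith+
      have "\<bar>s - of_int m\<bar> < \<delta> / 2 ^ r" using that m by (simp add: dist_real_def)
      moreover have "s = of_int \<lfloor>s\<rfloor> + frac s" by (simp add: frac_def)
      ultimately have a: "\<bar>of_int (\<lfloor>s\<rfloor> - m) + frac s\<bar> < \<delta> / 2 ^ r" by (simp add: algebra_simps)
      then have "of_int (\<lfloor>s\<rfloor> - m) < (0 :: real)" "- 1 < (of_int (\<lfloor>s\<rfloor> - m) :: real)" using g by linarith+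
      then have "of_int (\<lfloor>s\<rfloor> - m) < (of_int 0 :: real)" "of_int (- 1) < (of_int (\<lfloor>s\<rfloor> - m) :: real)"
        by (simp_all only: of_int_0 of_int_minus of_int_1)
      then show False unfolding of_int_less_iff by simp
    qed
    have "eventually (\<lambda>s. bump W r i s = 0) (nhds t)"
      unfolding eventually_nhds_metric using z \<delta> by (intro exI[of _ "\<delta> / 2 ^ r"]) auto
    then show ?thesis by (subst isCont_cong) auto
  qed
  then show ?thesis by (simp add: continuous_at_imp_continuous_on)
qed

lemma has_integral_dilate:
  fixes f :: "real \<Rightarrow> complex"
  assumes "(f has_integral J) {0..1}" "m > 0"
  shows "((\<lambda>t. f (m * t - c)) has_integral J / of_real m) ((\<lambda>t. t / m + c / m) ` {0..1})"
  using has_integral_affinity[of f J 0 1 m "- c"] assms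
  by (simp add: scaleR_conv_of_real divide_inverse mult.commute)

text \<open>Since \<open>W\<close> vanishes outside the unit interval, \<open>rft W\<close> is its
  Fourier transform on the line. Compression by 2^r samples it at multiples of 2^-r, and the
  position of the cell enters only as a phase.\<close>

lemma fc1_bump:
  assumes W: "profile \<delta> W" and \<delta>: "0 < \<delta>" and i: "i < 2 ^ r"
  shows "fc1 (bump W r i) k = ee (- (of_int k * real i / 2 ^ r)) * rft W (of_int k / 2 ^ r) / 2 ^ r"
proof -
  let ?m = "2 ^ r :: real"
  let ?f = "\<lambda>x. W x * ee (- (of_int k / ?m * (x + real i)))"
  have cW: "continuous_on S W" for S using W by (auto simp: profile_def intro: continuous_on_subset)
  have e: "?f = (\<lambda>x. ee (- (of_int k * real i / ?m)) * (W x * ee (- (of_int k / ?m * x))))"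
  proof
    fix x
    have "- (of_int k / ?m * (x + real i)) = - (of_int k * real i / ?m) + - (of_int k / ?m * x)"
      by (simp add: field_simps)
    then show "?f x = ee (- (of_int k * real i / ?m)) * (W x * ee (- (of_int k / ?m * x)))"
      unfolding \<open>- (of_int k / ?m * (x + real i)) = _\<close> ee_add by (simp only: mult_ac)
  qed
  have "(?f has_integral (ee (- (of_int k * real i / ?m)) * rft W (of_int k / ?m))) {0..1}"
    unfolding e rft_def
    by (intro has_integral_mult_right integrable_integral integrable_continuous_real continuous_intros cW)
  from has_integral_dilate[OF this, of ?m "real i"]
  have "((\<lambda>t. ?f (?m * t - real i)) has_integral (ee (- (of_int k * real i / ?m)) * rft W (of_int k / ?m)) / ?m)
     ((\<lambda>t. t / ?m + real i / ?m) ` {0..1})"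
    by simp
  then have 1: "((\<lambda>t. ?f (?m * t - real i)) has_integral (ee (- (of_int k * real i / ?m)) * rft W (of_int k / ?m)) / ?m) UNIV"
  proof (rule has_integral_on_superset)
    fix t assume t: "t \<notin> (\<lambda>t. t / ?m + real i / ?m) ` {0..1}"
    have "\<not> (0 \<le> ?m * t - real i \<and> ?m * t - real i \<le> 1)"
    proof
      assume *: "0 \<le> ?m * t - real i \<and> ?m * t - real i \<le> 1"
      have "t \<in> (\<lambda>t. t / ?m + real i / ?m) ` {0..1}"
      proof (rule image_eqI[of _ _ "?m * t - real i"])
        show "t = (?m * t - real i) / ?m + real i / ?m" by (simp add: field_simps)
      qed (use * in auto)
      then show False using t by simp
    qed
    then have "W (?m * t - real i) = 0" using \<delta> by (intro profile_zero[OF W]) auto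
    then show "?f (?m * t - real i) = 0" by simp
  qed simp
  have i1: "real i + 1 \<le> ?m" by (rule two_power_real_le[OF i])
  have 2: "(if t \<in> {0..1} then bump W r i t * ee (- (of_int k * t)) else 0) = ?f (?m * t - real i)" for t
  proof (cases "0 \<le> t \<and> t < 1")
    case True
    then have "frac t = t" by (simp add: frac_eq)
    then show ?thesis using True by (simp add: bump_def)
  next
    case False
    note * = this
    have "?m * t - real i \<le> 0 \<or> 1 \<le> ?m * t - real i"
    proof (cases "t < 0")
      case True
      then have "?m * t < 0" by (simp add: mult_less_0_iff)
      then show ?thesis by simp
    next
      case False
      then have "?m \<le> ?m * t" using * by simp
      then show ?thesis using i1 by linarith
    qed
    then have z: "W (?m * t - real i) = 0" using \<delta> by (intro profile_zero[OF W]) auto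
    \<comment> \<open>At t = 1 the periodised bump takes the value \<open>W (- real i)\<close>
      instead of \<open>W (2 ^ r - real i)\<close>. Both are zero.\<close>
    show ?thesis
    proof (cases "t = 1")
      case True
      have "W (- real i) = 0" using \<delta> by (intro profile_zero[OF W]) auto
      then show ?thesis using True z by (simp add: bump_def)
    qed (use z False in auto)
  qed
  have "((\<lambda>t. bump W r i t * ee (- (of_int k * t))) has_integral (ee (- (of_int k * real i / ?m)) * rft W (of_int k / ?m)) / ?m) {0..1}"
    using 1 by (subst has_integral_restrict_UNIV[symmetric]) (simp only: 2)
  from integral_unique[OF this] show ?thesis unfolding fc1_def by simp
qed

lemma norm_fc1_bump:
  assumes "profile \<delta> W" "0 < \<delta>" "i < 2 ^ r"
  shows "norm (fc1 (bump W r i) k) = norm (rft W (of_int k / 2 ^ r)) / 2 ^ r"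
  unfolding fc1_bump[OF assms] by (simp add: norm_mult norm_divide norm_power)

text \<open>The transform of a modulated cutoff is concentrated at the frequency of the wave.
  Keeping that centre \<kappa> as a parameter allows \<open>A\<close> to be uniform over all
  modes.\<close>

definition quad_decay :: "real \<Rightarrow> real \<Rightarrow> (real \<Rightarrow> complex) \<Rightarrow> bool" where
  "quad_decay A \<kappa> W \<longleftrightarrow> (\<forall>\<xi>. norm (rft W \<xi>) \<le> A / (1 + (\<xi> - \<kappa>)\<^sup>2))"

lemma quad_decay_nonneg: assumes "quad_decay A \<kappa> W" shows "0 \<le> A"
  using order_trans[OF norm_ge_zero assms[unfolded quad_decay_def, rule_format, of \<kappa>]] by simp

text \<open>The factor 4^r is crude but suffices: the quantitative trivial bound uses r = 0, and at
  other levels only a finite bound common to all modes is required.\<close>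

lemma rft_dilated_sum:
  assumes W: "quad_decay A \<kappa> W"
  shows "(\<lambda>k. norm (rft W (of_int k / 2 ^ r))) summable_on UNIV"
    and "(\<Sum>\<^sub>\<infinity>k. norm (rft W (of_int k / 2 ^ r))) \<le> 4 ^ r * (3 * lattice_sum) * A"
proof -
  have A: "0 \<le> A" by (rule quad_decay_nonneg[OF W])
  let ?g = "\<lambda>k::int. (4 ^ r * A) * (1 / (1 + (of_int k - 2 ^ r * \<kappa>)\<^sup>2))"
  have le: "norm (rft W (of_int k / 2 ^ r)) \<le> ?g k" for k
  proof -
    have "(of_int k - 2 ^ r * \<kappa>)\<^sup>2 = 4 ^ r * (of_int k / 2 ^ r - \<kappa>)\<^sup>2"
    proof -
      have "of_int k - 2 ^ r * \<kappa> = 2 ^ r * (of_int k / 2 ^ r - \<kappa>)" by (simp add: field_simps)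
      moreover have "(2 ^ r :: real)\<^sup>2 = 4 ^ r" by (simp add: power2_eq_square power_mult_distrib[symmetric])
      ultimately show ?thesis by (simp only: power_mult_distrib)
    qed
    moreover have "(1 :: real) \<le> 4 ^ r" by simp
    ultimately have "1 + (of_int k - 2 ^ r * \<kappa>)\<^sup>2 \<le> 4 ^ r * (1 + (of_int k / 2 ^ r - \<kappa>)\<^sup>2)"
      by (simp add: distrib_left)
    moreover have p: "0 < 1 + (of_int k - 2 ^ r * \<kappa>)\<^sup>2" "0 < 1 + (of_int k / 2 ^ r - \<kappa>)\<^sup>2"
      by (smt (verit) zero_le_power2)+
    ultimately have "1 / (1 + (of_int k / 2 ^ r - \<kappa>)\<^sup>2) \<le> 4 ^ r * (1 / (1 + (of_int k - 2 ^ r * \<kappa>)\<^sup>2))"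
      by (simp add: field_simps)
    then have "A * (1 / (1 + (of_int k / 2 ^ r - \<kappa>)\<^sup>2)) \<le> A * (4 ^ r * (1 / (1 + (of_int k - 2 ^ r * \<kappa>)\<^sup>2)))"
      using A by (rule mult_left_mono)
    moreover have "norm (rft W (of_int k / 2 ^ r)) \<le> A * (1 / (1 + (of_int k / 2 ^ r - \<kappa>)\<^sup>2))"
      using W by (simp add: quad_decay_def)
    ultimately show ?thesis by (simp add: mult_ac)
  qed
  have s: "?g summable_on UNIV" by (rule summable_on_cmult_right[OF shifted_lattice_sum(1)])
  show s': "(\<lambda>k. norm (rft W (of_int k / 2 ^ r))) summable_on UNIV"
    by (rule summable_on_comparison_test[OF s le]) simp
  have "(\<Sum>\<^sub>\<infinity>k. norm (rft W (of_int k / 2 ^ r))) \<le> infsum ?g UNIV" by (rule infsum_mono[OF s' s le])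
  also have "\<dots> = (4 ^ r * A) * (\<Sum>\<^sub>\<infinity>k::int. 1 / (1 + (of_int k - 2 ^ r * \<kappa>)\<^sup>2))" by (rule infsum_cmult_right')
  also have "\<dots> \<le> (4 ^ r * A) * (3 * lattice_sum)" using A by (intro mult_left_mono shifted_lattice_sum(2)) simp
  finally show "(\<Sum>\<^sub>\<infinity>k. norm (rft W (of_int k / 2 ^ r))) \<le> 4 ^ r * (3 * lattice_sum) * A" by (simp add: mult_ac)
qed

lemma bump_coeffs_sum:
  assumes W: "profile \<delta> W" "0 < \<delta>" "i < 2 ^ r" and d: "quad_decay A \<kappa> W"
  shows "(\<lambda>k. norm (fc1 (bump W r i) k)) summable_on UNIV"
    and "(\<Sum>\<^sub>\<infinity>k. norm (fc1 (bump W r i) k)) \<le> 2 ^ r * (3 * lattice_sum) * A"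
proof -
  have "(4 :: real) ^ r = 2 ^ r * 2 ^ r" by (simp add: power_mult_distrib[symmetric])
  then have "(\<Sum>\<^sub>\<infinity>k. norm (rft W (of_int k / 2 ^ r))) / 2 ^ r \<le> (2 ^ r * 2 ^ r * (3 * lattice_sum) * A) / 2 ^ r"
    using rft_dilated_sum(2)[OF d, of r] by (intro divide_right_mono) auto
  also have "(2 ^ r * 2 ^ r * (3 * lattice_sum) * A) / 2 ^ r = 2 ^ r * (3 * lattice_sum) * A" by simp
  also have "(\<Sum>\<^sub>\<infinity>k. norm (rft W (of_int k / 2 ^ r))) / 2 ^ r = (\<Sum>\<^sub>\<infinity>k. norm (fc1 (bump W r i) k))"
    unfolding norm_fc1_bump[OF W]
    using infsum_cmult_left'[of "\<lambda>k. norm (rft W (of_int k / 2 ^ r))" "inverse (2 ^ r)" UNIV]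
    by (simp only: divide_inverse)
  finally show "(\<Sum>\<^sub>\<infinity>k. norm (fc1 (bump W r i) k)) \<le> 2 ^ r * (3 * lattice_sum) * A" .
  show "(\<lambda>k. norm (fc1 (bump W r i) k)) summable_on UNIV"
    unfolding norm_fc1_bump[OF W] divide_inverse[of "norm _"] by (rule summable_on_cmult_left[OF rft_dilated_sum(1)[OF d]])
qed

lemma wiener_bump:
  assumes W: "profile \<delta> W" "0 < \<delta>" "i < 2 ^ r" and d: "quad_decay A \<kappa> W"
  shows "wiener (bump W r i) (fc1 (bump W r i))"
  by (rule fourier_inversion[OF bump_continuous[OF W] bump_per1 bump_coeffs_sum(1)[OF W d]])

text \<open>Of the L + 2 powers of decay, two make the sum over \<open>k\<close> converge and the
  remaining L yield the small factor. As \<open>T\<close> is positive, only nonzero frequencies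
  occur, for which 1/k^2 is at most 2/(1 + k^2).\<close>

lemma bump_tail:
  assumes W: "profile \<delta> W" "0 < \<delta>" "i < 2 ^ r"
    and t: "\<And>\<xi>. \<xi> \<noteq> 0 \<Longrightarrow> norm (rft W \<xi>) \<le> B / \<bar>\<xi>\<bar> ^ (L + 2)" and B: "0 \<le> B" and T: "0 < T"
  shows "infsum (\<lambda>k. norm (fc1 (bump W r i) k)) {k. T \<le> \<bar>of_int k\<bar>} \<le> 2 * lattice_sum * B * (2 ^ r * (2 ^ r / T) ^ L)"
proof -
  let ?c = "2 * B * (2 ^ r * (2 ^ r / T) ^ L)"
  let ?g = "\<lambda>k::int. ?c * (1 / (1 + (of_int k)\<^sup>2))"
  have c: "0 \<le> ?c" using B T by simp
  have le: "norm (fc1 (bump W r i) k) \<le> ?g k" if k: "k \<in> {k. T \<le> \<bar>of_int k\<bar>}" for k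
  proof -
    let ?x = "\<bar>real_of_int k\<bar>"
    have x: "T \<le> ?x" using k by simp
    then have x0: "0 < ?x" using T by linarith
    then have "1 \<le> \<bar>k\<bar>" by simp
    then have "1 \<le> ?x" by linarith
    have x1: "1 + ?x\<^sup>2 \<le> 2 * ?x\<^sup>2" using \<open>1 \<le> ?x\<close> one_le_power[of ?x 2] by linarith
    have "of_int k / 2 ^ r \<noteq> (0 :: real)" using x0 by auto
    from t[OF this] have "norm (fc1 (bump W r i) k) \<le> B / \<bar>of_int k / 2 ^ r\<bar> ^ (L + 2) / 2 ^ r"
      unfolding norm_fc1_bump[OF W] by (intro divide_right_mono) auto
    also have "\<dots> = B * 2 ^ r * (2 ^ r / ?x) ^ L * (1 / ?x\<^sup>2)"
      using x0 by (simp add: abs_divide power_divide power_add power2_eq_square field_simps)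
    also have "\<dots> \<le> B * 2 ^ r * (2 ^ r / T) ^ L * (2 / (1 + ?x\<^sup>2))"
    proof (intro mult_mono power_mono divide_left_mono)
      show "1 / ?x\<^sup>2 \<le> 2 / (1 + ?x\<^sup>2)" using x1 x0 by (simp add: field_simps add_pos_nonneg)
    qed (use B T x x0 in auto)
    finally show ?thesis by (simp add: mult_ac)
  qed
  have s: "?g summable_on {k. T \<le> \<bar>of_int k\<bar>}"
    by (rule summable_on_subset_banach[OF summable_on_cmult_right[OF lattice_sum_summable]]) auto
  have s': "(\<lambda>k. norm (fc1 (bump W r i) k)) summable_on {k. T \<le> \<bar>of_int k\<bar>}"
    by (rule summable_on_comparison_test[OF s le]) auto
  have "infsum (\<lambda>k. norm (fc1 (bump W r i) k)) {k. T \<le> \<bar>of_int k\<bar>} \<le> infsum ?g {k. T \<le> \<bar>of_int k\<bar>}"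
    by (rule infsum_mono[OF s' s le])
  also have "\<dots> \<le> infsum ?g UNIV"
    by (rule infsum_mono_neutral[OF s summable_on_cmult_right[OF lattice_sum_summable]]) (use c in auto)
  also have "\<dots> = ?c * lattice_sum" unfolding lattice_sum_def by (rule infsum_cmult_right')
  finally show ?thesis by (simp add: mult_ac)
qed

section \<open>The classical map on cells\<close>

lemma baker_fund_dom: "x \<in> fund_dom \<Longrightarrow> baker x \<in> fund_dom"
  using bij_betw_baker by (auto simp: bij_betw_def)

lemma torus_rep_fund_dom [simp]: "torus_rep x \<in> fund_dom"
  by (simp add: torus_rep_def fund_dom_def frac_lt_1)

lemma baker_iter_fund_dom: "x \<in> fund_dom \<Longrightarrow> (baker ^^ n) x \<in> fund_dom"
  by (induction n) (auto simp: baker_fund_dom)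

lemma baker_inv_iter:
  assumes "x \<in> fund_dom"
  shows "(inv_into fund_dom baker ^^ n) x \<in> fund_dom \<and> (baker ^^ n) ((inv_into fund_dom baker ^^ n) x) = x"
  using assms
proof (induction n arbitrary: x)
  case (Suc n)
  let ?g = "inv_into fund_dom baker"
  have im: "baker ` fund_dom = fund_dom" using bij_betw_baker by (simp add: bij_betw_def)
  have g: "?g y \<in> fund_dom" "baker (?g y) = y" if "y \<in> fund_dom" for y
    using that im by (auto intro: inv_into_into f_inv_into_f)
  have IH: "(?g ^^ n) x \<in> fund_dom" "(baker ^^ n) ((?g ^^ n) x) = x" using Suc by auto
  have "(baker ^^ Suc n) ((?g ^^ Suc n) x) = (baker ^^ n) (baker (?g ((?g ^^ n) x)))"
    by (simp add: funpow_swap1)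
  also have "\<dots> = x" using g IH by simp
  finally show ?case using g IH by simp
qed simp

definition tens :: "(real \<Rightarrow> complex) \<Rightarrow> (real \<Rightarrow> complex) \<Rightarrow> real \<times> real \<Rightarrow> complex" where
  "tens u v = (\<lambda>(q, p). u q * v p)"

text \<open>In binary digits the map is a shift: the leading digit \<open>b\<close> of the position
  index becomes the leading digit of the momentum index. On the half of the square not named by
  \<open>b\<close> both sides vanish.\<close>

lemma tens_bump_baker:
  fixes b :: nat
  assumes W: "profile \<delta> W" "profile \<delta> W'" "0 < \<delta>" and i: "i < 2 ^ r" and l: "l < 2 ^ s" and b: "b \<le> 1"
    and x: "x \<in> fund_dom"
  shows "tens (bump W r i) (bump W' (Suc s) (l + b * 2 ^ s)) (baker x) =
    tens (bump W (Suc r) (i + b * 2 ^ r)) (bump W' s l) x"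
proof -
  obtain q p where qp: "x = (q, p)" "0 \<le> q" "q < 1" "0 \<le> p" "p < 1"
    using x by (cases x) (auto simp: fund_dom_def)
  have fr: "frac q = q" "frac p = p" using qp by (auto simp: frac_eq)
  have i1: "real i + 1 \<le> 2 ^ r" and l1: "real l + 1 \<le> 2 ^ s" by (rule two_power_real_le[OF i], rule two_power_real_le[OF l])
  have z: "W y = 0" "W' y = 0" if "y \<le> 0 \<or> 1 \<le> y" for y
    using that W(3) by (auto intro!: profile_zero[OF W(1)] profile_zero[OF W(2)])
  have bb: "b = 0 \<or> b = 1" using b by auto
  show ?thesis
  proof (cases "q < 1 / 2")
    case True
    have f2: "frac (2 * q) = 2 * q" "frac (p / 2) = p / 2" using True qp by (auto simp: frac_eq)
    have B: "baker (q, p) = (2 * q, p / 2)" using True by (simp add: baker_def torus_rep_def fr)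
    have r: "2 ^ r * (2 * q) = 2 ^ Suc r * q" by simp
    show ?thesis
    proof (cases "b = 0")
      case True
      have r': "2 ^ Suc s * (p / 2) = 2 ^ s * p" by simp
      show ?thesis
        by (simp only: True B tens_def bump_def f2 fr qp(1) prod.case r r' mult_zero_left add_0_right)
    next
      case False
      then have b1: "b = 1" using bb by simp
      have "2 ^ s * p \<le> 2 ^ s" using qp by simp
      moreover have "2 ^ Suc s * (p / 2) = 2 ^ s * p" "real (l + 2 ^ s) = real l + 2 ^ s" by simp_all
      ultimately have "W' (2 ^ Suc s * (p / 2) - real (l + 2 ^ s)) = 0" by (intro z disjI1) linarith
      moreover have "W (2 ^ Suc r * q - real (i + 2 ^ r)) = 0"
      proof (intro z disjI1)
        have "2 ^ r * (2 * q) \<le> 2 ^ r" using True by simp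
        moreover have "real (i + 2 ^ r) = real i + 2 ^ r" by simp
        ultimately show "2 ^ Suc r * q - real (i + 2 ^ r) \<le> 0" unfolding r by linarith
      qed
      ultimately show ?thesis by (simp add: B tens_def bump_def f2 fr qp(1) b1)
    qed
  next
    case False
    have f2: "frac (2 * q - 1) = 2 * q - 1" "frac ((p + 1) / 2) = (p + 1) / 2" using False qp by (auto simp: frac_eq)
    have B: "baker (q, p) = (2 * q - 1, (p + 1) / 2)" using False by (simp add: baker_def torus_rep_def fr)
    show ?thesis
    proof (cases "b = 1")
      case True
      have e1: "2 ^ r * (2 * q - 1) - real i = 2 ^ Suc r * q - real (i + 1 * 2 ^ r)"
        and e2: "2 ^ Suc s * ((p + 1) / 2) - real (l + 1 * 2 ^ s) = 2 ^ s * p - real l"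
        by (simp_all add: algebra_simps)
      show ?thesis by (simp only: True B tens_def bump_def f2 fr qp(1) prod.case e1 e2)
    next
      case c: False
      then have b0: "b = 0" using bb by simp
      have "W' (2 ^ Suc s * ((p + 1) / 2) - real l) = 0"
      proof (intro z disjI2)
        have "2 ^ Suc s * ((p + 1) / 2) = 2 ^ s * p + 2 ^ s" by (simp add: distrib_left)
        moreover have "0 \<le> 2 ^ s * p" using qp by simp
        ultimately show "1 \<le> 2 ^ Suc s * ((p + 1) / 2) - real l" using l1 by linarith
      qed
      moreover have "W (2 ^ Suc r * q - real i) = 0"
      proof (intro z disjI2)
        have "(2::real) ^ r \<le> 2 ^ r * (2 * q)" using False by simp
        moreover have "2 ^ r * (2 * q) = 2 ^ Suc r * q" by simp
        ultimately show "1 \<le> 2 ^ Suc r * q - real i" using i1 by linarith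
      qed
      ultimately show ?thesis by (simp add: B tens_def bump_def f2 fr qp(1) b0)
    qed
  qed
qed

section \<open>Iterating the map\<close>

abbreviation qpow :: "nat \<Rightarrow> nat \<Rightarrow> complex mat" where
  "qpow M n \<equiv> qbaker M [^]\<^bsub>mat_ring (2 * M)\<^esub> n"

abbreviation qpow_inv :: "nat \<Rightarrow> nat \<Rightarrow> complex mat" where
  "qpow_inv M n \<equiv> qbaker_inv M [^]\<^bsub>mat_ring (2 * M)\<^esub> n"

lemma qpow_carrier [simp]: "qpow M n \<in> carrier_mat (2 * M) (2 * M)" "qpow_inv M n \<in> carrier_mat (2 * M) (2 * M)"
  unfolding pow_mat_ring_pow[symmetric, OF qbaker_carrier(1)] pow_mat_ring_pow[symmetric, OF qbaker_carrier(2)]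
  by (simp_all add: pow_carrier_mat)

lemma qpow_0: "qpow M 0 = 1\<^sub>m (2 * M)" "qpow_inv M 0 = 1\<^sub>m (2 * M)"
  by (simp_all add: ring_mat_simps)

lemma qpow_Suc: "qpow M (Suc n) = qbaker M * qpow M n"
proof -
  interpret ring "mat_ring (2 * M)" by (rule ring_mat)
  have "qpow M (Suc n) = qbaker M \<otimes>\<^bsub>mat_ring (2 * M)\<^esub> qpow M n"
    by (rule nat_pow_Suc2) (simp add: ring_mat_simps)
  then show ?thesis by (simp add: ring_mat_simps)
qed

lemma qpow_inv_Suc: "qpow_inv M (Suc n) = qpow_inv M n * qbaker_inv M"
  by (simp add: ring_mat_simps)

lemma mat_assoc4:
  assumes "(A :: complex mat) \<in> carrier_mat n n" "B \<in> carrier_mat n n" "C \<in> carrier_mat n n" "D \<in> carrier_mat n n"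
  shows "A * B * (C * D) = A * (B * C) * D"
  using assoc_mult_mat[OF assms(1,2) mult_carrier_mat[OF assms(3,4)]] assoc_mult_mat[OF assms(2-4)]
    assoc_mult_mat[OF assms(1) mult_carrier_mat[OF assms(2,3)] assms(4)] by simp

lemma qpow_inverse:
  assumes M: "M > 0"
  shows "qpow M n * qpow_inv M n = 1\<^sub>m (2 * M)" "qpow_inv M n * qpow M n = 1\<^sub>m (2 * M)"
proof (induction n)
  case (Suc n)
  let ?U = "qbaker M" and ?V = "qbaker_inv M" and ?P = "qpow M n" and ?Q = "qpow_inv M n" and ?C = "carrier_mat (2 * M) (2 * M)"
  have c: "?U \<in> ?C" "?V \<in> ?C" "?P \<in> ?C" "?Q \<in> ?C" by (simp_all del: nat_pow_Suc)
  have "?U * ?P * (?Q * ?V) = ?U * (?P * ?Q) * ?V"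
    using c by (intro mat_assoc4)
  then show "qpow M (Suc n) * qpow_inv M (Suc n) = 1\<^sub>m (2 * M)"
    unfolding qpow_Suc qpow_inv_Suc using Suc.IH(1) c by (simp add: qbaker_inverse[OF M])
  have "?Q * ?V * (?U * ?P) = ?Q * (?V * ?U) * ?P"
    using c by (intro mat_assoc4)
  then show "qpow_inv M (Suc n) * qpow M (Suc n) = 1\<^sub>m (2 * M)"
    unfolding qpow_Suc qpow_inv_Suc using Suc.IH(2) c by (simp add: qbaker_inverse[OF M])
qed (simp_all add: qpow_0 del: nat_pow_0)

lemma op_bound_qpow:
  assumes M: "M > 0" shows "op_bound (2 * M) (qpow M n) 1" "op_bound (2 * M) (qpow_inv M n) 1"
proof (induction n)
  case 0
  show "op_bound (2 * M) (qpow M 0) 1" "op_bound (2 * M) (qpow_inv M 0) 1" unfolding qpow_0 by (rule op_bound_one)+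
next
  case (Suc n)
  show "op_bound (2 * M) (qpow M (Suc n)) 1" "op_bound (2 * M) (qpow_inv M (Suc n)) 1"
    unfolding qpow_Suc qpow_inv_Suc
    using op_bound_mult[OF op_bound_qbaker(1)[OF M] Suc(1)] op_bound_mult[OF Suc(2) op_bound_qbaker(2)[OF M]] by simp_all
qed

lemma inv_qpow: assumes M: "M > 0" shows "inv\<^bsub>mat_ring (2 * M)\<^esub> (qpow M n) = qpow_inv M n"
proof -
  interpret R: ring "mat_ring (2 * M)" by (rule ring_mat)
  have c: "qpow M n \<in> carrier (mat_ring (2 * M))" "qpow_inv M n \<in> carrier (mat_ring (2 * M))"
    using qpow_carrier[of M n] by (simp_all add: ring_mat_simps)
  show ?thesis
    by (rule R.inv_char[OF c]) (use qpow_inverse[OF M, of n] in \<open>simp_all add: ring_mat_simps\<close>)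
qed

section \<open>Cells followed along the orbit\<close>

lemma half_frac:
  fixes b :: nat assumes "b \<le> 1"
  shows "frac (real b / 2 + frac x / 2) = real b / 2 + frac x / 2"
proof -
  have "b = 0 \<or> b = 1" using assms by auto
  then show ?thesis using frac_lt_1[of x] by (auto simp: frac_eq)
qed

lemma bump_half:
  fixes b :: nat
  assumes "b \<le> 1"
  shows "bump W r i x = bump W (Suc r) (i + b * 2 ^ r) (real b / 2 + frac x / 2)"
  unfolding bump_def half_frac[OF assms] by (simp add: algebra_simps)

text \<open>The margin obtained here is the one that \<open>cell_step\<close> passes to
  \<open>qbaker_step\<close> as \<eta> and \<eta>'.\<close>

lemma bump_half_supp:
  fixes b :: nat
  assumes W: "profile \<delta> W" and b: "b \<le> 1" and i: "i < 2 ^ r" and nz: "bump W (Suc r) (i + b * 2 ^ r) x \<noteq> 0"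
  shows "real b / 2 + \<delta> / 2 ^ Suc r < frac x \<and> frac x < real b / 2 + 1 / 2 - \<delta> / 2 ^ Suc r"
proof -
  have e: "real (i + b * 2 ^ r) = real i + real b * 2 ^ r" by simp
  have p: "(2::real) ^ Suc r = 2 * 2 ^ r" by simp
  have lo: "real b / 2 + \<delta> / 2 ^ Suc r = (real b * 2 ^ r + \<delta>) / 2 ^ Suc r" unfolding p by (simp add: field_simps)
  have hi: "real b / 2 + 1 / 2 - \<delta> / 2 ^ Suc r = (2 ^ r + real b * 2 ^ r - \<delta>) / 2 ^ Suc r" unfolding p by (simp add: field_simps)
  have "(real b * 2 ^ r + \<delta>) / 2 ^ Suc r \<le> (real i + real b * 2 ^ r + \<delta>) / 2 ^ Suc r"
    by (intro divide_right_mono) auto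
  moreover have "(real i + real b * 2 ^ r + 1 - \<delta>) / 2 ^ Suc r \<le> (2 ^ r + real b * 2 ^ r - \<delta>) / 2 ^ Suc r"
    using two_power_real_le[OF i] by (intro divide_right_mono) (linarith, simp)
  ultimately show ?thesis using bump_supp[OF W nz] unfolding e lo hi by linarith
qed

lemma weyl_op_carrier [simp]: "weyl_op N f \<in> carrier_mat N N"
  by (simp add: weyl_op_def)

text \<open>\<open>W\<close> is the position profile and \<open>W'\<close> the momentum profile. The
  constants \<open>A\<close> and \<open>B\<close> are kept apart because \<open>A\<close> enters the
  trivial bound and has to be the same for all modes, whereas \<open>B\<close> controls the tails
  and may grow with the frequency.\<close>

locale bump_pair =
  fixes M :: nat and \<delta> s A \<kappa> \<kappa>' B :: real and L :: nat and W W' :: "real \<Rightarrow> complex"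
  assumes M: "M > 0" and \<delta>: "0 < \<delta>" "\<delta> \<le> 1 / 4"
    and W: "profile \<delta> W" "profile \<delta> W'"
    and s: "\<And>x. cmod (W x) \<le> s" "\<And>x. cmod (W' x) \<le> s"
    and dec: "quad_decay A \<kappa> W" "quad_decay A \<kappa>' W'"
    and tail: "\<And>\<xi>. \<xi> \<noteq> 0 \<Longrightarrow> norm (rft W \<xi>) \<le> B / \<bar>\<xi>\<bar> ^ (L + 2)"
      "\<And>\<xi>. \<xi> \<noteq> 0 \<Longrightarrow> norm (rft W' \<xi>) \<le> B / \<bar>\<xi>\<bar> ^ (L + 2)"
    and B: "0 \<le> B"
begin

text \<open>A bump on a rectangle of width 2^-r and height 2^-t. The map preserves the area, hence r
  + t.\<close>

definition cell :: "nat \<Rightarrow> nat \<Rightarrow> nat \<Rightarrow> nat \<Rightarrow> real \<times> real \<Rightarrow> complex" where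
  "cell r t i l = tens (bump W r i) (bump W' t l)"

text \<open>The 8 collects three factors 2: two block errors per step, \<open>2 * s\<close> for each
  coefficient beyond the threshold, and the 2 in \<open>bump_tail\<close>.\<close>

definition err :: "nat \<Rightarrow> real" where
  "err n = 8 * s * lattice_sum * B * 2 ^ n * (2 ^ n / (4 * real M * \<delta>)) ^ L"

lemma s_nonneg: "0 \<le> s" using order_trans[OF norm_ge_zero s(1)] .

lemma err_nonneg: "0 \<le> err n"
  using s_nonneg lattice_sum_nonneg B \<delta> by (simp add: err_def)

lemma wiener_W: "i < 2 ^ r \<Longrightarrow> wiener (bump W r i) (fc1 (bump W r i))"
  and wiener_W': "l < 2 ^ r \<Longrightarrow> wiener (bump W' r l) (fc1 (bump W' r l))"
  by (rule wiener_bump[OF W(1) \<delta>(1) _ dec(1)], assumption, rule wiener_bump[OF W(2) \<delta>(1) _ dec(2)])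

lemma bump_le: "cmod (bump W r i x) \<le> s" "cmod (bump W' r i x) \<le> s"
  unfolding bump_def by (rule s)+

lemma weyl_cell:
  assumes "i < 2 ^ r" "l < 2 ^ t"
  shows "weyl_op N (cell r t i l) = opt N (bump W r i) (\<lambda>k. fc1 (bump W' t l) (- k))"
  unfolding cell_def tens_def by (rule weyl_op_tensor[OF wiener_W[OF assms(1)] wiener_W'[OF assms(2)]])

text \<open>A bump at level \<open>r\<close> has frequencies of order 2^r, and a margin at level
  \<open>r'\<close> tolerates jumps up to 4 M \<delta> / 2^r'. The quotient depends on r + r' only,
  so all steps of an orbit share one error.\<close>

lemma tail_bound:
  assumes V: "profile \<delta> V" and tV: "\<And>\<xi>. \<xi> \<noteq> 0 \<Longrightarrow> norm (rft V \<xi>) \<le> B / \<bar>\<xi>\<bar> ^ (L + 2)"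
    and i: "i < 2 ^ r" and n: "r + r' = n"
  shows "infsum (\<lambda>k. norm (fc1 (bump V r i) k)) {k. 4 * real M * (\<delta> / 2 ^ r') \<le> \<bar>of_int k\<bar>}
     \<le> 2 * lattice_sum * B * (2 ^ n * (2 ^ n / (4 * real M * \<delta>)) ^ L)"
proof -
  let ?T = "4 * real M * (\<delta> / 2 ^ r')"
  have T: "0 < ?T" using M \<delta> by simp
  have n2: "(2::real) ^ n = 2 ^ r * 2 ^ r'" using n by (simp add: power_add[symmetric])
  have e: "2 ^ r / ?T = 2 ^ n / (4 * real M * \<delta>)" unfolding n2 using M \<delta> by (simp add: field_simps)
  from bump_tail[OF V \<delta>(1) i tV B T]
  have "infsum (\<lambda>k. norm (fc1 (bump V r i) k)) {k. ?T \<le> \<bar>of_int k\<bar>} \<le> 2 * lattice_sum * B * (2 ^ r * (2 ^ n / (4 * real M * \<delta>)) ^ L)"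
    unfolding e .
  also have "\<dots> \<le> 2 * lattice_sum * B * (2 ^ n * (2 ^ n / (4 * real M * \<delta>)) ^ L)"
    using lattice_sum_nonneg B \<delta> n by (intro mult_left_mono mult_right_mono power_increasing) auto
  finally show ?thesis .
qed

lemma cell_step:
  fixes b :: nat
  assumes i: "i < 2 ^ r" and l: "l < 2 ^ t" and b: "b \<le> 1" and n: "Suc (r + t) = n"
  shows "op_bound (2 * M) (qbaker M * weyl_op (2 * M) (cell (Suc r) t (i + b * 2 ^ r) l)
     - weyl_op (2 * M) (cell r (Suc t) i (l + b * 2 ^ t)) * qbaker M) (err n)"
proof -
  have i2: "i + b * 2 ^ r < 2 ^ Suc r" and l2: "l + b * 2 ^ t < 2 ^ Suc t"
    using i l b by (cases b; auto)+
  have small: "4 * (\<delta> / 2 ^ Suc m) \<le> 1" for m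
  proof -
    have "4 * \<delta> \<le> 2 ^ Suc m" using \<delta> one_le_power[of "2::real" "Suc m"] by linarith
    then show ?thesis by (simp add: divide_le_eq)
  qed
  let ?E = "2 * lattice_sum * B * (2 ^ n * (2 ^ n / (4 * real M * \<delta>)) ^ L)"
  have "op_bound (2 * M) (qbaker M * opt (2 * M) (bump W (Suc r) (i + b * 2 ^ r)) (\<lambda>k. fc1 (bump W' t l) (- k))
     - opt (2 * M) (bump W r i) (\<lambda>k. fc1 (bump W' (Suc t) (l + b * 2 ^ t)) (- k)) * qbaker M)
     (2 * s * ?E + 2 * s * ?E)"
  proof (rule qbaker_step[where b = b and \<eta> = "\<delta> / 2 ^ Suc r" and \<eta>' = "\<delta> / 2 ^ Suc t"
        and U = "fc1 (bump W (Suc r) (i + b * 2 ^ r))" and v = "bump W' t l" and ?U1.0 = "fc1 (bump W r i)"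
        and ?v1.0 = "bump W' (Suc t) (l + b * 2 ^ t)"])
    show "infsum (\<lambda>k. norm (fc1 (bump W' t l) k)) {k. 4 * real M * (\<delta> / 2 ^ Suc r) \<le> \<bar>of_int k\<bar>} \<le> ?E"
      by (rule tail_bound[OF W(2) _ l], erule tail(2), use n in linarith)
    show "infsum (\<lambda>k. norm (fc1 (bump W r i) k)) {k. 4 * real M * (\<delta> / 2 ^ Suc t) \<le> \<bar>of_int k\<bar>} \<le> ?E"
      by (rule tail_bound[OF W(1) _ i], erule tail(1), use n in linarith)
  qed (rule M b small wiener_W[OF i2] wiener_W'[OF l] wiener_W[OF i] wiener_W'[OF l2] bump_half[OF b]
      bump_half_supp[OF W(1) b i] bump_half_supp[OF W(2) b l] bump_le | assumption | simp add: \<delta>)+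
  also have "2 * s * ?E + 2 * s * ?E = err n" by (simp add: err_def mult_ac)
  finally show ?thesis unfolding weyl_cell[OF i2 l] weyl_cell[OF i l2] .
qed

text \<open>\<open>n\<close> applications of the map carry the cell \<open>(i, l)\<close> to the cell \<open>(i', l')\<close>: exactly for the
  classical map, up to an error for the quantum map.\<close>

definition linked :: "nat \<Rightarrow> nat \<Rightarrow> nat \<Rightarrow> nat \<Rightarrow> nat \<Rightarrow> nat \<Rightarrow> nat \<Rightarrow> bool" where
  "linked n r t i l i' l' \<longleftrightarrow> i < 2 ^ (r + n) \<and> l < 2 ^ t \<and> i' < 2 ^ r \<and> l' < 2 ^ (t + n) \<and>
     (\<forall>x\<in>fund_dom. cell r (t + n) i' l' ((baker ^^ n) x) = cell (r + n) t i l x) \<and>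
     op_bound (2 * M) (qpow M n * weyl_op (2 * M) (cell (r + n) t i l)
       - weyl_op (2 * M) (cell r (t + n) i' l') * qpow M n) (real n * err (r + t + n))"

lemma linked_0:
  assumes "i < 2 ^ r" "l < 2 ^ t"
  shows "linked 0 r t i l i l"
proof -
  have "1\<^sub>m (2 * M) * weyl_op (2 * M) (cell r t i l) - weyl_op (2 * M) (cell r t i l) * 1\<^sub>m (2 * M) = 0\<^sub>m (2 * M) (2 * M)"
    by (simp add: left_mult_one_mat[OF weyl_op_carrier] right_mult_one_mat[OF weyl_op_carrier])
  then show ?thesis using assms op_bound_zero[of "2 * M"] by (simp add: linked_def qpow_0 del: nat_pow_0)
qed

text \<open>The new step is appended at the end of the orbit and the difference telescopes. Both the
  map and its powers have norm at most 1, so the errors simply add.\<close>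

lemma linked_Suc:
  fixes b :: nat
  assumes lk: "linked n (Suc r) t i l (i' + b * 2 ^ r) l'" and b: "b \<le> 1" and i': "i' < 2 ^ r"
  shows "linked (Suc n) r t i l i' (l' + b * 2 ^ (t + n))"
proof -
  let ?C = "carrier_mat (2 * M) (2 * M)"
  note d = lk[unfolded linked_def]
  have l': "l' < 2 ^ (t + n)" using d by simp
  let ?A = "weyl_op (2 * M) (cell (Suc r + n) t i l)" and ?A1 = "weyl_op (2 * M) (cell (Suc r) (t + n) (i' + b * 2 ^ r) l')"
    and ?A2 = "weyl_op (2 * M) (cell r (t + Suc n) i' (l' + b * 2 ^ (t + n)))" and ?U = "qbaker M" and ?P = "qpow M n"
  have c: "?A \<in> ?C" "?A1 \<in> ?C" "?A2 \<in> ?C" "?U \<in> ?C" "?P \<in> ?C" by simp_all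
  have 1: "op_bound (2 * M) (?P * ?A - ?A1 * ?P) (real n * err (r + t + Suc n))" using d by simp
  have 2: "op_bound (2 * M) (?U * ?A1 - ?A2 * ?U) (err (r + t + Suc n))"
    using cell_step[OF i' l' b] by (simp add: add.assoc)
  have "op_bound (2 * M) (?U * (?P * ?A - ?A1 * ?P) + (?U * ?A1 - ?A2 * ?U) * ?P)
     (1 * (real n * err (r + t + Suc n)) + err (r + t + Suc n) * 1)"
    by (intro op_bound_add op_bound_mult op_bound_qbaker(1)[OF M] op_bound_qpow(1)[OF M] 1 2)
  also have "?U * (?P * ?A - ?A1 * ?P) + (?U * ?A1 - ?A2 * ?U) * ?P = ?U * ?P * ?A - ?A2 * (?U * ?P)"
  proof -
    have c2: "?P * ?A \<in> ?C" "?A1 * ?P \<in> ?C" "?U * ?A1 \<in> ?C" "?A2 * ?U \<in> ?C"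
      by (rule mult_carrier_mat[OF c(5,1)] mult_carrier_mat[OF c(2,5)] mult_carrier_mat[OF c(4,2)] mult_carrier_mat[OF c(3,4)])+
    have "?U * (?P * ?A - ?A1 * ?P) = ?U * (?P * ?A) - ?U * (?A1 * ?P)"
      by (rule mult_minus_distrib_mat[OF c(4) c2(1,2)])
    moreover have "(?U * ?A1 - ?A2 * ?U) * ?P = ?U * ?A1 * ?P - ?A2 * ?U * ?P"
      by (rule minus_mult_distrib_mat[OF c2(3,4) c(5)])
    moreover have "?U * ?A1 * ?P = ?U * (?A1 * ?P)" "?A2 * ?U * ?P = ?A2 * (?U * ?P)" "?U * ?P * ?A = ?U * (?P * ?A)"
      using c by (auto intro!: assoc_mult_mat[of _ "2 * M" "2 * M" _ "2 * M" _ "2 * M"])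
    moreover have "X - Y + (Y - Z) = X - Z" if "X \<in> ?C" "Y \<in> ?C" "Z \<in> ?C" for X Y Z :: "complex mat"
      using that by (intro eq_matI) auto
    moreover have "?U * (?P * ?A) \<in> ?C" "?U * (?A1 * ?P) \<in> ?C" "?A2 * (?U * ?P) \<in> ?C"
      using c by (auto intro!: mult_carrier_mat[of _ "2 * M" "2 * M" _ "2 * M"])
    ultimately show ?thesis by simp
  qed
  finally have bdd: "op_bound (2 * M) (qpow M (Suc n) * ?A - ?A2 * qpow M (Suc n)) (real (Suc n) * err (r + t + Suc n))"
    unfolding qpow_Suc by (simp add: distrib_right add.commute)
  have comp: "cell r (t + Suc n) i' (l' + b * 2 ^ (t + n)) ((baker ^^ Suc n) x) = cell (r + Suc n) t i l x" if x: "x \<in> fund_dom" for x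
  proof -
    have "cell r (t + Suc n) i' (l' + b * 2 ^ (t + n)) (baker ((baker ^^ n) x)) = cell (Suc r) (t + n) (i' + b * 2 ^ r) l' ((baker ^^ n) x)"
      unfolding cell_def add_Suc_right by (rule tens_bump_baker[OF W \<delta>(1) i' l' b baker_iter_fund_dom[OF x]])
    then show ?thesis using d x by simp
  qed
  have "l' + b * 2 ^ (t + n) < 2 ^ (t + Suc n)" using l' b by (cases b) auto
  then show ?thesis unfolding linked_def using d i' bdd comp by (simp del: nat_pow_Suc funpow.simps)
qed

lemma split_top_bit: fixes i :: nat assumes "i < 2 ^ Suc r" obtains i' b :: nat where "i = i' + b * 2 ^ r" "b \<le> 1" "i' < 2 ^ r"
proof
  show "i = i mod 2 ^ r + (i div 2 ^ r) * 2 ^ r" by (rule mod_div_mult_eq[symmetric])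
  have "i div 2 ^ r < 2" using assms by (simp add: less_mult_imp_div_less)
  then show "i div 2 ^ r \<le> 1" by simp
qed simp

text \<open>The level \<open>r\<close> is arbitrary in the induction: the hypothesis at
  \<open>Suc r\<close> covers \<open>n\<close> steps and leaves one extra leading position digit for
  the last step to consume.\<close>

lemma linked_forward:
  assumes "i < 2 ^ (r + n)" "l < 2 ^ t"
  shows "\<exists>i' l'. linked n r t i l i' l'"
  using assms
proof (induction n arbitrary: r)
  case (Suc n)
  have "i < 2 ^ (Suc r + n)" using Suc.prems by simp
  from Suc.IH[OF this Suc.prems(2)] obtain i1 l1 where lk: "linked n (Suc r) t i l i1 l1" by blast
  then have "i1 < 2 ^ Suc r" by (simp add: linked_def)
  then obtain i' b :: nat where i': "i1 = i' + b * 2 ^ r" "b \<le> 1" "i' < 2 ^ r" by (rule split_top_bit)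
  show ?case using linked_Suc[OF lk[unfolded i'(1)] i'(2,3)] by blast
qed (auto intro: linked_0)

text \<open>The leading digit of the target momentum index tells from which half the last step came.
  Putting it back on the position index gives the target of the preceding steps.\<close>

lemma linked_backward:
  assumes "i' < 2 ^ r" "l' < 2 ^ (t + n)"
  shows "\<exists>i l. linked n r t i l i' l'"
  using assms
proof (induction n arbitrary: r i' l')
  case (Suc n)
  have "l' < 2 ^ Suc (t + n)" using Suc.prems by simp
  then obtain l1 b :: nat where l1: "l' = l1 + b * 2 ^ (t + n)" "b \<le> 1" "l1 < 2 ^ (t + n)" by (rule split_top_bit)
  have "i' + b * 2 ^ r < 2 ^ Suc r" using Suc.prems(1) l1(2) by (cases b) auto
  then obtain i l where lk: "linked n (Suc r) t i l (i' + b * 2 ^ r) l1"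
    using Suc.IH[of "i' + b * 2 ^ r" "Suc r" l1] l1(3) by blast
  show ?case using linked_Suc[OF lk l1(2) Suc.prems(1)] l1(1) by blast
qed (auto intro: linked_0)

end

section \<open>Superpositions of symbols\<close>

lemma translation_norm_le:
  assumes "i < N" "j < N" shows "cmod (translation N k $$ (i, j)) \<le> 1"
  using assms by (cases k) (simp add: translation_index)

lemma weyl_op_has_sum:
  assumes f: "wiener2 f c" and ij: "i < N" "j < N"
  shows "((\<lambda>k. c k * translation N k $$ (i, j)) has_sum weyl_op N f $$ (i, j)) UNIV"
proof -
  have "(\<lambda>k. norm (c k * translation N k $$ (i, j))) summable_on UNIV"
    by (rule summable_on_comparison_test[OF wiener2_abs[OF f]])
      (auto simp: norm_mult intro!: mult_left_le translation_norm_le ij)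
  from has_sum_infsum[OF abs_summable_summable[OF this]] show ?thesis
    using ij by (simp add: weyl_op_def wiener2_fourier_coeff[OF f])
qed

text \<open>Quantisation commutes with an infinite superposition when the coefficient sums are
  bounded by a common \<open>S\<close>: the double series in \<open>m\<close> and \<open>k\<close>
  then converges absolutely. It is applied to sums over cells and again to sums over Fourier
  modes.\<close>

lemma wiener2_comb:
  fixes a :: "'m \<Rightarrow> complex" and c :: "'m \<Rightarrow> int \<times> int \<Rightarrow> complex"
  assumes f: "\<And>m. wiener2 (f m) (c m)" and S: "\<And>m. (\<Sum>\<^sub>\<infinity>k. norm (c m k)) \<le> S"
    and a: "(\<lambda>m. norm (a m)) summable_on UNIV"
    and F: "\<And>x. ((\<lambda>m. a m * f m x) has_sum F x) UNIV"
  shows "wiener2 F (\<lambda>k. \<Sum>\<^sub>\<infinity>m. a m * c m k)"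
    and "(\<Sum>\<^sub>\<infinity>k. norm (\<Sum>\<^sub>\<infinity>m. a m * c m k)) \<le> S * (\<Sum>\<^sub>\<infinity>m. norm (a m))"
    and "\<And>i j. i < N \<Longrightarrow> j < N \<Longrightarrow> ((\<lambda>m. a m * weyl_op N (f m) $$ (i, j)) has_sum weyl_op N F $$ (i, j)) UNIV"
proof -
  define C where "C = (\<lambda>k. \<Sum>\<^sub>\<infinity>m. a m * c m k)"
  have cs: "(\<lambda>k. norm (c m k)) summable_on UNIV" for m using f by (simp add: wiener2_def)
  have Sm0: "0 \<le> (\<Sum>\<^sub>\<infinity>k. norm (c m k))" for m by (rule infsum_nonneg) simp
  then have lattice_sum: "0 \<le> S" using S order_trans by blast
  have row: "(\<Sum>\<^sub>\<infinity>k. norm (a m * c m k)) = norm (a m) * (\<Sum>\<^sub>\<infinity>k. norm (c m k))" for m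
    by (simp add: norm_mult infsum_cmult_right')
  have rows: "(\<lambda>m. \<Sum>\<^sub>\<infinity>k. norm (a m * c m k)) summable_on UNIV"
    unfolding row by (rule summable_on_comparison_test[OF summable_on_cmult_left[OF a, of S]])
      (use S Sm0 in \<open>auto intro!: mult_left_mono\<close>)
  have abs: "(\<lambda>x. norm (a (fst x) * c (fst x) (snd x))) summable_on Sigma UNIV (\<lambda>_. UNIV)"
    unfolding Infinite_Sum.abs_summable_on_Sigma_iff fst_conv snd_conv
  proof (intro conjI ballI)
    show "(\<lambda>k. norm (a m * c m k)) summable_on UNIV" for m
      unfolding norm_mult by (rule summable_on_cmult_right[OF cs])
    have "norm (\<Sum>\<^sub>\<infinity>k. norm (a m * c m k)) = (\<Sum>\<^sub>\<infinity>k. norm (a m * c m k))" for m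
      unfolding real_norm_def by (rule abs_of_nonneg, rule infsum_nonneg, simp)
    then show "(\<lambda>m. norm (\<Sum>\<^sub>\<infinity>k. norm (a m * c m k))) summable_on UNIV"
      using rows by (simp only:)
  qed
  have abs': "(\<lambda>(m, k). norm (a m * c m k)) summable_on UNIV \<times> UNIV"
    using abs by (simp add: case_prod_unfold)
  have abs_swap: "(\<lambda>(k, m). norm (a m * c m k)) summable_on UNIV \<times> UNIV"
    using summable_on_swap[of "\<lambda>(k, m). norm (a m * c m k)" UNIV UNIV] abs' by (simp add: case_prod_unfold)
  have col: "(\<lambda>k. \<Sum>\<^sub>\<infinity>m. norm (a m * c m k)) summable_on UNIV"
    by (rule summable_on_Sigma_banach[OF abs_swap])
  have colm: "(\<lambda>m. norm (a m * c m k)) summable_on UNIV" for k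
    using summable_on_SigmaD1[OF abs_swap, of k] by simp
  have Cle: "norm (C k) \<le> (\<Sum>\<^sub>\<infinity>m. norm (a m * c m k))" for k
    unfolding C_def by (rule norm_infsum_bound[OF colm])
  have Cs: "(\<lambda>k. norm (C k)) summable_on UNIV"
    by (rule summable_on_comparison_test[OF col Cle]) simp
  show sumC: "(\<Sum>\<^sub>\<infinity>k. norm (\<Sum>\<^sub>\<infinity>m. a m * c m k)) \<le> S * (\<Sum>\<^sub>\<infinity>m. norm (a m))"
  proof -
    have "(\<Sum>\<^sub>\<infinity>k. norm (C k)) \<le> (\<Sum>\<^sub>\<infinity>k. \<Sum>\<^sub>\<infinity>m. norm (a m * c m k))"
      by (rule infsum_mono[OF Cs col Cle])
    also have "\<dots> = (\<Sum>\<^sub>\<infinity>m. \<Sum>\<^sub>\<infinity>k. norm (a m * c m k))"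
      by (rule infsum_swap_banach[OF abs_swap])
    also have "\<dots> \<le> (\<Sum>\<^sub>\<infinity>m. norm (a m) * S)"
      by (rule infsum_mono[OF rows summable_on_cmult_left[OF a]]) (simp add: row S mult_left_mono)
    also have "\<dots> = S * (\<Sum>\<^sub>\<infinity>m. norm (a m))" by (subst infsum_cmult_left') (rule mult.commute)
    finally show ?thesis by (simp add: C_def)
  qed
  \<comment> \<open>Pairing with an arbitrary bounded weight treats two cases together: plane waves
    at a point give the values of the function, entries of the translations give those of the
    operator.\<close>
  have test: "((\<lambda>m. a m * (\<Sum>\<^sub>\<infinity>k. c m k * w k)) has_sum (\<Sum>\<^sub>\<infinity>k. C k * w k)) UNIV"
    if w: "\<And>k. norm (w k) \<le> 1" for w :: "int \<times> int \<Rightarrow> complex"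
  proof -
    have "(\<lambda>x. norm (a (fst x) * c (fst x) (snd x) * w (snd x))) summable_on Sigma UNIV (\<lambda>_. UNIV)"
      by (rule summable_on_comparison_test[OF abs]) (auto simp: norm_mult w intro!: mult_left_le mult_nonneg_nonneg)
    from abs_summable_summable[OF this]
    have sw: "(\<lambda>(m, k). a m * c m k * w k) summable_on UNIV \<times> UNIV" by (simp add: case_prod_unfold)
    have r: "(\<Sum>\<^sub>\<infinity>k. a m * c m k * w k) = a m * (\<Sum>\<^sub>\<infinity>k. c m k * w k)" for m
      unfolding mult.assoc by (rule infsum_cmult_right')
    have l: "(\<Sum>\<^sub>\<infinity>m. a m * c m k * w k) = C k * w k" for k
      unfolding C_def by (rule infsum_cmult_left')
    have "(\<lambda>m. \<Sum>\<^sub>\<infinity>k. a m * c m k * w k) summable_on UNIV"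
      by (rule summable_on_Sigma_banach[OF sw])
    from has_sum_infsum[OF this] show ?thesis
      unfolding infsum_swap_banach[OF sw] l unfolding r .
  qed
  show "wiener2 F (\<lambda>k. \<Sum>\<^sub>\<infinity>m. a m * c m k)"
    unfolding C_def[symmetric] wiener2_def
  proof (intro conjI allI Cs)
    fix q p
    let ?w = "\<lambda>k. ee (q * of_int (snd k) - p * of_int (fst k))"
    have "(\<Sum>\<^sub>\<infinity>k. c m k * ?w k) = f m (q, p)" for m
      using f by (intro infsumI) (simp add: wiener2_def)
    with test[of ?w] have "((\<lambda>m. a m * f m (q, p)) has_sum (\<Sum>\<^sub>\<infinity>k. C k * ?w k)) UNIV" by simp
    from has_sum_unique[OF F this] have "F (q, p) = (\<Sum>\<^sub>\<infinity>k. C k * ?w k)" .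
    moreover have "(\<lambda>k. norm (C k * ?w k)) summable_on UNIV" using Cs by (simp add: norm_mult)
    ultimately show "((\<lambda>k. C k * ?w k) has_sum F (q, p)) UNIV"
      using has_sum_infsum[OF abs_summable_summable] by simp
  qed
  then have W: "wiener2 F C" by (simp add: C_def)
  fix i j assume ij: "i < N" "j < N"
  let ?w = "\<lambda>k. translation N k $$ (i, j)"
  have "(\<Sum>\<^sub>\<infinity>k. c m k * ?w k) = weyl_op N (f m) $$ (i, j)" for m
    by (rule infsumI[OF weyl_op_has_sum[OF f ij]])
  moreover have "(\<Sum>\<^sub>\<infinity>k. C k * ?w k) = weyl_op N F $$ (i, j)"
    by (rule infsumI[OF weyl_op_has_sum[OF W ij]])
  ultimately show "((\<lambda>m. a m * weyl_op N (f m) $$ (i, j)) has_sum weyl_op N F $$ (i, j)) UNIV"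
    using test[of ?w] translation_norm_le[OF ij] by simp
qed

lemma commutator_has_sum:
  fixes a :: "'m \<Rightarrow> complex" and A B :: "'m \<Rightarrow> complex mat"
  assumes P: "P \<in> carrier_mat N N" and A: "\<And>m. A m \<in> carrier_mat N N" "\<And>m. B m \<in> carrier_mat N N"
    and F: "F \<in> carrier_mat N N" "G \<in> carrier_mat N N"
    and s: "\<And>i j. i < N \<Longrightarrow> j < N \<Longrightarrow> ((\<lambda>m. a m * A m $$ (i, j)) has_sum F $$ (i, j)) UNIV"
      "\<And>i j. i < N \<Longrightarrow> j < N \<Longrightarrow> ((\<lambda>m. a m * B m $$ (i, j)) has_sum G $$ (i, j)) UNIV"
    and ij: "i < N" "j < N"
  shows "((\<lambda>m. (a m \<cdot>\<^sub>m (P * A m - B m * P)) $$ (i, j)) has_sum (P * F - G * P) $$ (i, j)) UNIV"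
proof -
  have "((\<lambda>m. (\<Sum>l<N. P $$ (i, l) * (a m * A m $$ (l, j))) + (- 1) * (\<Sum>l<N. (a m * B m $$ (i, l)) * P $$ (l, j))) has_sum
     ((\<Sum>l<N. P $$ (i, l) * F $$ (l, j)) + (- 1) * (\<Sum>l<N. G $$ (i, l) * P $$ (l, j)))) UNIV"
    using ij by (intro has_sum_add has_sum_cmult_right has_sum_finite_sum has_sum_cmult_left s) auto
  also have "(\<lambda>m. (\<Sum>l<N. P $$ (i, l) * (a m * A m $$ (l, j))) + (- 1) * (\<Sum>l<N. (a m * B m $$ (i, l)) * P $$ (l, j))) =
     (\<lambda>m. (a m \<cdot>\<^sub>m (P * A m - B m * P)) $$ (i, j))"
  proof
    fix m
    have c: "P * A m \<in> carrier_mat N N" "B m * P \<in> carrier_mat N N"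
      using P A by (auto intro!: mult_carrier_mat[of _ N N _ N])
    have "(a m \<cdot>\<^sub>m (X - Y)) $$ (i, j) = a m * (X $$ (i, j) - Y $$ (i, j))"
      if "X \<in> carrier_mat N N" "Y \<in> carrier_mat N N" for X Y :: "complex mat"
      using ij that by auto
    from this[OF c] have "(a m \<cdot>\<^sub>m (P * A m - B m * P)) $$ (i, j) = a m * ((P * A m) $$ (i, j) - (B m * P) $$ (i, j))" .
    also have "\<dots> = a m * ((\<Sum>l<N. P $$ (i, l) * A m $$ (l, j)) - (\<Sum>l<N. B m $$ (i, l) * P $$ (l, j)))"
      using mat_mult_index[OF P A(1) ij] mat_mult_index[OF A(2) P ij] by simp
    finally show "(\<Sum>l<N. P $$ (i, l) * (a m * A m $$ (l, j))) + (- 1) * (\<Sum>l<N. (a m * B m $$ (i, l)) * P $$ (l, j)) =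
      (a m \<cdot>\<^sub>m (P * A m - B m * P)) $$ (i, j)"
      by (simp add: right_diff_distrib sum_distrib_left sum_negf mult_ac)
  qed
  also have "(\<Sum>l<N. P $$ (i, l) * F $$ (l, j)) + (- 1) * (\<Sum>l<N. G $$ (i, l) * P $$ (l, j)) = (P * F - G * P) $$ (i, j)"
  proof -
    have c: "P * F \<in> carrier_mat N N" "G * P \<in> carrier_mat N N"
      using P F by (auto intro!: mult_carrier_mat[of _ N N _ N])
    have "(X - Y) $$ (i, j) = X $$ (i, j) - Y $$ (i, j)"
      if "X \<in> carrier_mat N N" "Y \<in> carrier_mat N N" for X Y :: "complex mat"
      using ij that by auto
    from this[OF c] show ?thesis using mat_mult_index[OF P F(1) ij] mat_mult_index[OF F(2) P ij] by simp
  qed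
  finally show ?thesis .
qed

lemma has_sum_lessThan:
  fixes h :: "nat \<Rightarrow> 'b::{topological_comm_monoid_add,t2_space}"
  assumes "\<And>m. \<not> m < K \<Longrightarrow> h m = 0"
  shows "(h has_sum (\<Sum>m<K. h m)) UNIV"
  by (rule has_sum_finite_neutralI[of "{..<K}"]) (use assms in auto)

lemma wiener_add: "wiener u U \<Longrightarrow> wiener v V \<Longrightarrow> wiener (\<lambda>x. u x + v x) (\<lambda>k. U k + V k)"
  unfolding wiener_def
  by (auto simp: distrib_right intro!: has_sum_add summable_on_comparison_test[OF summable_on_add norm_triangle_ineq])

lemma wiener_cmult: "wiener u U \<Longrightarrow> wiener (\<lambda>x. a * u x) (\<lambda>k. a * U k)"
  unfolding wiener_def by (auto simp: norm_mult mult.assoc intro!: has_sum_cmult_right summable_on_cmult_right)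

lemma wiener_zero: "wiener (\<lambda>x. 0) (\<lambda>k. 0)"
  by (simp add: wiener_def)

lemma wiener_sum:
  assumes "finite I" "\<And>m. m \<in> I \<Longrightarrow> wiener (u m) (U m)"
  shows "wiener (\<lambda>x. \<Sum>m\<in>I. a m * u m x) (\<lambda>k. \<Sum>m\<in>I. a m * U m k)"
  using assms by (induction I) (auto intro!: wiener_zero wiener_add wiener_cmult)

context bump_pair
begin

lemma wiener2_cell:
  assumes "i < 2 ^ r" "l < 2 ^ t"
  shows "\<exists>c. wiener2 (cell r t i l) c \<and> (\<Sum>\<^sub>\<infinity>k. norm (c k)) \<le> (2 ^ r * (3 * lattice_sum) * A) * (2 ^ t * (3 * lattice_sum) * A)"
proof -
  let ?U = "fc1 (bump W r i)" and ?V = "fc1 (bump W' t l)"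
  have U: "(\<lambda>k. norm (?U k)) summable_on UNIV" "(\<Sum>\<^sub>\<infinity>k. norm (?U k)) \<le> 2 ^ r * (3 * lattice_sum) * A"
    by (rule bump_coeffs_sum[OF W(1) \<delta>(1) assms(1) dec(1)])+
  have V: "(\<Sum>\<^sub>\<infinity>k. norm (?V k)) \<le> 2 ^ t * (3 * lattice_sum) * A"
    by (rule bump_coeffs_sum[OF W(2) \<delta>(1) assms(2) dec(2)])
  have Vn: "(\<Sum>\<^sub>\<infinity>k. norm (?V (- k))) = (\<Sum>\<^sub>\<infinity>k. norm (?V k))"
    by (rule infsum_reindex_bij_betw[of uminus UNIV UNIV "\<lambda>k. norm (?V k)"]) (simp add: bij_uminus)
  have w: "wiener2 (cell r t i l) (\<lambda>(k1, k2). ?V (- k1) * ?U k2)"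
    unfolding cell_def tens_def by (rule wiener2_tensor[OF wiener_W[OF assms(1)] wiener_W'[OF assms(2)]])
  have abs: "(\<lambda>(k1, k2). norm (?V (- k1)) * norm (?U k2)) summable_on UNIV \<times> UNIV"
    using wiener2_abs[OF w] by (simp add: norm_mult case_prod_unfold)
  have "(\<Sum>\<^sub>\<infinity>k. norm (case k of (k1, k2) \<Rightarrow> ?V (- k1) * ?U k2)) = (\<Sum>\<^sub>\<infinity>(k1, k2)\<in>UNIV \<times> UNIV. norm (?V (- k1)) * norm (?U k2))"
    by (simp add: norm_mult case_prod_unfold)
  also have "\<dots> = (\<Sum>\<^sub>\<infinity>k1. \<Sum>\<^sub>\<infinity>k2. norm (?V (- k1)) * norm (?U k2))"
    by (rule infsum_Sigma'_banach[OF abs, symmetric])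
  also have "\<dots> = (\<Sum>\<^sub>\<infinity>k. norm (?V k)) * (\<Sum>\<^sub>\<infinity>k. norm (?U k))"
    by (simp add: infsum_cmult_right' infsum_cmult_left' Vn)
  also have "\<dots> \<le> (2 ^ t * (3 * lattice_sum) * A) * (2 ^ r * (3 * lattice_sum) * A)"
    using U V by (intro mult_mono) (auto intro!: infsum_nonneg mult_nonneg_nonneg lattice_sum_nonneg quad_decay_nonneg[OF dec(1)])
  finally show ?thesis using w by (auto simp: mult.commute)
qed

text \<open>Only the first bound and the coefficient sums grow with the number \<open>K\<close> of
  cells. In the norm bounds for \<open>F\<close> and \<open>G\<close> the sum over cells sits in a
  single factor and enters through \<open>S\<close>, while the other factor stays at level
  0.\<close>

lemma egorov_cells:
  assumes lk: "\<And>m. m < K \<Longrightarrow> linked n 0 0 (i m) 0 0 (l m)"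
    and \<phi>: "\<And>m. cmod (\<phi> m) \<le> 1"
    and F: "F = (\<lambda>x. \<Sum>m<K. \<phi> m * cell n 0 (i m) 0 x)" and G: "G = (\<lambda>x. \<Sum>m<K. \<phi> m * cell 0 n 0 (l m) x)"
    and S: "\<And>x. cmod (F x) \<le> S" "\<And>x. cmod (G x) \<le> S"
    and one: "cmod (W (1 / 2)) = 1" "cmod (W' (1 / 2)) = 1"
  shows "op_bound (2 * M) (qpow M n * weyl_op (2 * M) F - weyl_op (2 * M) G * qpow M n) (real K * (real n * err n))"
    and "op_bound (2 * M) (weyl_op (2 * M) F) (S * (3 * lattice_sum * A))"
    and "op_bound (2 * M) (weyl_op (2 * M) G) (S * (3 * lattice_sum * A))"
    and "\<exists>c. wiener2 F c \<and> (\<Sum>\<^sub>\<infinity>k. norm (c k)) \<le> real K * (2 ^ n * (3 * lattice_sum * A)\<^sup>2)"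
    and "\<exists>c. wiener2 G c \<and> (\<Sum>\<^sub>\<infinity>k. norm (c k)) \<le> real K * (2 ^ n * (3 * lattice_sum * A)\<^sup>2)"
proof -
  have i: "i m < 2 ^ n" and l: "l m < 2 ^ n" if "m < K" for m using lk[OF that] by (auto simp: linked_def)
  let ?R = "2 ^ n * (3 * lattice_sum * A)\<^sup>2"
  have R: "(2 ^ n * (3 * lattice_sum) * A) * (2 ^ 0 * (3 * lattice_sum) * A) = ?R" "(2 ^ 0 * (3 * lattice_sum) * A) * (2 ^ n * (3 * lattice_sum) * A) = ?R"
    by (simp_all add: power2_eq_square mult_ac)
  \<comment> \<open>Coefficients are padded by 0 and indices by the valid cell 0, which turns the
    finite sum into a series over all naturals as \<open>wiener2_comb\<close> expects.\<close>
  define a where "a m = (if m < K then \<phi> m else 0)" for m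
  define f where "f m = cell n 0 (if m < K then i m else 0) 0" for m
  define g where "g m = cell 0 n 0 (if m < K then l m else 0)" for m
  have "\<exists>c. wiener2 (f m) c \<and> (\<Sum>\<^sub>\<infinity>k. norm (c k)) \<le> ?R" for m
    unfolding f_def using wiener2_cell[of "if m < K then i m else 0" n 0 0] i unfolding R by auto
  then obtain c where c: "\<And>m. wiener2 (f m) (c m)" "\<And>m. (\<Sum>\<^sub>\<infinity>k. norm (c m k)) \<le> ?R" by metis
  have "\<exists>c. wiener2 (g m) c \<and> (\<Sum>\<^sub>\<infinity>k. norm (c k)) \<le> ?R" for m
    unfolding g_def using wiener2_cell[of 0 0 "if m < K then l m else 0" n] l unfolding R by auto
  then obtain d where d: "\<And>m. wiener2 (g m) (d m)" "\<And>m. (\<Sum>\<^sub>\<infinity>k. norm (d m k)) \<le> ?R" by metis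
  have as: "((\<lambda>m. norm (a m)) has_sum (\<Sum>m<K. norm (a m))) UNIV" by (rule has_sum_lessThan) (simp add: a_def)
  have asum: "(\<lambda>m. norm (a m)) summable_on UNIV" using as by (rule has_sum_imp_summable)
  have aK: "(\<Sum>\<^sub>\<infinity>m. norm (a m)) \<le> real K"
    using infsumI[OF as] sum_bounded_above[of "{..<K}" "\<lambda>m. norm (a m)" 1] \<phi> by (simp add: a_def)
  have Fs: "((\<lambda>m. a m * f m x) has_sum F x) UNIV" for x
  proof -
    have "(\<Sum>m<K. a m * f m x) = F x" unfolding F by (rule sum.cong) (auto simp: a_def f_def)
    then show ?thesis using has_sum_lessThan[of K "\<lambda>m. a m * f m x"] by (simp add: a_def)
  qed
  have Gs: "((\<lambda>m. a m * g m x) has_sum G x) UNIV" for x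
  proof -
    have "(\<Sum>m<K. a m * g m x) = G x" unfolding G by (rule sum.cong) (auto simp: a_def g_def)
    then show ?thesis using has_sum_lessThan[of K "\<lambda>m. a m * g m x"] by (simp add: a_def)
  qed
  have R0: "0 \<le> ?R" by simp
  note cF = wiener2_comb[OF c asum Fs] and cG = wiener2_comb[OF d asum Gs]
  have le: "?R * (\<Sum>\<^sub>\<infinity>m. norm (a m)) \<le> real K * ?R"
    using mult_left_mono[OF aK R0] by (simp only: mult.commute[of "real K"])
  show "\<exists>c. wiener2 F c \<and> (\<Sum>\<^sub>\<infinity>k. norm (c k)) \<le> real K * ?R"
    using cF(1) order_trans[OF cF(2) le] by blast
  show "\<exists>c. wiener2 G c \<and> (\<Sum>\<^sub>\<infinity>k. norm (c k)) \<le> real K * ?R"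
    using cG(1) order_trans[OF cG(2) le] by blast
  let ?N = "2 * M" and ?P = "qpow M n"
  have ne: "0 \<le> real n * err n" using err_nonneg by simp
  show "op_bound ?N (?P * weyl_op ?N F - weyl_op ?N G * ?P) (real K * (real n * err n))"
  proof (rule op_bound_has_sum[where B = "\<lambda>m. a m \<cdot>\<^sub>m (?P * weyl_op ?N (f m) - weyl_op ?N (g m) * ?P)" and b = "\<lambda>m. norm (a m) * (real n * err n)"])
    show "?P * weyl_op ?N F - weyl_op ?N G * ?P \<in> carrier_mat ?N ?N"
      by (intro minus_carrier_mat mult_carrier_mat[of _ ?N ?N]) simp_all
    show "op_bound ?N (a m \<cdot>\<^sub>m (?P * weyl_op ?N (f m) - weyl_op ?N (g m) * ?P)) (norm (a m) * (real n * err n))" for m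
    proof (cases "m < K")
      case True
      then have "op_bound ?N (?P * weyl_op ?N (f m) - weyl_op ?N (g m) * ?P) (real n * err n)"
        using lk[OF True] by (simp add: linked_def f_def g_def)
      then show ?thesis by (rule op_bound_smult)
    next
      case False
      have "?P * weyl_op ?N (f m) - weyl_op ?N (g m) * ?P \<in> carrier_mat ?N ?N"
        by (intro minus_carrier_mat mult_carrier_mat[of _ ?N ?N]) simp_all
      moreover have "0 \<cdot>\<^sub>m X = 0\<^sub>m ?N ?N" if "X \<in> carrier_mat ?N ?N" for X :: "complex mat"
        using that by auto
      ultimately have "0 \<cdot>\<^sub>m (?P * weyl_op ?N (f m) - weyl_op ?N (g m) * ?P) = 0\<^sub>m ?N ?N" by blast
      then show ?thesis using False op_bound_zero by (simp add: a_def)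
    qed
    show "((\<lambda>m. (a m \<cdot>\<^sub>m (?P * weyl_op ?N (f m) - weyl_op ?N (g m) * ?P)) $$ (i', j')) has_sum
        (?P * weyl_op ?N F - weyl_op ?N G * ?P) $$ (i', j')) UNIV" if "i' < ?N" "j' < ?N" for i' j'
      by (rule commutator_has_sum[OF qpow_carrier(1) weyl_op_carrier weyl_op_carrier weyl_op_carrier weyl_op_carrier
          cF(3) cG(3) that])
    show "(\<lambda>m. norm (a m) * (real n * err n)) summable_on UNIV" by (rule summable_on_cmult_left[OF asum])
    show "(\<Sum>\<^sub>\<infinity>m. norm (a m) * (real n * err n)) \<le> real K * (real n * err n)"
      using aK ne by (simp add: infsum_cmult_left' mult_right_mono)
  qed
  define u where "u q = (\<Sum>m<K. \<phi> m * bump W n (i m) q)" for q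
  define v where "v p = (\<Sum>m<K. \<phi> m * bump W' n (l m) p)" for p
  have Fu: "F = (\<lambda>(q, p). u q * bump W' 0 0 p)"
    unfolding F u_def cell_def tens_def by (auto simp: fun_eq_iff sum_distrib_right mult.assoc)
  have Gv: "G = (\<lambda>(q, p). bump W 0 0 q * v p)"
    unfolding G v_def cell_def tens_def by (auto simp: fun_eq_iff sum_distrib_left mult_ac)
  have half: "bump W 0 0 (1 / 2) = W (1 / 2)" "bump W' 0 0 (1 / 2) = W' (1 / 2)"
    by (simp_all add: bump_def frac_eq)
  \<comment> \<open>At \<open>1/2\<close> the other factor has modulus one.\<close>
  have us: "cmod (u q) \<le> S" for q
    using S(1)[of "(q, 1 / 2)"] one(2) unfolding Fu by (simp add: norm_mult half)
  have vs: "cmod (v p) \<le> S" for p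
    using S(2)[of "(1 / 2, p)"] one(1) unfolding Gv by (simp add: norm_mult half)
  have S_nonneg: "0 \<le> S" using order_trans[OF norm_ge_zero us] .
  have u: "wiener u (\<lambda>k. \<Sum>m<K. \<phi> m * fc1 (bump W n (i m)) k)"
    unfolding u_def by (rule wiener_sum) (auto intro!: wiener_W i)
  have v: "wiener v (\<lambda>k. \<Sum>m<K. \<phi> m * fc1 (bump W' n (l m)) k)"
    unfolding v_def by (rule wiener_sum) (auto intro!: wiener_W' l)
  have N: "?N > 0" using M by simp
  have z: "(0::nat) < 2 ^ 0" by simp
  note W0 = wiener_W[OF z] wiener_W'[OF z]
  have V0: "(\<lambda>k. norm (fc1 (bump W' 0 0) (- k))) summable_on UNIV" "(\<Sum>\<^sub>\<infinity>k. norm (fc1 (bump W' 0 0) (- k))) \<le> 3 * lattice_sum * A"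
    using bump_coeffs_sum[OF W(2) \<delta>(1) z dec(2)] summable_on_neg_iff[of "\<lambda>k. norm (fc1 (bump W' 0 0) k)"]
      infsum_reindex_bij_betw[of uminus UNIV UNIV "\<lambda>k. norm (fc1 (bump W' 0 0) k)"] by (simp_all add: bij_uminus)
  have U0: "(\<lambda>k. norm (fc1 (bump W 0 0) k)) summable_on UNIV" "(\<Sum>\<^sub>\<infinity>k. norm (fc1 (bump W 0 0) k)) \<le> 3 * lattice_sum * A"
    using bump_coeffs_sum[OF W(1) \<delta>(1) z dec(1)] by simp_all
  have "weyl_op ?N F = opt ?N u (\<lambda>k. fc1 (bump W' 0 0) (- k))" unfolding Fu by (rule weyl_op_tensor[OF u W0(2)])
  then show "op_bound ?N (weyl_op ?N F) (S * (3 * lattice_sum * A))"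
    using op_bound_mono[OF op_bound_opt[OF N V0(1) us] mult_left_mono[OF V0(2) S_nonneg]] by simp
  have w: "weyl_op ?N G = opt ?N (bump W 0 0) (\<lambda>k. \<Sum>m<K. \<phi> m * fc1 (bump W' n (l m)) (- k))"
    unfolding Gv by (rule weyl_op_tensor[OF W0(1) v])
  \<comment> \<open>In \<open>G\<close> the many bumps are in the momentum factor. A Fourier
    transform moves them into the position factor, where only their sup norm counts.\<close>
  have "weyl_op ?N G = idft ?N * (dft ?N * weyl_op ?N G)"
    by (subst assoc_mult_mat[OF idft_carrier dft_carrier weyl_op_carrier, symmetric])
      (simp add: dft_idft[OF N] left_mult_one_mat[OF weyl_op_carrier])
  also have "dft ?N * weyl_op ?N G = opt ?N v (fc1 (bump W 0 0)) * dft ?N"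
    unfolding w by (rule dft_opt[OF N W0(1) v])
  finally have "weyl_op ?N G = idft ?N * (opt ?N v (fc1 (bump W 0 0)) * dft ?N)" .
  moreover have "op_bound ?N (idft ?N * (opt ?N v (fc1 (bump W 0 0)) * dft ?N)) (1 * ((S * (3 * lattice_sum * A)) * 1))"
    by (intro op_bound_mult op_bound_dft[OF N] op_bound_mono[OF op_bound_opt[OF N U0(1) vs] mult_left_mono[OF U0(2) S_nonneg]])
  ultimately show "op_bound ?N (weyl_op ?N G) (S * (3 * lattice_sum * A))" by simp
qed

end

section \<open>Decay of the Fourier coefficients of the observable\<close>

lemma fc1_cmult: "fc1 (\<lambda>t. a * w t) k = a * fc1 w k"
  unfolding fc1_def mult.assoc by (rule integral_mult_right)

lemma fc1_norm_le:
  assumes "continuous_on UNIV w" "\<And>t. norm (w t) \<le> B"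
  shows "norm (fc1 w k) \<le> B"
proof -
  have "norm (fc1 w k) \<le> integral {0..1} (\<lambda>t::real. B)"
    unfolding fc1_def
    by (rule integral_norm_bound_integral)
      (auto simp: norm_mult assms intro!: integrable_continuous_real continuous_intros continuous_on_subset[OF assms(1)])
  then show ?thesis by simp
qed

text \<open>The boundary condition is phrased to cover both uses: a periodic function at integer
  \<xi>, and a function vanishing at both ends at real \<xi>.\<close>

lemma integral_by_parts_ee:
  fixes g g' :: "real \<Rightarrow> complex"
  assumes d: "\<And>t. (g has_vector_derivative g' t) (at t)" and c: "continuous_on UNIV g'"
    and op_bound: "g 1 * ee (- \<xi>) = g 0"
  shows "integral {0..1} (\<lambda>t. g' t * ee (- (\<xi> * t))) = 2 * pi * \<i> * \<xi> * integral {0..1} (\<lambda>t. g t * ee (- (\<xi> * t)))"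
proof -
  have cg: "continuous_on UNIV g"
    using d by (intro continuous_at_imp_continuous_on ballI) (rule has_vector_derivative_continuous)
  let ?e = "\<lambda>t. ee (- (\<xi> * t))"
  define J where "J = 2 * pi * \<i> * of_real (- \<xi>)"
  have e: "(?e has_vector_derivative (J * ?e t)) (at t within S)" for t S
    using has_vector_derivative_ee[of "- \<xi>" t S] by (simp add: J_def)
  have "((\<lambda>t. g t * ?e t) has_vector_derivative (g t * (J * ?e t) + g' t * ?e t)) (at t within {0..1})" for t
    by (rule has_vector_derivative_mult[OF has_vector_derivative_at_within[OF d] e])
  then have "((\<lambda>t. g t * (J * ?e t) + g' t * ?e t) has_integral (g 1 * ?e 1 - g 0 * ?e 0)) {0..1}"
    by (intro fundamental_theorem_of_calculus) auto
  then have "0 = integral {0..1} (\<lambda>t. g t * (J * ?e t) + g' t * ?e t)"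
    using op_bound by (simp add: integral_unique)
  also have "\<dots> = integral {0..1} (\<lambda>t. g t * (J * ?e t)) + integral {0..1} (\<lambda>t. g' t * ?e t)"
    by (rule integral_add; intro integrable_continuous_real continuous_intros continuous_on_subset[OF cg] continuous_on_subset[OF c]) auto
  also have "(\<lambda>t. g t * (J * ?e t)) = (\<lambda>t. J * (g t * ?e t))"
    by (simp add: mult_ac)
  also have "integral {0..1} \<dots> = J * integral {0..1} (\<lambda>t. g t * ?e t)" by (rule integral_mult_right)
  finally have "integral {0..1} (\<lambda>t. g' t * ?e t) = - (J * integral {0..1} (\<lambda>t. g t * ?e t))"
    by (simp add: eq_neg_iff_add_eq_0 add.commute)
  then show ?thesis by (simp add: J_def)
qed

lemma fc1_deriv:
  assumes d: "\<And>t. (g has_vector_derivative g' t) (at t)" and c: "continuous_on UNIV g'" and per: "per1 g"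
  shows "fc1 g' k = 2 * pi * \<i> * of_int k * fc1 g k"
  unfolding fc1_def using per[unfolded per1_def, rule_format, of 0]
  by (subst integral_by_parts_ee[OF d c]) (auto simp: ee_minus)

text \<open>With the p-integral innermost, derivatives in \<open>p\<close> can be integrated by
  parts; \<open>fourier_coeff_fc1\<close> does the same for derivatives in \<open>q\<close>.\<close>

lemma fourier_coeff_fc1':
  assumes cont: "continuous_on UNIV f"
  shows "fourier_coeff f (k1, k2) = fc1 (\<lambda>q. fc1 (\<lambda>p. f (q, p)) (- k1)) k2"
proof -
  let ?h = "\<lambda>x. f x * ee (- (fst x * of_int k2 - snd x * of_int k1))"
  have "integral (cbox (0, 0) (1, 1)) ?h = integral (cbox 0 1) (\<lambda>q. integral (cbox 0 1) (\<lambda>p. ?h (q, p)))"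
    by (rule integral_prod_continuous) (auto intro!: continuous_intros continuous_on_subset[OF cont])
  also have "\<dots> = fc1 (\<lambda>q. fc1 (\<lambda>p. f (q, p)) (- k1)) k2"
    unfolding fc1_def integral_mult_left[symmetric]
    by (simp add: ee_add[symmetric] mult.assoc algebra_simps)
  finally show ?thesis by (simp add: fourier_coeff_cbox cont)
qed

section \<open>Smooth functions on the torus\<close>

definition smooth2 :: "(real \<times> real \<Rightarrow> complex) \<Rightarrow> bool" where
  "smooth2 f \<longleftrightarrow> periodic2 f \<and> (\<forall>k. C_k k f)"

lemma smooth2_differentiable: "smooth2 f \<Longrightarrow> f differentiable (at x)"
  unfolding smooth2_def using C_k.simps(2)[of 0 f] by (cases x) (auto simp: differentiable_on_def)

lemma smooth2_continuous: "smooth2 f \<Longrightarrow> continuous_on UNIV f"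
  unfolding smooth2_def using C_k.simps(1) by blast

lemma smooth2_periodic: "smooth2 f \<Longrightarrow> f (q + 1, p) = f (q, p) \<and> f (q, p + 1) = f (q, p)"
  by (simp add: smooth2_def periodic2_def)

lemma smooth2_partial_q:
  assumes "smooth2 f" shows "((\<lambda>t. f (t, p)) has_vector_derivative partial_q f (q, p)) (at q)"
proof -
  have "(\<lambda>t. f (t, p)) differentiable (at q)"
    by (rule differentiable_compose[of f "\<lambda>t. (t, p)", OF smooth2_differentiable[OF assms]])
      (auto intro!: derivative_intros)
  then show ?thesis unfolding partial_q_def prod.case by (rule vector_derivative_works[THEN iffD1])
qed

lemma smooth2_partial_p:
  assumes "smooth2 f" shows "((\<lambda>t. f (q, t)) has_vector_derivative partial_p f (q, p)) (at p)"
proof -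
  have "(\<lambda>t. f (q, t)) differentiable (at p)"
    by (rule differentiable_compose[of f "\<lambda>t. (q, t)", OF smooth2_differentiable[OF assms]])
      (auto intro!: derivative_intros)
  then show ?thesis unfolding partial_p_def prod.case by (rule vector_derivative_works[THEN iffD1])
qed

lemma vector_derivative_shift:
  fixes g :: "real \<Rightarrow> complex"
  assumes g: "\<And>t. (g has_vector_derivative g' t) (at t)" and per: "\<And>t. g (t + 1) = g t"
  shows "g' (t + 1) = g' t"
proof -
  have "((\<lambda>t. t + 1) has_vector_derivative 1) (at t)" by (auto intro!: derivative_eq_intros)
  from vector_diff_chain_at[OF this g]
  have "(g has_vector_derivative g' (t + 1)) (at t)" by (simp add: o_def per)
  then show ?thesis using g vector_derivative_unique_at by blast
qed

lemma smooth2_partial: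
  assumes f: "smooth2 f" shows "smooth2 (partial_q f)" "smooth2 (partial_p f)"
proof -
  have C: "C_k k (partial_q f)" "C_k k (partial_p f)" for k
    using f C_k.simps(2)[of k f] by (auto simp: smooth2_def)
  have pq: "periodic2 (partial_q f)" unfolding periodic2_def
  proof (intro allI conjI)
    fix q p
    show "partial_q f (q + 1, p) = partial_q f (q, p)"
      by (rule vector_derivative_shift[of "\<lambda>t. f (t, p)" "\<lambda>q. partial_q f (q, p)"])
        (use smooth2_partial_q[OF f] smooth2_periodic[OF f] in auto)
    show "partial_q f (q, p + 1) = partial_q f (q, p)"
      using smooth2_periodic[OF f] by (simp add: partial_q_def)
  qed
  have pp: "periodic2 (partial_p f)" unfolding periodic2_def
  proof (intro allI conjI)
    fix q p
    show "partial_p f (q, p + 1) = partial_p f (q, p)"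
      by (rule vector_derivative_shift[of "\<lambda>t. f (q, t)" "\<lambda>p. partial_p f (q, p)"])
        (use smooth2_partial_p[OF f] smooth2_periodic[OF f] in auto)
    show "partial_p f (q + 1, p) = partial_p f (q, p)"
      using smooth2_periodic[OF f] by (simp add: partial_p_def)
  qed
  show "smooth2 (partial_q f)" "smooth2 (partial_p f)" using C pq pp by (auto simp: smooth2_def)
qed

lemma smooth2_partial_pow: "smooth2 f \<Longrightarrow> smooth2 ((partial_q ^^ j) f)" "smooth2 f \<Longrightarrow> smooth2 ((partial_p ^^ j) f)"
  by (induction j) (auto simp: smooth2_partial)

lemma smooth2_partial_multi: "smooth2 f \<Longrightarrow> smooth2 (partial \<gamma> f)"
  unfolding partial_def by (intro smooth2_partial_pow)

lemma fourier_coeff_partial: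
  assumes f: "smooth2 f"
  shows "fourier_coeff (partial_q f) (k1, k2) = 2 * pi * \<i> * of_int k2 * fourier_coeff f (k1, k2)"
    and "fourier_coeff (partial_p f) (k1, k2) = - (2 * pi * \<i> * of_int k1 * fourier_coeff f (k1, k2))"
proof -
  note c = smooth2_continuous[OF f] smooth2_continuous[OF smooth2_partial(1)[OF f]] smooth2_continuous[OF smooth2_partial(2)[OF f]]
  have 1: "fc1 (\<lambda>q. partial_q f (q, p)) k2 = 2 * pi * \<i> * of_int k2 * fc1 (\<lambda>q. f (q, p)) k2" for p
    by (rule fc1_deriv[OF smooth2_partial_q[OF f]])
      (use smooth2_periodic[OF f] in \<open>auto simp: per1_def intro!: continuous_on_pair[OF c(2)] continuous_intros\<close>)
  show "fourier_coeff (partial_q f) (k1, k2) = 2 * pi * \<i> * of_int k2 * fourier_coeff f (k1, k2)"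
    unfolding fourier_coeff_fc1[OF c(2)] fourier_coeff_fc1[OF c(1)] 1 by (rule fc1_cmult)
  have 2: "fc1 (\<lambda>p. partial_p f (q, p)) (- k1) = (- (2 * pi * \<i> * of_int k1)) * fc1 (\<lambda>p. f (q, p)) (- k1)" for q
    by (subst fc1_deriv[OF smooth2_partial_p[OF f]])
      (use smooth2_periodic[OF f] in \<open>auto simp: per1_def intro!: continuous_on_pair[OF c(3)] continuous_intros\<close>)
  show "fourier_coeff (partial_p f) (k1, k2) = - (2 * pi * \<i> * of_int k1 * fourier_coeff f (k1, k2))"
    unfolding fourier_coeff_fc1'[OF c(3)] fourier_coeff_fc1'[OF c(1)] 2 by (subst fc1_cmult) simp
qed

lemma fourier_coeff_partial_pow:
  assumes f: "smooth2 f"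
  shows "norm (fourier_coeff ((partial_q ^^ j) f) (k1, k2)) = (2 * pi * \<bar>of_int k2\<bar>) ^ j * norm (fourier_coeff f (k1, k2))"
    and "norm (fourier_coeff ((partial_p ^^ j) f) (k1, k2)) = (2 * pi * \<bar>of_int k1\<bar>) ^ j * norm (fourier_coeff f (k1, k2))"
proof (induction j)
  case (Suc j)
  show "norm (fourier_coeff ((partial_q ^^ Suc j) f) (k1, k2)) = (2 * pi * \<bar>of_int k2\<bar>) ^ Suc j * norm (fourier_coeff f (k1, k2))"
    using Suc.IH(1) by (simp add: fourier_coeff_partial[OF smooth2_partial_pow(1)[OF f]] norm_mult)
  show "norm (fourier_coeff ((partial_p ^^ Suc j) f) (k1, k2)) = (2 * pi * \<bar>of_int k1\<bar>) ^ Suc j * norm (fourier_coeff f (k1, k2))"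
    using Suc.IH(2) by (simp add: fourier_coeff_partial[OF smooth2_partial_pow(2)[OF f]] norm_mult)
qed auto

lemma periodic2_torus_rep: assumes "periodic2 f" shows "f (torus_rep x) = f x"
proof -
  have 1: "per1 (\<lambda>q. f (q, p))" "per1 (\<lambda>p. f (q, p))" for q p using assms by (auto simp: per1_def periodic2_def)
  obtain q p where x: "x = (q, p)" by force
  have "f (frac q, frac p) = f (q, p)"
    using per1_frac[of "\<lambda>q. f (q, frac p)" q, OF 1(1)] per1_frac[of "\<lambda>p. f (q, p)" p, OF 1(2)] by simp
  then show ?thesis by (simp add: x torus_rep_def)
qed

text \<open>A supremum of reals is an upper bound only for a bounded range. Periodicity reduces
  boundedness to the compact unit square.\<close>

lemma C0_norm_bound:
  assumes "smooth2 f" shows "norm (f x) \<le> C0_norm f"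
proof -
  have "compact (f ` cbox (0, 0) (1, 1))"
    by (intro compact_continuous_image continuous_on_subset[OF smooth2_continuous[OF assms]]) auto
  then have "bounded (f ` cbox (0, 0) (1, 1))" by (rule compact_imp_bounded)
  then obtain B where "\<forall>y\<in>f ` cbox (0, 0) (1, 1). norm y \<le> B" unfolding bounded_iff by (rule exE)
  then have B: "norm y \<le> B" if "y \<in> f ` cbox (0, 0) (1, 1)" for y using that by (rule bspec)
  have "norm (f y) \<le> B" for y
  proof -
    have "torus_rep y \<in> cbox (0, 0) (1, 1)"
      by (auto simp: torus_rep_def cbox_Pair_eq less_imp_le[OF frac_lt_1])
    then have "norm (f (torus_rep y)) \<le> B" by (intro B) auto
    then show ?thesis using periodic2_torus_rep[of f y] assms by (simp add: smooth2_def)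
  qed
  then have "bdd_above (range (\<lambda>x. norm (f x)))" by (intro bdd_aboveI2)
  then show ?thesis unfolding C0_norm_def by (intro cSUP_upper) auto
qed

lemma fourier_coeff_le_C0: assumes f: "smooth2 f" shows "norm (fourier_coeff f k) \<le> C0_norm f"
proof -
  obtain k1 k2 where k: "k = (k1, k2)" by force
  note c = smooth2_continuous[OF f]
  show ?thesis unfolding k fourier_coeff_fc1[OF c]
    by (intro fc1_norm_le fc1_param_continuous c continuous_on_pair[OF c] continuous_intros C0_norm_bound[OF f])
qed

lemma C0_norm_le_Cj:
  assumes f: "smooth2 f" and g: "fst \<gamma> + snd \<gamma> \<le> j"
  shows "C0_norm (partial \<gamma> f) \<le> Cj_norm j f"
proof -
  have nn: "0 \<le> C0_norm (partial \<gamma> f)" for \<gamma>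
    using order_trans[OF norm_ge_zero C0_norm_bound[OF smooth2_partial_multi[OF f]]] .
  have "{\<gamma> :: nat \<times> nat. fst \<gamma> + snd \<gamma> \<le> j} \<subseteq> {..j} \<times> {..j}" by auto
  then have "finite {\<gamma> :: nat \<times> nat. fst \<gamma> + snd \<gamma> \<le> j}" using finite_subset by blast
  then show ?thesis unfolding Cj_norm_def using g nn by (intro member_le_sum) auto
qed

text \<open>The floor at 1 includes the zero mode and makes powers of \<open>kmax\<close> increase
  with the exponent.\<close>

definition kmax :: "int \<times> int \<Rightarrow> real" where
  "kmax k = max 1 (max \<bar>of_int (fst k)\<bar> \<bar>of_int (snd k)\<bar>)"

lemma kmax_ge: "1 \<le> kmax k" "\<bar>of_int (fst k)\<bar> \<le> kmax k" "\<bar>of_int (snd k)\<bar> \<le> kmax k"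
  by (auto simp: kmax_def)

text \<open>Fourth derivatives in the direction of the larger index suffice. The factors 2 pi they
  produce are at least 1 and are dropped.\<close>

lemma fourier_coeff_decay:
  assumes f: "smooth2 f"
  shows "norm (fourier_coeff f k) * kmax k ^ 4 \<le> Cj_norm 4 f"
proof -
  obtain k1 k2 where k: "k = (k1, k2)" by force
  let ?c = "norm (fourier_coeff f (k1, k2))"
  have j: "(2 * pi * \<bar>of_int j\<bar>) ^ 4 * ?c \<ge> \<bar>of_int j\<bar> ^ 4 * ?c" for j :: int
  proof (intro mult_right_mono power_mono)
    have "1 * \<bar>of_int j\<bar> \<le> 2 * pi * \<bar>real_of_int j\<bar>" using pi_ge_two by (intro mult_right_mono) auto
    then show "\<bar>of_int j\<bar> \<le> 2 * pi * \<bar>real_of_int j\<bar>" by simp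
  qed auto
  have 1: "?c \<le> Cj_norm 4 f"
    using order_trans[OF fourier_coeff_le_C0[OF f, of "(k1, k2)"]] C0_norm_le_Cj[OF f, of "(0, 0)" 4] by (simp add: partial_def)
  have 2: "\<bar>of_int k2\<bar> ^ 4 * ?c \<le> Cj_norm 4 f"
    using j[of k2] fourier_coeff_le_C0[OF smooth2_partial_pow(1)[OF f, of 4], of "(k1, k2)"] C0_norm_le_Cj[OF f, of "(4, 0)" 4]
    by (simp add: fourier_coeff_partial_pow[OF f] partial_def)
  have 3: "\<bar>of_int k1\<bar> ^ 4 * ?c \<le> Cj_norm 4 f"
    using j[of k1] fourier_coeff_le_C0[OF smooth2_partial_pow(2)[OF f, of 4], of "(k1, k2)"] C0_norm_le_Cj[OF f, of "(0, 4)" 4]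
    by (simp add: fourier_coeff_partial_pow[OF f] partial_def)
  have "kmax k = 1 \<or> kmax k = \<bar>of_int k1\<bar> \<or> kmax k = \<bar>of_int k2\<bar>" by (auto simp: kmax_def k max_def)
  then show ?thesis using 1 2 3 unfolding k by (auto simp: mult.commute)
qed

text \<open>The exponent 4 of the decay is split as \<open>3/2 + 2 * 5/4\<close>: the summand \<open>3/2\<close> compensates the trivial
  bound for the high modes, and the exponents \<open>5/4 > 1\<close> make the weight summable over \<open>\<int>\<^sup>2\<close>.\<close>

definition kwt :: "int \<times> int \<Rightarrow> real" where
  "kwt k = max 1 \<bar>of_int (fst k)\<bar> powr (- 5 / 4) * max 1 \<bar>of_int (snd k)\<bar> powr (- 5 / 4)"

lemma kwt_nonneg: "0 \<le> kwt k" by (simp add: kwt_def)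

lemma kwt_summable: "kwt summable_on UNIV"
proof -
  have "summable (\<lambda>n::nat. max 1 (real n) powr (- 5 / 4))"
  proof (rule summable_comparison_test')
    show "summable (\<lambda>n::nat. real n powr (- 5 / 4))" by (simp add: summable_real_powr_iff)
    show "norm (max 1 (real n) powr (- 5 / 4)) \<le> real n powr (- 5 / 4)" if "n \<ge> 1" for n
      using that by (simp add: max_def)
  qed
  from summable_on_int_abs[OF this]
  have 1: "(\<lambda>k::int. max 1 \<bar>real_of_int k\<bar> powr (- 5 / 4)) summable_on (UNIV :: int set)" by simp
  have "(\<lambda>k. norm (max 1 \<bar>real_of_int (fst k)\<bar> powr (- 5 / 4) * max 1 \<bar>real_of_int (snd k)\<bar> powr (- 5 / 4))) summable_on Sigma UNIV (\<lambda>_. UNIV)"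
    unfolding Infinite_Sum.abs_summable_on_Sigma_iff
    using 1 by (auto simp: norm_mult infsum_cmult_right' abs_mult intro!: summable_on_cmult_right summable_on_cmult_left)
  then show ?thesis unfolding kwt_def[abs_def] by (simp add: abs_mult)
qed

lemma kmax_kwt: "1 \<le> kwt k * kmax k powr (5 / 2)"
proof -
  have *: "1 \<le> x powr (- 5 / 4) * kmax k powr (5 / 4)" if "1 \<le> x" "x \<le> kmax k" for x
  proof -
    have "x powr (5 / 4) \<le> kmax k powr (5 / 4)" using that by (intro powr_mono2) auto
    then have "x powr (- 5 / 4) * x powr (5 / 4) \<le> x powr (- 5 / 4) * kmax k powr (5 / 4)" by (intro mult_left_mono) auto
    moreover have "x powr (- 5 / 4) * x powr (5 / 4) = 1" using that by (simp add: powr_add[symmetric])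
    ultimately show ?thesis by simp
  qed
  have "1 * 1 \<le> (max 1 \<bar>of_int (fst k)\<bar> powr (- 5 / 4) * kmax k powr (5 / 4)) * (max 1 \<bar>of_int (snd k)\<bar> powr (- 5 / 4) * kmax k powr (5 / 4))"
    using kmax_ge[of k] by (intro mult_mono *) auto
  also have "\<dots> = kwt k * (kmax k powr (5 / 4) * kmax k powr (5 / 4))" by (simp add: kwt_def mult_ac)
  also have "kmax k powr (5 / 4) * kmax k powr (5 / 4) = kmax k powr (5 / 2)" by (simp add: powr_add[symmetric])
  finally show ?thesis by simp
qed

lemma kmax_power4: "kmax k ^ 4 = kmax k powr (3 / 2) * kmax k powr (5 / 2)"
proof -
  have "0 < kmax k" using kmax_ge(1)[of k] by linarith
  then show ?thesis by (simp add: powr_add[symmetric] powr_numeral)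
qed

lemma smooth2_wiener2:
  assumes f: "smooth2 f" shows "wiener2 f (fourier_coeff f)"
proof (rule fourier_inversion2)
  show "continuous_on UNIV f" by (rule smooth2_continuous[OF f])
  show "periodic2 f" using f by (simp add: smooth2_def)
  show "(\<lambda>k. norm (fourier_coeff f k)) summable_on UNIV"
  proof (rule summable_on_comparison_test[OF summable_on_cmult_right[OF kwt_summable, of "Cj_norm 4 f"]])
    fix k
    have km: "1 \<le> kmax k" by (rule kmax_ge)
    have C: "0 \<le> Cj_norm 4 f" using order_trans[OF _ fourier_coeff_decay[OF f, of k]] km by simp
    have "norm (fourier_coeff f k) * 1 \<le> norm (fourier_coeff f k) * (kwt k * kmax k powr (5 / 2))"
      by (intro mult_left_mono kmax_kwt) simp
    also have "\<dots> = kwt k * (norm (fourier_coeff f k) * kmax k powr (5 / 2))" by simp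
    also have "\<dots> \<le> kwt k * (norm (fourier_coeff f k) * kmax k ^ 4)"
    proof (intro mult_left_mono)
      have "1 * kmax k powr (5 / 2) \<le> kmax k powr (3 / 2) * kmax k powr (5 / 2)"
        using km by (intro mult_right_mono ge_one_powr_ge_zero) auto
      then show "kmax k powr (5 / 2) \<le> kmax k ^ 4" by (simp add: kmax_power4)
    qed (auto simp: kwt_nonneg)
    also have "\<dots> \<le> kwt k * Cj_norm 4 f" by (intro mult_left_mono fourier_coeff_decay f kwt_nonneg)
    finally show "norm (fourier_coeff f k) \<le> Cj_norm 4 f * kwt k" by (simp add: mult.commute)
  qed simp
qed

section \<open>Cutoffs\<close>

text \<open>One member of the family, with the constants \<open>c\<close> shared by all widths.
  Bounds in terms of \<open>c\<close> thus depend on \<delta> only through explicit powers.\<close>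

definition cutoff1 :: "real \<Rightarrow> (nat \<Rightarrow> real) \<Rightarrow> (real \<Rightarrow> real) \<Rightarrow> bool" where
  "cutoff1 \<delta> c h \<longleftrightarrow> 0 < \<delta> \<and> \<delta> < 1 / 4 \<and> per1 h \<and> (\<forall>k x. (deriv ^^ k) h differentiable (at x)) \<and>
     (\<forall>x\<in>{- \<delta>..\<delta>}. \<forall>m::int. h (x + of_int m) = 0) \<and> (\<forall>x\<in>{2 * \<delta>..1 - 2 * \<delta>}. h x = 1) \<and>
     (\<forall>k x. \<bar>(deriv ^^ k) h x\<bar> \<le> c k / \<delta> ^ k)"

lemma cutoff_family_cutoff1:
  assumes "cutoff_family ct"
  obtains c where "\<And>\<delta>. 0 < \<delta> \<Longrightarrow> \<delta> < 1 / 4 \<Longrightarrow> cutoff1 \<delta> c (ct \<delta>)" "\<And>k. 0 \<le> c k"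
proof -
  note fam = assms[unfolded cutoff_family_def, THEN conjunct1, THEN spec, THEN mp]
  obtain c where c0: "\<forall>\<delta>. 0 < \<delta> \<and> \<delta> < 1/4 \<longrightarrow> (\<forall>k x. \<bar>(deriv ^^ k) (ct \<delta>) x\<bar> \<le> c k / \<delta> ^ k)"
    using assms[unfolded cutoff_family_def, THEN conjunct2] by (rule exE)
  have c: "\<bar>(deriv ^^ k) (ct \<delta>) x\<bar> \<le> c k / \<delta> ^ k" if "0 < \<delta>" "\<delta> < 1 / 4" for \<delta> k x
    using c0[rule_format, of \<delta> k x] that by simp
  have "cutoff1 \<delta> c (ct \<delta>)" if \<delta>: "0 < \<delta>" "\<delta> < 1 / 4" for \<delta>
  proof -
    have one: "ct \<delta> x = 1" if "x \<in> {2 * \<delta>..1 - 2 * \<delta>}" for x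
    proof -
      have "ct \<delta> (x + of_int 0) = 1"
        using fam[of \<delta>, THEN conjunct2, THEN conjunct2, THEN conjunct2] \<delta> that by blast
      then show ?thesis by simp
    qed
    show ?thesis unfolding cutoff1_def per1_def using fam[of \<delta>] \<delta> c[OF \<delta>] one by (intro conjI ballI allI) (simp_all only:)
  qed
  moreover have "0 \<le> c k" for k
  proof -
    \<comment> \<open>The width 1/8 is just one admissible choice, used to read off the
      sign.\<close>
    have "0 \<le> c k / (1 / 8) ^ k" using order_trans[OF abs_ge_zero c[of "1 / 8" k 0]] by simp
    moreover have "0 < (1 / 8 :: real) ^ k" by simp
    ultimately show ?thesis unfolding zero_le_divide_iff by linarith
  qed
  ultimately show thesis by (rule that)
qed

text \<open>On an open interval where the cutoff vanishes identically, so do all its derivatives.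
  This removes the boundary terms in \<open>cft_decay\<close>.\<close>

lemma deriv_pow_zero:
  assumes h: "cutoff1 \<delta> c h" and x: "\<bar>x - of_int m\<bar> < \<delta>"
  shows "(deriv ^^ k) h x = 0"
  using x
proof (induction k arbitrary: x)
  case 0
  then have "x - of_int m \<in> {- \<delta>..\<delta>}" by auto
  then have "h ((x - of_int m) + of_int m) = 0" using h unfolding cutoff1_def by blast
  then show ?case by simp
next
  case (Suc k)
  have "open {y. \<bar>y - of_int m\<bar> < \<delta>}" by (intro open_Collect_less continuous_intros)
  then have "eventually (\<lambda>y. \<bar>y - of_int m\<bar> < \<delta>) (nhds x)"
    using Suc.prems eventually_nhds_in_open by fastforce
  then have "eventually (\<lambda>y. (deriv ^^ k) h y = 0) (nhds x)"
    by eventually_elim (rule Suc.IH)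
  then have "deriv ((deriv ^^ k) h) x = deriv (\<lambda>_. 0) x" by (rule deriv_cong_ev) simp
  then show ?case by simp
qed

definition cft :: "(real \<Rightarrow> real) \<Rightarrow> real \<Rightarrow> complex" where
  "cft h \<xi> = integral {0..1} (\<lambda>t. complex_of_real (h t) * ee (- (\<xi> * t)))"

lemma cutoff1_deriv:
  assumes h: "cutoff1 \<delta> c h"
  shows "((deriv ^^ k) h has_real_derivative (deriv ^^ Suc k) h x) (at x)"
  using h unfolding cutoff1_def by (simp add: DERIV_deriv_iff_real_differentiable)

lemma cutoff1_deriv_continuous:
  assumes h: "cutoff1 \<delta> c h" shows "continuous_on S ((deriv ^^ k) h)"
  by (intro continuous_at_imp_continuous_on ballI DERIV_isCont[OF cutoff1_deriv[OF h]])

text \<open>Integration by parts k times. As all derivatives vanish at 0 and 1, real frequencies are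
  allowed, which the dilated bumps require.\<close>

lemma cft_decay:
  assumes h: "cutoff1 \<delta> c h" shows "\<bar>\<xi>\<bar> ^ k * norm (cft h \<xi>) \<le> c k / \<delta> ^ k"
proof -
  let ?X = "\<lambda>k. cft ((deriv ^^ k) h) \<xi>"
  have \<delta>: "0 < \<delta>" using h by (simp add: cutoff1_def)
  have step: "?X (Suc k) = 2 * pi * \<i> * \<xi> * ?X k" for k
    unfolding cft_def
  proof (rule integral_by_parts_ee)
    show "((\<lambda>t. complex_of_real ((deriv ^^ k) h t)) has_vector_derivative complex_of_real ((deriv ^^ Suc k) h t)) (at t)" for t
      by (rule has_vector_derivative_of_real) (use cutoff1_deriv[OF h] in \<open>simp add: has_real_derivative_iff_has_vector_derivative\<close>)
    show "continuous_on UNIV (\<lambda>t. complex_of_real ((deriv ^^ Suc k) h t))"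
      by (intro continuous_on_of_real cutoff1_deriv_continuous[OF h])
    have "(deriv ^^ k) h 0 = 0" "(deriv ^^ k) h 1 = 0"
      using \<delta> deriv_pow_zero[OF h, of 0 0 k] deriv_pow_zero[OF h, of 1 1 k] by simp_all
    then show "complex_of_real ((deriv ^^ k) h 1) * ee (- \<xi>) = complex_of_real ((deriv ^^ k) h 0)" by simp
  qed
  have pow: "norm (?X k) = (2 * pi * \<bar>\<xi>\<bar>) ^ k * norm (?X 0)" for k
    by (induction k) (simp_all only: step norm_mult, simp_all)
  have bound: "norm (?X k) \<le> c k / \<delta> ^ k"
  proof -
    have "norm (?X k) \<le> integral {0..1} (\<lambda>t::real. c k / \<delta> ^ k)"
      unfolding cft_def
    proof (rule integral_norm_bound_integral)
      show "(\<lambda>t. complex_of_real ((deriv ^^ k) h t) * ee (- (\<xi> * t))) integrable_on {0..1}"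
        by (intro integrable_continuous_real continuous_intros continuous_on_of_real cutoff1_deriv_continuous[OF h])
      show "norm (complex_of_real ((deriv ^^ k) h t) * ee (- (\<xi> * t))) \<le> c k / \<delta> ^ k" for t
        using h by (simp add: norm_mult cutoff1_def)
    qed auto
    then show ?thesis by simp
  qed
  have "\<bar>\<xi>\<bar> ^ k \<le> (2 * pi * \<bar>\<xi>\<bar>) ^ k"
  proof (intro power_mono)
    have "1 * \<bar>\<xi>\<bar> \<le> 2 * pi * \<bar>\<xi>\<bar>" using pi_ge_two by (intro mult_right_mono) auto
    then show "\<bar>\<xi>\<bar> \<le> 2 * pi * \<bar>\<xi>\<bar>" by simp
  qed simp
  then have "\<bar>\<xi>\<bar> ^ k * norm (?X 0) \<le> (2 * pi * \<bar>\<xi>\<bar>) ^ k * norm (?X 0)" by (rule mult_right_mono) simp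
  then show ?thesis using pow[of k] bound by simp
qed

text \<open>\<open>bump\<close> needs a function on the line supported in the unit interval, whereas
  \<open>h\<close> is periodic. One period is kept and extended by zero, continuously because
  \<open>h\<close> vanishes near the integers.\<close>

definition wave :: "(real \<Rightarrow> real) \<Rightarrow> real \<Rightarrow> real \<Rightarrow> complex" where
  "wave h \<kappa> x = (if 0 \<le> x \<and> x \<le> 1 then complex_of_real (h x) * ee (\<kappa> * x) else 0)"

lemma cutoff1_zero: 
  assumes h: "cutoff1 \<delta> c h" and "\<bar>x - of_int m\<bar> \<le> \<delta>" shows "h x = 0"
proof -
  have "x - of_int m \<in> {- \<delta>..\<delta>}" using assms(2) by auto
  then have "h ((x - of_int m) + of_int m) = 0" using h unfolding cutoff1_def by blast
  then show ?thesis by simp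
qed

lemma profile_wave:
  assumes h: "cutoff1 \<delta> c h" shows "profile \<delta> (wave h \<kappa>)"
  unfolding profile_def
proof (intro conjI allI impI)
  have \<delta>: "0 < \<delta>" using h by (simp add: cutoff1_def)
  have z: "h 0 = 0" "h 1 = 0" using cutoff1_zero[OF h, of 0 0] cutoff1_zero[OF h, of 1 1] \<delta> by simp_all
  have cc: "continuous_on S (\<lambda>x. complex_of_real (h x) * ee (\<kappa> * x))" for S
    using cutoff1_deriv_continuous[OF h, of S 0] by (intro continuous_intros continuous_on_of_real) simp
  have "continuous_on ({0..1} \<union> ({..0} \<union> {1..})) (wave h \<kappa>)"
    unfolding wave_def
  proof (rule continuous_on_cases)
    show "\<forall>x. x \<in> {0..1} \<and> \<not> (0 \<le> x \<and> x \<le> 1) \<or> x \<in> {..0} \<union> {1..} \<and> (0 \<le> x \<and> x \<le> 1) \<longrightarrow>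
        complex_of_real (h x) * ee (\<kappa> * x) = 0"
      using z by auto
  qed (auto intro: cc closed_Un)
  moreover have "{0..1} \<union> ({..0} \<union> {1..}) = (UNIV :: real set)" by auto
  ultimately show "continuous_on UNIV (wave h \<kappa>)" by simp
  fix x assume nz: "wave h \<kappa> x \<noteq> 0"
  then have x: "0 \<le> x" "x \<le> 1" "h x \<noteq> 0" by (auto simp: wave_def split: if_splits)
  show "\<delta> < x" using cutoff1_zero[OF h, of x 0] x by (cases "x \<le> \<delta>") auto
  show "x < 1 - \<delta>" using cutoff1_zero[OF h, of x 1] x by (cases "1 - \<delta> \<le> x") auto
qed

lemma cutoff1_le: "cutoff1 \<delta> c h \<Longrightarrow> \<bar>h x\<bar> \<le> c 0"
  unfolding cutoff1_def by (metis (no_types, lifting) div_by_1 funpow_0 power_0)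

lemma wave_le: assumes "cutoff1 \<delta> c h" shows "norm (wave h \<kappa> x) \<le> c 0"
  using cutoff1_le[OF assms, of x] order_trans[OF abs_ge_zero cutoff1_le[OF assms, of x]]
  by (auto simp: wave_def norm_mult)

text \<open>Since \<delta> < 1/4, the point 1/2 lies on the plateau of the cutoff.
  \<open>egorov_cells\<close> uses it to read the sup norm of one factor off that of a
  product.\<close>

lemma wave_half: assumes "cutoff1 \<delta> c h" shows "norm (wave h \<kappa> (1 / 2)) = 1"
proof -
  have "h (1 / 2) = 1" using assms by (simp add: cutoff1_def)
  then show ?thesis by (simp add: wave_def norm_mult)
qed

lemma rft_wave: "rft (wave h \<kappa>) \<xi> = cft h (\<xi> - \<kappa>)"
  unfolding rft_def cft_def
proof (rule integral_cong)
  fix x :: real assume "x \<in> {0..1}"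
  moreover have "\<kappa> * x + - (\<xi> * x) = - ((\<xi> - \<kappa>) * x)" by (simp add: algebra_simps)
  ultimately show "wave h \<kappa> x * ee (- (\<xi> * x)) = complex_of_real (h x) * ee (- ((\<xi> - \<kappa>) * x))"
    by (simp add: wave_def mult.assoc ee_add[symmetric])
qed

lemma quad_decay_wave:
  assumes h: "cutoff1 \<delta> c h" shows "quad_decay (c 0 + c 2 / \<delta> ^ 2) \<kappa> (wave h \<kappa>)"
  unfolding quad_decay_def rft_wave
proof
  fix \<xi>
  have "(1 + (\<xi> - \<kappa>)\<^sup>2) * norm (cft h (\<xi> - \<kappa>)) \<le> c 0 + c 2 / \<delta> ^ 2"
    using cft_decay[OF h, of "\<xi> - \<kappa>" 0] cft_decay[OF h, of "\<xi> - \<kappa>" 2] by (simp add: distrib_right)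
  moreover have "0 < 1 + (\<xi> - \<kappa>)\<^sup>2" by (simp add: add_pos_nonneg)
  ultimately show "norm (cft h (\<xi> - \<kappa>)) \<le> (c 0 + c 2 / \<delta> ^ 2) / (1 + (\<xi> - \<kappa>)\<^sup>2)"
    by (simp add: le_divide_eq mult.commute)
qed

lemma power_add_le:
  assumes "0 \<le> x" "0 \<le> (y::real)" shows "(x + y) ^ p \<le> 2 ^ p * (x ^ p + y ^ p)"
proof -
  have "(x + y) ^ p \<le> (2 * max x y) ^ p" using assms by (intro power_mono) auto
  also have "\<dots> = 2 ^ p * (max x y) ^ p" by (rule power_mult_distrib)
  also have "(max x y) ^ p \<le> x ^ p + y ^ p" using assms by (auto simp: max_def)
  finally show ?thesis by simp
qed

text \<open>Decay is wanted around 0 instead of around \<kappa>. Splitting \<xi> into \<xi> -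
  \<kappa> and \<kappa> costs a power of the mode frequency, which is why the low modes have to be
  limited.\<close>

lemma wave_tail:
  assumes h: "cutoff1 \<delta> c h" and \<kappa>: "\<bar>\<kappa>\<bar> \<le> k" and \<xi>: "\<xi> \<noteq> 0"
  shows "norm (rft (wave h \<kappa>) \<xi>) \<le> (2 ^ p * (c p / \<delta> ^ p + k ^ p * c 0)) / \<bar>\<xi>\<bar> ^ p"
proof -
  let ?x = "norm (cft h (\<xi> - \<kappa>))"
  have "\<bar>\<xi>\<bar> ^ p \<le> (\<bar>\<xi> - \<kappa>\<bar> + \<bar>\<kappa>\<bar>) ^ p" by (intro power_mono) auto
  also have "\<dots> \<le> 2 ^ p * (\<bar>\<xi> - \<kappa>\<bar> ^ p + \<bar>\<kappa>\<bar> ^ p)" by (rule power_add_le) auto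
  finally have "\<bar>\<xi>\<bar> ^ p * ?x \<le> 2 ^ p * (\<bar>\<xi> - \<kappa>\<bar> ^ p + \<bar>\<kappa>\<bar> ^ p) * ?x" by (rule mult_right_mono) simp
  also have "\<dots> = 2 ^ p * (\<bar>\<xi> - \<kappa>\<bar> ^ p * ?x + \<bar>\<kappa>\<bar> ^ p * ?x)" by (simp add: algebra_simps)
  also have "\<dots> \<le> 2 ^ p * (c p / \<delta> ^ p + k ^ p * c 0)"
    using cft_decay[OF h, of "\<xi> - \<kappa>" p] cft_decay[OF h, of "\<xi> - \<kappa>" 0] \<kappa>
    by (intro mult_left_mono add_mono mult_mono power_mono) auto
  finally show ?thesis using \<xi> by (simp add: rft_wave le_divide_eq mult.commute)
qed

text \<open>At most one bump is nonzero at a given point, namely the one of the cell containing it.\<close>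

lemma bump_wave_sum:
  assumes h: "cutoff1 \<delta> c h"
  shows "(\<Sum>m<2 ^ n. ee (of_int k * real m / 2 ^ n) * bump (wave h (of_int k / 2 ^ n)) n m q) =
    complex_of_real (h (2 ^ n * q)) * ee (of_int k * q)"
proof -
  define y where "y = 2 ^ n * frac q"
  define m0 where "m0 = nat \<lfloor>y\<rfloor>"
  have \<delta>: "0 < \<delta>" using h by (simp add: cutoff1_def)
  have y: "0 \<le> y" "y < 2 ^ n" using frac_lt_1[of q] by (auto simp: y_def)
  have m0: "real m0 = of_int \<lfloor>y\<rfloor>" using y by (simp add: m0_def)
  have "real m0 < 2 ^ n" using y unfolding m0 by linarith
  then have m0lt: "m0 < 2 ^ n" using of_nat_less_iff[of m0 "2 ^ n", where 'a = real] by simp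
  let ?W = "wave h (of_int k / 2 ^ n)"
  have z: "bump ?W n m q = 0" if "m \<noteq> m0" for m
  proof -
    have "y - real m \<le> 0 \<or> 1 \<le> y - real m"
    proof -
      have "real m + 1 \<le> of_int \<lfloor>y\<rfloor> \<or> of_int \<lfloor>y\<rfloor> + 1 \<le> real m"
        using that m0 by (metis Suc_eq_plus1 Suc_leI linorder_neqE_nat of_nat_1 of_nat_add of_nat_le_iff)
      then show ?thesis by linarith
    qed
    then show ?thesis unfolding bump_def y_def[symmetric] using \<delta> by (intro profile_zero[OF profile_wave[OF h]]) auto
  qed
  have "(\<Sum>m<2 ^ n. ee (of_int k * real m / 2 ^ n) * bump ?W n m q) = ee (of_int k * real m0 / 2 ^ n) * bump ?W n m0 q"
    by (rule sum.mono_neutral_right[of "{..<2 ^ n}" "{m0}", simplified]) (use z m0lt in auto)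
  also have "bump ?W n m0 q = complex_of_real (h (y - real m0)) * ee (of_int k / 2 ^ n * (y - real m0))"
  proof -
    have "0 \<le> y - real m0" "y - real m0 \<le> 1" unfolding m0 by linarith+
    then show ?thesis by (simp add: bump_def y_def[symmetric] wave_def)
  qed
  also have "h (y - real m0) = h (2 ^ n * q)"
  proof -
    have "y - real m0 = 2 ^ n * q - of_int (2 ^ n * \<lfloor>q\<rfloor> + \<lfloor>y\<rfloor>)"
      by (simp add: m0 y_def frac_def algebra_simps)
    moreover have "per1 h" using h by (simp add: cutoff1_def)
    ultimately show ?thesis using per1_diff_int by metis
  qed
  also have "ee (of_int k * real m0 / 2 ^ n) * (complex_of_real (h (2 ^ n * q)) * ee (of_int k / 2 ^ n * (y - real m0))) =
     complex_of_real (h (2 ^ n * q)) * (ee (of_int k * real m0 / 2 ^ n) * ee (of_int k / 2 ^ n * (y - real m0)))"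
    by simp
  \<comment> \<open>The weight of a cell restores the phase at its left end, and the local wave of
    frequency k / 2^n supplies the rest, so the pieces join to the global wave.\<close>
  also have "ee (of_int k * real m0 / 2 ^ n) * ee (of_int k / 2 ^ n * (y - real m0)) = ee (of_int k * frac q)"
    unfolding ee_add[symmetric] by (simp add: y_def field_simps)
  also have "ee (of_int k * frac q) = ee (of_int k * q)"
    by (rule ee_int_cong[where m = "- k * \<lfloor>q\<rfloor>"]) (simp add: frac_def algebra_simps)
  finally show ?thesis .
qed

section \<open>The Egorov estimate\<close>

text \<open>What the superposition needs from one Fourier mode: \<open>F\<close> is the symbol
  before and \<open>G\<close> the one after \<open>n\<close> steps, \<open>E\<close> the error from
  the tails, \<open>S\<close> the trivial bound, and \<open>R\<close> a coefficient sum common to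
  all modes. Both signs of time share this interface.\<close>

definition modes :: "nat \<Rightarrow> nat \<Rightarrow> real \<Rightarrow> real \<Rightarrow> real \<Rightarrow> (real \<times> real \<Rightarrow> complex) \<Rightarrow> (real \<times> real \<Rightarrow> complex) \<Rightarrow> bool" where
  "modes M n E S R F G \<longleftrightarrow>
     (\<forall>x\<in>fund_dom. G ((baker ^^ n) x) = F x) \<and> (\<forall>x. F (torus_rep x) = F x \<and> G (torus_rep x) = G x) \<and>
     op_bound (2 * M) (qpow M n * weyl_op (2 * M) F - weyl_op (2 * M) G * qpow M n) E \<and>
     op_bound (2 * M) (weyl_op (2 * M) F) S \<and> op_bound (2 * M) (weyl_op (2 * M) G) S \<and>
     (\<exists>c. wiener2 F c \<and> (\<Sum>\<^sub>\<infinity>k. norm (c k)) \<le> R) \<and> (\<exists>c. wiener2 G c \<and> (\<Sum>\<^sub>\<infinity>k. norm (c k)) \<le> R)"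

context bump_pair
begin

text \<open>Whichever of \<open>F\<close> and \<open>G\<close> is given explicitly supplies the sup
  bound. The other inherits it along the map, which is a bijection of the fundamental
  domain.\<close>

lemma modes_cells:
  fixes i l :: "nat \<Rightarrow> nat"
  assumes lk: "\<And>m. m < 2 ^ n \<Longrightarrow> linked n 0 0 (i m) 0 0 (l m)" and \<phi>: "\<And>m. cmod (\<phi> m) \<le> 1"
    and F: "F = (\<lambda>x. \<Sum>m<2 ^ n. \<phi> m * cell n 0 (i m) 0 x)" and G: "G = (\<lambda>x. \<Sum>m<2 ^ n. \<phi> m * cell 0 n 0 (l m) x)"
    and S: "(\<forall>x. cmod (F x) \<le> S) \<or> (\<forall>x. cmod (G x) \<le> S)"
    and one: "cmod (W (1 / 2)) = 1" "cmod (W' (1 / 2)) = 1"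
  shows "modes M n (2 ^ n * (real n * err n)) (S * (3 * lattice_sum * A)) (2 ^ n * (2 ^ n * (3 * lattice_sum * A)\<^sup>2)) F G"
proof -
  have GF: "G ((baker ^^ n) x) = F x" if "x \<in> fund_dom" for x
    unfolding F G by (rule sum.cong[OF refl]) (use lk that in \<open>auto simp: linked_def\<close>)
  have ct: "cell r t a b (torus_rep x) = cell r t a b x" for r t a b x
    by (cases x) (simp add: cell_def tens_def torus_rep_def bump_def)
  have per: "F (torus_rep x) = F x" "G (torus_rep x) = G x" for x
    unfolding F G by (simp_all add: ct)
  have "(\<forall>x. cmod (F x) \<le> S) \<and> (\<forall>x. cmod (G x) \<le> S)"
    using S
  proof
    assume *: "\<forall>x. cmod (F x) \<le> S"
    have "cmod (G x) \<le> S" for x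
    proof -
      let ?y = "(inv_into fund_dom baker ^^ n) (torus_rep x)"
      have "G x = F ?y" using GF[of ?y] baker_inv_iter[OF torus_rep_fund_dom, of n x] per(2) by metis
      then show ?thesis using spec[OF *, of ?y] by (simp only:)
    qed
    then show ?thesis using * by simp
  next
    assume *: "\<forall>x. cmod (G x) \<le> S"
    have "cmod (F x) \<le> S" for x
      using GF[OF torus_rep_fund_dom, of x] per(1)[of x] * by metis
    then show ?thesis using * by simp
  qed
  then have S': "\<And>x. cmod (F x) \<le> S" "\<And>x. cmod (G x) \<le> S" by auto
  show ?thesis
    using egorov_cells[OF lk \<phi> F G S' one] GF per by (simp add: modes_def)
qed

end

definition egorov_tail :: "(nat \<Rightarrow> real) \<Rightarrow> real \<Rightarrow> nat \<Rightarrow> real \<Rightarrow> real" where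
  "egorov_tail c \<delta> L K = 2 ^ (L + 2) * (c (L + 2) / \<delta> ^ (L + 2) + K ^ (L + 2) * c 0)"

text \<open>There are 2^n cells with n steps each; what remains is \<open>err n\<close> for two
  waves of frequency at most \<open>K\<close>.\<close>

definition egorov_err :: "(nat \<Rightarrow> real) \<Rightarrow> real \<Rightarrow> nat \<Rightarrow> nat \<Rightarrow> nat \<Rightarrow> real \<Rightarrow> real" where
  "egorov_err c \<delta> M L n K = 2 ^ n * (real n * (8 * c 0 * lattice_sum * egorov_tail c \<delta> L K * 2 ^ n * (2 ^ n / (4 * real M * \<delta>)) ^ L))"

lemma bump_pair_wave:
  assumes h: "cutoff1 \<delta> c h" and c: "\<And>k. 0 \<le> c k" and M: "M > 0" and \<kappa>: "\<bar>\<kappa>\<bar> \<le> K" "\<bar>\<kappa>'\<bar> \<le> K"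
  shows "bump_pair M \<delta> (c 0) (c 0 + c 2 / \<delta> ^ 2) \<kappa> \<kappa>' (egorov_tail c \<delta> L K) L (wave h \<kappa>) (wave h \<kappa>')"
proof
  have \<delta>: "0 < \<delta>" "\<delta> < 1 / 4" using h by (auto simp: cutoff1_def)
  show "0 < \<delta>" "\<delta> \<le> 1 / 4" using \<delta> by auto
  show "0 \<le> egorov_tail c \<delta> L K" using c \<delta> \<kappa> by (auto simp: egorov_tail_def intro!: add_nonneg_nonneg mult_nonneg_nonneg)
  show "norm (rft (wave h \<kappa>) \<xi>) \<le> egorov_tail c \<delta> L K / \<bar>\<xi>\<bar> ^ (L + 2)" if "\<xi> \<noteq> 0" for \<xi>
    unfolding egorov_tail_def by (rule wave_tail[OF h \<kappa>(1) that])
  show "norm (rft (wave h \<kappa>') \<xi>) \<le> egorov_tail c \<delta> L K / \<bar>\<xi>\<bar> ^ (L + 2)" if "\<xi> \<noteq> 0" for \<xi>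
    unfolding egorov_tail_def by (rule wave_tail[OF h \<kappa>(2) that])
qed (use M profile_wave[OF h] wave_le[OF h] quad_decay_wave[OF h] in auto)

lemma abs_int_div_le: "\<bar>real_of_int j / 2 ^ n\<bar> \<le> \<bar>of_int j\<bar>"
proof -
  have "\<bar>real_of_int j\<bar> / 2 ^ n \<le> \<bar>real_of_int j\<bar> / 1" by (intro divide_left_mono) auto
  then show ?thesis by (simp add: abs_divide)
qed

lemma bump_wave_0: "cutoff1 \<delta> c h \<Longrightarrow> bump (wave h (of_int k)) 0 0 p = complex_of_real (h p) * ee (of_int k * p)"
  using bump_wave_sum[of \<delta> c h k 0 p] by simp

lemma modes_forward:
  assumes h: "cutoff1 \<delta> c h" and c: "\<And>k. 0 \<le> c k" and M: "M > 0"
  shows "\<exists>G. modes M n (egorov_err c \<delta> M L n (kmax k)) ((c 0)\<^sup>2 * (3 * lattice_sum * (c 0 + c 2 / \<delta> ^ 2)))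
      (2 ^ n * (2 ^ n * (3 * lattice_sum * (c 0 + c 2 / \<delta> ^ 2))\<^sup>2))
      (\<lambda>x. ee (fst x * of_int (snd k) - snd x * of_int (fst k)) * complex_of_real (h (2 ^ n * fst x) * h (snd x))) G"
proof -
  define k1 where "k1 = fst k" define k2 where "k2 = snd k"
  \<comment> \<open>Position is cut into 2^n cells, so in the coordinate of a cell the wave has
    frequency k2 / 2^n. Momentum is uncut, and its sign comes from the symplectic phase.\<close>
  let ?\<kappa> = "of_int k2 / 2 ^ n" and ?\<kappa>' = "of_int (- k1)"
  from abs_int_div_le[of k2 n] have \<kappa>: "\<bar>?\<kappa>\<bar> \<le> kmax k" "\<bar>?\<kappa>'\<bar> \<le> kmax k" using kmax_ge[of k] by (auto simp: k1_def k2_def)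
  interpret bump_pair M \<delta> "c 0" "c 0 + c 2 / \<delta> ^ 2" ?\<kappa> ?\<kappa>' "egorov_tail c \<delta> L (kmax k)" L "wave h ?\<kappa>" "wave h ?\<kappa>'"
    by (rule bump_pair_wave[OF h c M \<kappa>])
  have "\<exists>l. linked n 0 0 m 0 0 l" if m: "m < 2 ^ n" for m
  proof -
    obtain i' l' where "linked n 0 0 m 0 i' l'" using linked_forward[of m 0 n 0 0] m by auto
    moreover from this have "i' = 0" unfolding linked_def by simp
    ultimately show ?thesis by auto
  qed
  then obtain l where l: "\<And>m. m < 2 ^ n \<Longrightarrow> linked n 0 0 m 0 0 (l m)" by metis
  let ?\<phi> = "\<lambda>m. ee (of_int k2 * real m / 2 ^ n)"
  let ?F = "\<lambda>x. \<Sum>m<2 ^ n. ?\<phi> m * cell n 0 m 0 x" and ?G = "\<lambda>x. \<Sum>m<2 ^ n. ?\<phi> m * cell 0 n 0 (l m) x"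
  let ?H = "\<lambda>x. ee (fst x * of_int k2 - snd x * of_int k1) * complex_of_real (h (2 ^ n * fst x) * h (snd x))"
  have H: "?H = ?F"
  proof
    fix x
    have "?F x = (\<Sum>m<2 ^ n. ?\<phi> m * bump (wave h ?\<kappa>) n m (fst x)) * bump (wave h ?\<kappa>') 0 0 (snd x)"
      unfolding cell_def tens_def by (simp add: case_prod_unfold sum_distrib_right mult.assoc)
    also have "\<dots> = complex_of_real (h (2 ^ n * fst x) * h (snd x)) * (ee (of_int k2 * fst x) * ee (of_int (- k1) * snd x))"
      unfolding bump_wave_sum[OF h] bump_wave_0[OF h] by (simp add: mult_ac)
    also have "ee (of_int k2 * fst x) * ee (of_int (- k1) * snd x) = ee (fst x * of_int k2 - snd x * of_int k1)"
      unfolding ee_add[symmetric] by (simp add: algebra_simps)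
    finally show "?H x = ?F x" by (simp only: mult_ac)
  qed
  have S: "cmod (?H x) \<le> (c 0)\<^sup>2" for x
  proof -
    have "cmod (?H x) = \<bar>h (2 ^ n * fst x)\<bar> * \<bar>h (snd x)\<bar>" by (simp add: norm_mult abs_mult)
    also have "\<dots> \<le> c 0 * c 0" using c by (intro mult_mono cutoff1_le[OF h]) auto
    finally show ?thesis by (simp add: power2_eq_square)
  qed
  have "modes M n (2 ^ n * (real n * err n)) ((c 0)\<^sup>2 * (3 * lattice_sum * (c 0 + c 2 / \<delta> ^ 2)))
      (2 ^ n * (2 ^ n * (3 * lattice_sum * (c 0 + c 2 / \<delta> ^ 2))\<^sup>2)) ?H ?G"
    by (rule modes_cells[OF l _ H refl]) (use S wave_half[OF h] in auto)
  moreover have "2 ^ n * (real n * err n) = egorov_err c \<delta> M L n (kmax k)" unfolding err_def egorov_err_def ..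
  ultimately show ?thesis unfolding k1_def[symmetric] k2_def[symmetric] by (intro exI[of _ ?G]) (simp only:)
qed

text \<open>For negative times the good part lives on momentum strips. It is taken as the target of
  \<open>n\<close> forward steps, and the sources of its cells are found by
  \<open>linked_backward\<close>.\<close>

lemma modes_backward:
  assumes h: "cutoff1 \<delta> c h" and c: "\<And>k. 0 \<le> c k" and M: "M > 0"
  shows "\<exists>F. modes M n (egorov_err c \<delta> M L n (kmax k)) ((c 0)\<^sup>2 * (3 * lattice_sum * (c 0 + c 2 / \<delta> ^ 2)))
      (2 ^ n * (2 ^ n * (3 * lattice_sum * (c 0 + c 2 / \<delta> ^ 2))\<^sup>2)) F
      (\<lambda>x. ee (fst x * of_int (snd k) - snd x * of_int (fst k)) * complex_of_real (h (2 ^ n * snd x) * h (fst x)))"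
proof -
  define k1 where "k1 = fst k" define k2 where "k2 = snd k"
  let ?\<kappa> = "of_int k2" and ?\<kappa>' = "of_int (- k1) / 2 ^ n"
  from abs_int_div_le[of "- k1" n] have \<kappa>: "\<bar>?\<kappa>\<bar> \<le> kmax k" "\<bar>?\<kappa>'\<bar> \<le> kmax k" using kmax_ge[of k] by (auto simp: k1_def k2_def)
  interpret bump_pair M \<delta> "c 0" "c 0 + c 2 / \<delta> ^ 2" ?\<kappa> ?\<kappa>' "egorov_tail c \<delta> L (kmax k)" L "wave h ?\<kappa>" "wave h ?\<kappa>'"
    by (rule bump_pair_wave[OF h c M \<kappa>])
  have "\<exists>i. linked n 0 0 i 0 0 m" if m: "m < 2 ^ n" for m
  proof -
    obtain i l where "linked n 0 0 i l 0 m" using linked_backward[of 0 0 m 0 n] m by auto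
    moreover from this have "l = 0" unfolding linked_def by simp
    ultimately show ?thesis by auto
  qed
  then obtain i where i: "\<And>m. m < 2 ^ n \<Longrightarrow> linked n 0 0 (i m) 0 0 m" by metis
  let ?\<phi> = "\<lambda>m. ee (of_int (- k1) * real m / 2 ^ n)"
  let ?F = "\<lambda>x. \<Sum>m<2 ^ n. ?\<phi> m * cell n 0 (i m) 0 x" and ?G = "\<lambda>x. \<Sum>m<2 ^ n. ?\<phi> m * cell 0 n 0 m x"
  let ?H = "\<lambda>x. ee (fst x * of_int k2 - snd x * of_int k1) * complex_of_real (h (2 ^ n * snd x) * h (fst x))"
  have H: "?H = ?G"
  proof
    fix x
    have "?G x = bump (wave h ?\<kappa>) 0 0 (fst x) * (\<Sum>m<2 ^ n. ?\<phi> m * bump (wave h ?\<kappa>') n m (snd x))"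
      unfolding cell_def tens_def by (simp add: case_prod_unfold sum_distrib_left mult_ac)
    also have "\<dots> = complex_of_real (h (2 ^ n * snd x) * h (fst x)) * (ee (of_int k2 * fst x) * ee (of_int (- k1) * snd x))"
      unfolding bump_wave_sum[OF h] bump_wave_0[OF h] by (simp add: mult_ac)
    also have "ee (of_int k2 * fst x) * ee (of_int (- k1) * snd x) = ee (fst x * of_int k2 - snd x * of_int k1)"
      unfolding ee_add[symmetric] by (simp add: algebra_simps)
    finally show "?H x = ?G x" by (simp only: mult_ac)
  qed
  have S: "cmod (?H x) \<le> (c 0)\<^sup>2" for x
  proof -
    have "cmod (?H x) = \<bar>h (2 ^ n * snd x)\<bar> * \<bar>h (fst x)\<bar>" by (simp add: norm_mult abs_mult)
    also have "\<dots> \<le> c 0 * c 0" using c by (intro mult_mono cutoff1_le[OF h]) auto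
    finally show ?thesis by (simp add: power2_eq_square)
  qed
  have "modes M n (2 ^ n * (real n * err n)) ((c 0)\<^sup>2 * (3 * lattice_sum * (c 0 + c 2 / \<delta> ^ 2)))
      (2 ^ n * (2 ^ n * (3 * lattice_sum * (c 0 + c 2 / \<delta> ^ 2))\<^sup>2)) ?F ?H"
    by (rule modes_cells[OF i _ refl H]) (use S wave_half[OF h] in auto)
  moreover have "2 ^ n * (real n * err n) = egorov_err c \<delta> M L n (kmax k)" unfolding err_def egorov_err_def ..
  ultimately show ?thesis unfolding k1_def[symmetric] k2_def[symmetric] by (intro exI[of _ ?F]) (simp only:)
qed

text \<open>For each mode \<open>e\<close> may dominate either the error from the tails or the
  trivial bound \<open>2 * S\<close> for P A - B P. The choice can vary from mode to mode.\<close>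

lemma modes_superpose:
  fixes E :: "int \<times> int \<Rightarrow> real"
  assumes M: "M > 0" and md: "\<And>k. modes M n (E k) S R (F k) (G k)"
    and a: "(\<lambda>k. norm (\<alpha> k)) summable_on UNIV"
    and FF: "\<And>x. ((\<lambda>k. \<alpha> k * F k x) has_sum FF x) UNIV" and GG: "\<And>x. ((\<lambda>k. \<alpha> k * G k x) has_sum GG x) UNIV"
    and e: "\<And>k. E k \<le> e k \<or> 2 * S \<le> e k"
    and T: "\<And>k. norm (\<alpha> k) * e k \<le> t k" "t summable_on UNIV" "infsum t UNIV \<le> T"
  shows "op_bound (2 * M) (qpow M n * weyl_op (2 * M) FF - weyl_op (2 * M) GG * qpow M n) T"
proof (rule op_bound_has_sum[where B = "\<lambda>k. \<alpha> k \<cdot>\<^sub>m (qpow M n * weyl_op (2 * M) (F k) - weyl_op (2 * M) (G k) * qpow M n)" and b = t])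
  let ?N = "2 * M" and ?P = "qpow M n"
  show "?P * weyl_op ?N FF - weyl_op ?N GG * ?P \<in> carrier_mat ?N ?N"
    by (rule minus_carrier_mat[OF mult_carrier_mat[OF weyl_op_carrier qpow_carrier(1)]])
  show "op_bound ?N (\<alpha> k \<cdot>\<^sub>m (?P * weyl_op ?N (F k) - weyl_op ?N (G k) * ?P)) (t k)" for k
  proof -
    have 1: "op_bound ?N (?P * weyl_op ?N (F k) - weyl_op ?N (G k) * ?P) (E k)" using md[of k] by (simp add: modes_def)
    have "op_bound ?N (?P * weyl_op ?N (F k) - weyl_op ?N (G k) * ?P) (1 * S + S * 1)"
      using md[of k] by (intro op_bound_minus op_bound_mult op_bound_qpow(1)[OF M]) (simp_all add: modes_def)
    then have "op_bound ?N (?P * weyl_op ?N (F k) - weyl_op ?N (G k) * ?P) (e k)"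
      using 1 e[of k] op_bound_mono by auto
    from op_bound_mono[OF op_bound_smult[OF this] T(1)] show ?thesis .
  qed
  have "\<exists>c. wiener2 (F k) c \<and> (\<Sum>\<^sub>\<infinity>j. norm (c j)) \<le> R" for k using md[of k] by (simp add: modes_def)
  then obtain c where c: "\<And>k. wiener2 (F k) (c k)" "\<And>k. (\<Sum>\<^sub>\<infinity>j. norm (c k j)) \<le> R" by metis
  have "\<exists>c. wiener2 (G k) c \<and> (\<Sum>\<^sub>\<infinity>j. norm (c j)) \<le> R" for k using md[of k] by (simp add: modes_def)
  then obtain d where d: "\<And>k. wiener2 (G k) (d k)" "\<And>k. (\<Sum>\<^sub>\<infinity>j. norm (d k j)) \<le> R" by metis
  show "((\<lambda>k. (\<alpha> k \<cdot>\<^sub>m (?P * weyl_op ?N (F k) - weyl_op ?N (G k) * ?P)) $$ (i', j')) has_sum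
      (?P * weyl_op ?N FF - weyl_op ?N GG * ?P) $$ (i', j')) UNIV" if "i' < ?N" "j' < ?N" for i' j'
    by (rule commutator_has_sum[OF qpow_carrier(1) weyl_op_carrier weyl_op_carrier weyl_op_carrier weyl_op_carrier
        wiener2_comb(3)[OF c a FF] wiener2_comb(3)[OF d a GG] that])
qed (use T in auto)

section \<open>Choice of exponents\<close>

text \<open>With \<open>K = N powr (2 \<epsilon> / 3)\<close> the factor \<open>K powr (3 / 2)\<close> absorbs the trivial bound for the modes beyond \<open>K\<close>,
  while \<open>K\<close> stays below \<open>N powr (3 \<epsilon> / 4)\<close>, up to which the modes are smooth on the scale of the cells.\<close>

lemma egorov_numerics:
  fixes c :: "nat \<Rightarrow> real"
  assumes c: "\<And>k. 0 \<le> c k" and \<epsilon>: "\<epsilon> > 0" and L: "48 / \<epsilon> + 22 \<le> real L"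
    and N: "N = real (2 * M)" "1 \<le> N" "8 * c 0 * lattice_sum * 2 ^ (L + 2) * (c (L + 2) + c 0) \<le> N"
    and \<delta>: "0 < \<delta>" "N powr (- \<epsilon> / 4) \<le> \<delta>" and n: "2 ^ n \<le> N powr (1 - \<epsilon>)"
    and D: "D = 1 + 6 * (c 0)\<^sup>2 * lattice_sum * (c 0 + c 2)"
  obtains e where "egorov_err c \<delta> M L n (kmax k) \<le> e \<or> 2 * ((c 0)\<^sup>2 * (3 * lattice_sum * (c 0 + c 2 / \<delta> ^ 2))) \<le> e"
    "e \<le> N powr (- \<epsilon> / 2) * D * kwt k * kmax k ^ 4"
proof -
  let ?K = "kmax k"
  have K1: "1 \<le> ?K" by (rule kmax_ge)
  have N0: "0 < N" using N by linarith
  have lattice_sum: "0 \<le> lattice_sum" by (rule lattice_sum_nonneg)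
  have D1: "1 \<le> D" using c lattice_sum by (simp add: D)
  have d1: "1 / \<delta> \<le> N powr (\<epsilon> / 4)"
  proof -
    have "1 / \<delta> \<le> 1 / N powr (- \<epsilon> / 4)" using \<delta> N0 by (intro divide_left_mono) auto
    then show ?thesis by (simp add: powr_minus_divide)
  qed
  have dp: "1 / \<delta> ^ p \<le> N powr (real p * \<epsilon> / 4)" for p
  proof -
    have "(1 / \<delta>) ^ p \<le> (N powr (\<epsilon> / 4)) ^ p" using \<delta> d1 by (intro power_mono) auto
    also have "\<dots> = N powr (real p * \<epsilon> / 4)" using N0 by (simp add: powr_power mult.commute)
    finally show ?thesis by (simp add: power_one_over)
  qed
  have kw: "1 \<le> kwt k * ?K powr (5 / 2)" by (rule kmax_kwt)
  show thesis
  proof (cases "?K \<le> N powr (2 * \<epsilon> / 3)")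
    case True
    have Kp: "?K ^ p \<le> N powr (real p * (2 * \<epsilon> / 3))" for p
    proof -
      have "?K ^ p \<le> (N powr (2 * \<epsilon> / 3)) ^ p" using True K1 by (intro power_mono) auto
      also have "\<dots> = N powr (real p * (2 * \<epsilon> / 3))" using N0 by (simp add: powr_power mult.commute)
      finally show ?thesis .
    qed
    let ?p = "L + 2"
    let ?q = "real ?p * (2 * \<epsilon> / 3)"
    \<comment> \<open>The inverse width is at most N^(\<epsilon>/4), hence below N^(2\<epsilon>/3),
      so one power of N covers the cutoff and the wave together.\<close>
    have t: "egorov_tail c \<delta> L ?K \<le> 2 ^ ?p * (c ?p + c 0) * N powr ?q"
    proof -
      have "1 / \<delta> ^ ?p \<le> N powr ?q"
      proof -
        have "N powr (real ?p * \<epsilon> / 4) \<le> N powr ?q" using N \<epsilon> by (intro powr_mono) (auto simp: field_simps)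
        then show ?thesis using dp[of ?p] by linarith
      qed
      then have "c ?p * (1 / \<delta> ^ ?p) + ?K ^ ?p * c 0 \<le> c ?p * N powr ?q + N powr ?q * c 0"
        using c Kp[of ?p] by (intro add_mono mult_left_mono mult_right_mono) auto
      then have "2 ^ ?p * (c ?p / \<delta> ^ ?p + ?K ^ ?p * c 0) \<le> 2 ^ ?p * (c ?p * N powr ?q + N powr ?q * c 0)"
        by (intro mult_left_mono) auto
      then show ?thesis by (simp only: egorov_tail_def distrib_left distrib_right mult_ac)
    qed
    have t0: "0 \<le> egorov_tail c \<delta> L ?K" using c \<delta> K1 by (simp add: egorov_tail_def)
    have nN: "2 ^ n \<le> N"
    proof -
      have "N powr (1 - \<epsilon>) \<le> N powr 1" using N \<epsilon> by (intro powr_mono) auto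
      then show ?thesis using n N0 by simp
    qed
    have nn: "real n \<le> N" using nN of_nat_less_two_power[of n, where 'a = real] by linarith
    \<comment> \<open>The time bound gives N^(-\<epsilon>) and the width gives back
      N^(\<epsilon>/4). The net gain 3\<epsilon>/4 per power must exceed the loss 2\<epsilon>/3 from
      the frequency.\<close>
    have r: "2 ^ n / (4 * real M * \<delta>) \<le> N powr (- (3 * \<epsilon> / 4))"
    proof -
      have "2 ^ n / (4 * real M * \<delta>) = (2 ^ n / (2 * N)) * (1 / \<delta>)" using N by simp
      also have "\<dots> \<le> (N powr (1 - \<epsilon>) / N) * N powr (\<epsilon> / 4)"
        using n N0 d1 \<delta> by (intro mult_mono frac_le) auto
      also have "N powr (1 - \<epsilon>) / N = N powr (- \<epsilon>)" using N0 by (simp add: powr_diff powr_minus_divide)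
      also have "N powr (- \<epsilon>) * N powr (\<epsilon> / 4) = N powr (- (3 * \<epsilon> / 4))" by (simp add: powr_add[symmetric])
      finally show ?thesis .
    qed
    have rL: "(2 ^ n / (4 * real M * \<delta>)) ^ L \<le> N powr (- (3 * \<epsilon> / 4) * real L)"
    proof -
      have "(2 ^ n / (4 * real M * \<delta>)) ^ L \<le> (N powr (- (3 * \<epsilon> / 4))) ^ L" using r \<delta> by (intro power_mono) auto
      then show ?thesis using N0 by (simp add: powr_power mult_ac)
    qed
    have rL0: "0 \<le> (2 ^ n / (4 * real M * \<delta>)) ^ L" using \<delta> by simp
    let ?C = "8 * c 0 * lattice_sum * 2 ^ ?p * (c ?p + c 0)"
    have "egorov_err c \<delta> M L n ?K \<le> N * (N * (8 * c 0 * lattice_sum * (2 ^ ?p * (c ?p + c 0) * N powr ?q) * N * N powr (- (3 * \<epsilon> / 4) * real L)))"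
      unfolding egorov_err_def using nN nn t t0 rL rL0 N0 c lattice_sum by (intro mult_mono mult_nonneg_nonneg) auto
    also have "\<dots> = ?C * (N powr 3 * N powr ?q * N powr (- (3 * \<epsilon> / 4) * real L))"
      using N0 by (simp add: powr_numeral power3_eq_cube)
    \<comment> \<open>Here everything that depends on \<open>L\<close>, and so on \<epsilon>, is
      absorbed by one factor N. The three other factors N bound 2^n twice and n once.\<close>
    also have "\<dots> \<le> N * (N powr 3 * N powr ?q * N powr (- (3 * \<epsilon> / 4) * real L))"
      using N by (intro mult_right_mono) auto
    also have "\<dots> = N powr 1 * (N powr 3 * N powr ?q * N powr (- (3 * \<epsilon> / 4) * real L))"
      using N0 by simp
    also have "\<dots> = N powr (1 + 3 + ?q + - (3 * \<epsilon> / 4) * real L)"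
      by (simp only: powr_add mult.assoc)
    also have "\<dots> \<le> N powr (- \<epsilon> / 2)"
    proof (rule powr_mono)
      \<comment> \<open>The exponent condition 4 + (2\<epsilon>/3)(L + 2) - (3\<epsilon>/4) L \<le>
        -\<epsilon>/2, multiplied by 12; this is the origin of the lower bound on
        \<open>L\<close>.\<close>
      have "48 + 22 * \<epsilon> \<le> \<epsilon> * real L" using L \<epsilon> mult_left_mono[OF L, of \<epsilon>] by (simp add: distrib_left)
      then show "1 + 3 + ?q + - (3 * \<epsilon> / 4) * real L \<le> - \<epsilon> / 2" by (simp add: field_simps)
    qed (use N in simp)
    also have "N powr (- \<epsilon> / 2) * 1 \<le> N powr (- \<epsilon> / 2) * (D * (kwt k * ?K ^ 4))"
    proof (intro mult_left_mono)
      have "1 * ?K powr (5 / 2) \<le> ?K powr (3 / 2) * ?K powr (5 / 2)"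
        using K1 by (intro mult_right_mono ge_one_powr_ge_zero) auto
      then have "kwt k * ?K powr (5 / 2) \<le> kwt k * ?K ^ 4" by (intro mult_left_mono kwt_nonneg) (simp add: kmax_power4)
      then have "1 * 1 \<le> D * (kwt k * ?K ^ 4)" using kw D1 by (intro mult_mono) auto
      then show "1 \<le> D * (kwt k * ?K ^ 4)" by simp
    qed simp
    finally have "egorov_err c \<delta> M L n ?K \<le> N powr (- \<epsilon> / 2) * D * kwt k * ?K ^ 4" by (simp add: mult.assoc)
    then show thesis by (intro that[of "egorov_err c \<delta> M L n ?K"]) auto
  next
    case False
    have "2 * ((c 0)\<^sup>2 * (3 * lattice_sum * (c 0 + c 2 / \<delta> ^ 2))) \<le> 2 * ((c 0)\<^sup>2 * (3 * lattice_sum * ((c 0 + c 2) * N powr (\<epsilon> / 2))))"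
    proof -
      have "c 2 * (1 / \<delta> ^ 2) \<le> c 2 * N powr (\<epsilon> / 2)" using dp[of 2] c by (intro mult_left_mono) auto
      moreover have "c 0 * 1 \<le> c 0 * N powr (\<epsilon> / 2)" using c N \<epsilon> by (intro mult_left_mono ge_one_powr_ge_zero) auto
      ultimately have "c 0 + c 2 / \<delta> ^ 2 \<le> (c 0 + c 2) * N powr (\<epsilon> / 2)" by (simp add: distrib_right)
      then show ?thesis using lattice_sum by (intro mult_left_mono) auto
    qed
    also have "\<dots> = (6 * (c 0)\<^sup>2 * lattice_sum * (c 0 + c 2)) * N powr (\<epsilon> / 2)" by simp
    also have "\<dots> \<le> D * N powr (\<epsilon> / 2)" by (intro mult_right_mono) (auto simp: D)
    also have "N powr (\<epsilon> / 2) = N powr (- \<epsilon> / 2) * N powr \<epsilon>" by (simp add: powr_add[symmetric])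
    also have "D * (N powr (- \<epsilon> / 2) * N powr \<epsilon>) \<le> D * (N powr (- \<epsilon> / 2) * (kwt k * ?K ^ 4))"
    proof (intro mult_left_mono)
      \<comment> \<open>The trivial bound loses N^(\<epsilon>/2) through the squared width while
        N^(-\<epsilon>/2) is wanted. The missing N^\<epsilon> is what the power 3/2 of a frequency
        beyond the threshold supplies.\<close>
      have "N powr \<epsilon> = (N powr (2 * \<epsilon> / 3)) powr (3 / 2)" by (simp add: powr_powr)
      also have "\<dots> \<le> ?K powr (3 / 2)" using False by (intro powr_mono2) auto
      also have "?K powr (3 / 2) * 1 \<le> ?K powr (3 / 2) * (kwt k * ?K powr (5 / 2))" by (intro mult_left_mono kw) auto
      also have "\<dots> = kwt k * ?K ^ 4" by (simp add: kmax_power4)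
      finally show "N powr \<epsilon> \<le> kwt k * ?K ^ 4" by simp
    qed (use D1 in auto)
    finally show thesis by (intro that[of "2 * ((c 0)\<^sup>2 * (3 * lattice_sum * (c 0 + c 2 / \<delta> ^ 2)))"]) (auto simp: mult_ac)
  qed
qed

section \<open>Integer powers and the estimate for an observable\<close>

lemma qpow_int:
  assumes "M > 0"
  shows "quantum_baker (2 * M) [^]\<^bsub>mat_ring (2 * M)\<^esub> int m = qpow M m"
    and "quantum_baker (2 * M) [^]\<^bsub>mat_ring (2 * M)\<^esub> (- int m) = qpow_inv M m"
proof -
  show "quantum_baker (2 * M) [^]\<^bsub>mat_ring (2 * M)\<^esub> int m = qpow M m"
    unfolding quantum_baker_eq[OF assms] by (rule int_pow_int)
  show "quantum_baker (2 * M) [^]\<^bsub>mat_ring (2 * M)\<^esub> (- int m) = qpow_inv M m"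
  proof (cases "m = 0")
    case True
    then show ?thesis by (simp add: int_pow_def2)
  next
    case False
    then have "- int m < 0" by simp
    then show ?thesis unfolding quantum_baker_eq[OF assms] int_pow_def2 using inv_qpow[OF assms, of m] by simp
  qed
qed

lemma baker_pow_int:
  "baker_pow (int m) x = (baker ^^ m) (torus_rep x)"
  "baker_pow (- int m) x = (inv_into fund_dom baker ^^ m) (torus_rep x)"
  by (cases "m = 0"; simp add: baker_pow_def)+

text \<open>One bound on P A - B P controls both conjugations. The first form is used for n \<ge> 0
  and the second for n < 0.\<close>

lemma op_bound_conjugate:
  assumes M: "M > 0" and A: "A \<in> carrier_mat (2 * M) (2 * M)" and B: "B \<in> carrier_mat (2 * M) (2 * M)"
    and op_bound: "op_bound (2 * M) (qpow M n * A - B * qpow M n) T"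
  shows "op_bound (2 * M) (qpow M n * A * qpow_inv M n - B) T" "op_bound (2 * M) (qpow_inv M n * B * qpow M n - A) T"
proof -
  let ?P = "qpow M n" and ?Q = "qpow_inv M n" and ?C = "carrier_mat (2 * M) (2 * M)"
  note c = qpow_carrier[of M n]
  note PA = mult_carrier_mat[OF c(1) A] and BP = mult_carrier_mat[OF B c(1)]
  have "(?P * A - B * ?P) * ?Q = ?P * A * ?Q - B * ?P * ?Q"
    by (rule minus_mult_distrib_mat[OF PA BP c(2)])
  also have "B * ?P * ?Q = B" using assoc_mult_mat[OF B c] qpow_inverse(1)[OF M, of n] B by simp
  finally have "?P * A * ?Q - B = (?P * A - B * ?P) * ?Q" ..
  then show "op_bound (2 * M) (?P * A * ?Q - B) T" using op_bound_mult[OF op_bound op_bound_qpow(2)[OF M, of n]] by simp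
  have "?Q * (?P * A - B * ?P) = ?Q * (?P * A) - ?Q * (B * ?P)"
    by (rule mult_minus_distrib_mat[OF c(2) PA BP])
  also have "?Q * (?P * A) = A" using assoc_mult_mat[OF c(2,1) A] qpow_inverse(2)[OF M, of n] A by simp
  also have "?Q * (B * ?P) = ?Q * B * ?P" using assoc_mult_mat[OF c(2) B c(1)] by simp
  finally have e: "?Q * (?P * A - B * ?P) = A - ?Q * B * ?P" .
  have "- (A - X) = X - A" if "X \<in> ?C" for X
    using that A by (intro eq_matI) auto
  from this[OF mult_carrier_mat[OF mult_carrier_mat[OF c(2) B] c(1)]]
  have "?Q * B * ?P - A = - (?Q * (?P * A - B * ?P))" unfolding e ..
  moreover have "op_bound (2 * M) (- (?Q * (?P * A - B * ?P))) (1 * T)"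
    by (intro op_bound_uminus op_bound_mult op_bound_qpow(2)[OF M] op_bound)
  ultimately show "op_bound (2 * M) (?Q * B * ?P - A) T" by simp
qed

text \<open>The order \<open>L\<close> and the constant \<open>c (L + 2)\<close> occur in the
  hypotheses only. The factor in the conclusion is built from \<open>c 0\<close>, \<open>c 2\<close>
  and two convergent sums, which makes it independent of \<epsilon>.\<close>

lemma egorov_good_part:
  assumes h: "cutoff1 \<delta> c (ct \<delta>)" and c: "\<And>k. 0 \<le> c k" and fa: "smooth2 a" and \<epsilon>: "\<epsilon> > 0"
    and L: "48 / \<epsilon> + 22 \<le> real L" and N: "even N" "1 \<le> N"
    and X8: "8 * c 0 * lattice_sum * 2 ^ (L + 2) * (c (L + 2) + c 0) \<le> real N"
    and dN: "real N powr (- \<epsilon> / 4) \<le> \<delta>" and n: "\<bar>real_of_int n\<bar> \<le> (1 - \<epsilon>) * ehrenfest_time N"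
  shows "op_norm (quantum_baker N [^]\<^bsub>mat_ring N\<^esub> n * weyl_op N (good_part ct \<delta> n a) * quantum_baker N [^]\<^bsub>mat_ring N\<^esub> (- n)
             - weyl_op N (good_part ct \<delta> n a \<circ> baker_pow (- n)))
    \<le> (1 + 6 * (c 0)\<^sup>2 * lattice_sum * (c 0 + c 2)) * infsum kwt UNIV * (Cj_norm 4 a / real N powr (\<epsilon> / 2))"
proof -
  define D where "D = 1 + 6 * (c 0)\<^sup>2 * lattice_sum * (c 0 + c 2)"
  define Sw where "Sw = infsum kwt UNIV"
  have D: "0 \<le> D" using c lattice_sum_nonneg by (simp add: D_def)
  obtain M where NM: "N = 2 * M" using N(1) by blast
  have M: "M > 0" using N NM by simp
  have N1: "1 \<le> real N" using N by simp
  have d: "0 < \<delta>" using h by (simp add: cutoff1_def)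
  let ?d = \<delta> and ?h = "ct \<delta>"
  define m where "m = nat \<bar>n\<bar>"
  have m: "2 ^ m \<le> real N powr (1 - \<epsilon>)"
  proof -
    have "real m * ln 2 \<le> (1 - \<epsilon>) * ln (real N)"
      using n mult_right_mono[OF n, of "ln 2"] by (simp add: m_def ehrenfest_time_def)
    then have "exp (real m * ln 2) \<le> exp ((1 - \<epsilon>) * ln (real N))" by simp
    then show ?thesis using N1 by (simp add: powr_def exp_of_nat_mult)
  qed
  let ?\<alpha> = "fourier_coeff a"
  let ?A = "c 0 + c 2 / ?d ^ 2"
  let ?E = "\<lambda>k. egorov_err c ?d M L m (kmax k)" and ?S = "(c 0)\<^sup>2 * (3 * lattice_sum * ?A)"
    and ?R = "2 ^ m * (2 ^ m * (3 * lattice_sum * ?A)\<^sup>2)"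
  let ?T = "Cj_norm 4 a * real N powr (- \<epsilon> / 2) * D * Sw"
  let ?e = "\<lambda>k x. ee (fst x * of_int (snd k) - snd x * of_int (fst k))"
  have wa: "wiener2 a ?\<alpha>" by (rule smooth2_wiener2[OF fa])
  have as: "(\<lambda>k. norm (?\<alpha> k)) summable_on UNIV" by (rule wiener2_abs[OF wa])
  have "\<exists>e. (?E k \<le> e \<or> 2 * ?S \<le> e) \<and> e \<le> real N powr (- \<epsilon> / 2) * D * kwt k * kmax k ^ 4" for k
  proof -
    show ?thesis
      by (rule egorov_numerics[where k = k and M = M, OF c \<epsilon> L _ N1 X8 d dN m D_def])
        (use NM in simp, blast)
  qed
  then obtain e where e: "\<And>k. ?E k \<le> e k \<or> 2 * ?S \<le> e k" "\<And>k. e k \<le> real N powr (- \<epsilon> / 2) * D * kwt k * kmax k ^ 4"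
    by metis
  have sup: "op_bound (2 * M) (qpow M m * weyl_op (2 * M) FF - weyl_op (2 * M) GG * qpow M m) ?T"
    if md: "\<And>k. modes M m (?E k) ?S ?R (F k) (G k)"
      and FF: "\<And>x. ((\<lambda>k. ?\<alpha> k * F k x) has_sum FF x) UNIV" and GG: "\<And>x. ((\<lambda>k. ?\<alpha> k * G k x) has_sum GG x) UNIV"
    for F G FF GG
  proof (rule modes_superpose[OF M md as FF GG e(1)])
    let ?t = "\<lambda>k. (Cj_norm 4 a * real N powr (- \<epsilon> / 2) * D) * kwt k"
    show "norm (?\<alpha> k) * e k \<le> ?t k" for k
    proof -
      have "norm (?\<alpha> k) * e k \<le> norm (?\<alpha> k) * (real N powr (- \<epsilon> / 2) * D * kwt k * kmax k ^ 4)"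
        by (intro mult_left_mono e) simp
      also have "\<dots> = (norm (?\<alpha> k) * kmax k ^ 4) * (real N powr (- \<epsilon> / 2) * D * kwt k)" by simp
      also have "\<dots> \<le> Cj_norm 4 a * (real N powr (- \<epsilon> / 2) * D * kwt k)"
        using D kwt_nonneg by (intro mult_right_mono fourier_coeff_decay fa) auto
      finally show ?thesis by (simp add: mult.assoc)
    qed
    show "?t summable_on UNIV" by (rule summable_on_cmult_right[OF kwt_summable])
    show "infsum ?t UNIV \<le> ?T" unfolding Sw_def by (simp add: infsum_cmult_right')
  qed
  have a_sum: "((\<lambda>k. ?\<alpha> k * (?e k x * z)) has_sum a x * z) UNIV" for x z
    unfolding mult.assoc[symmetric] by (rule has_sum_cmult_left[OF wiener2_has_sum[OF wa]])
  have "op_bound (2 * M) (quantum_baker N [^]\<^bsub>mat_ring N\<^esub> n * weyl_op N (good_part ct ?d n a) * quantum_baker N [^]\<^bsub>mat_ring N\<^esub> (- n)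
         - weyl_op N (good_part ct ?d n a \<circ> baker_pow (- n))) ?T"
  proof (cases "0 \<le> n")
    case True
    then have nm: "n = int m" by (simp add: m_def)
    let ?F = "\<lambda>k x. ?e k x * complex_of_real (?h (2 ^ m * fst x) * ?h (snd x))"
    let ?FF = "good_part ct ?d n a"
    have "\<forall>k. \<exists>G. modes M m (?E k) ?S ?R (?F k) G" by (rule allI) (rule modes_forward[OF h c M])
    from choice[OF this] obtain G where "\<forall>k. modes M m (?E k) ?S ?R (?F k) (G k)" by (rule exE)
    then have md: "modes M m (?E k) ?S ?R (?F k) (G k)" for k by (rule spec)
    have FF: "((\<lambda>k. ?\<alpha> k * ?F k x) has_sum ?FF x) UNIV" for x
    proof -
      have "?FF x = a x * complex_of_real (?h (2 ^ m * fst x) * ?h (snd x))"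
        by (cases x) (simp add: good_part_def cutoff_def nm)
      then show ?thesis using a_sum by simp
    qed
    have GG: "((\<lambda>k. ?\<alpha> k * G k x) has_sum (?FF \<circ> baker_pow (- n)) x) UNIV" for x
    proof -
      let ?y = "(inv_into fund_dom baker ^^ m) (torus_rep x)"
      have y: "?y \<in> fund_dom" "(baker ^^ m) ?y = torus_rep x" using baker_inv_iter[OF torus_rep_fund_dom] by auto
      have "G k x = ?F k ?y" for k
      proof -
        have "G k ((baker ^^ m) ?y) = ?F k ?y" "G k (torus_rep x) = G k x" using md[of k] y(1) unfolding modes_def by blast+
        then show ?thesis unfolding y(2) by simp
      qed
      then show ?thesis using FF[of ?y] by (simp add: nm baker_pow_int)
    qed
    show ?thesis unfolding NM nm qpow_int[OF M]
      by (rule op_bound_conjugate(1)[OF M weyl_op_carrier weyl_op_carrier sup[OF md FF GG, unfolded nm NM]])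
  next
    \<comment> \<open>Now the good part is the symbol after |n| forward steps, and its composition
      with a positive power of the map is the symbol before them.\<close>
    case False
    then have nm: "n = - int m" and m0: "m \<noteq> 0" by (auto simp: m_def)
    let ?G = "\<lambda>k x. ?e k x * complex_of_real (?h (2 ^ m * snd x) * ?h (fst x))"
    let ?GG = "good_part ct ?d n a"
    have "\<forall>k. \<exists>F. modes M m (?E k) ?S ?R F (?G k)" by (rule allI) (rule modes_backward[OF h c M])
    from choice[OF this] obtain F where "\<forall>k. modes M m (?E k) ?S ?R (F k) (?G k)" by (rule exE)
    then have md: "modes M m (?E k) ?S ?R (F k) (?G k)" for k by (rule spec)
    have GG: "((\<lambda>k. ?\<alpha> k * ?G k x) has_sum ?GG x) UNIV" for x
    proof -
      have "?GG x = a x * complex_of_real (?h (2 ^ m * snd x) * ?h (fst x))"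
        using m0 by (cases x) (simp add: good_part_def cutoff_def nm)
      then show ?thesis using a_sum by simp
    qed
    have FF: "((\<lambda>k. ?\<alpha> k * F k x) has_sum (?GG \<circ> baker_pow (- n)) x) UNIV" for x
    proof -
      let ?y = "(baker ^^ m) (torus_rep x)"
      have "F k x = ?G k ?y" for k
      proof -
        have "?G k ?y = F k (torus_rep x)" "F k (torus_rep x) = F k x" using md[of k] torus_rep_fund_dom[of x] unfolding modes_def by blast+
        then show ?thesis by simp
      qed
      then show ?thesis using GG[of ?y] by (simp add: nm baker_pow_int)
    qed
    show ?thesis unfolding NM nm minus_minus qpow_int[OF M]
      by (rule op_bound_conjugate(2)[OF M weyl_op_carrier weyl_op_carrier sup[OF md FF GG, unfolded nm NM minus_minus]])
  qed
  from op_norm_le[OF this] show ?thesis by (simp add: powr_minus_divide D_def Sw_def mult_ac)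
qed

theorem theorem5p15:
  fixes ct :: "real \<Rightarrow> real \<Rightarrow> real"
  assumes "cutoff_family ct"
  shows "\<exists>C>0. \<forall>\<epsilon>>0. \<exists>N0::nat. N0 > 0 \<and>
    (\<forall>a \<in> smooth_torus. \<forall>\<delta> :: nat \<Rightarrow> real.
      (\<forall>N\<ge>1. 0 < \<delta> N \<and> \<delta> N < 1/4 \<and> \<delta> N \<ge> min (real N powr (- \<epsilon> / 4)) (1/10)) \<longrightarrow>
      (\<forall>N\<ge>N0. even N \<longrightarrow>
        (\<forall>n::int. \<bar>real_of_int n\<bar> \<le> (1 - \<epsilon>) * ehrenfest_time N \<longrightarrow>
          op_norm
            (quantum_baker N [^]\<^bsub>mat_ring N\<^esub> n
               * weyl_op N (good_part ct (\<delta> N) n a)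
               * quantum_baker N [^]\<^bsub>mat_ring N\<^esub> (- n)
             - weyl_op N (good_part ct (\<delta> N) n a \<circ> baker_pow (- n)))
          \<le> C * (C0_norm a * real N powr (3/2) * exp (- pi * real N powr (\<epsilon> / 2))
                 + Cj_norm 4 a / real N powr (\<epsilon> / 2)))))"
proof -
  obtain c where cut: "\<And>\<delta>. 0 < \<delta> \<Longrightarrow> \<delta> < 1 / 4 \<Longrightarrow> cutoff1 \<delta> c (ct \<delta>)" and c: "\<And>k. 0 \<le> c k"
    using cutoff_family_cutoff1[OF assms] by blast
  \<comment> \<open>Only \<open>c 0\<close> and \<open>c 2\<close> occur, so the constant can be
    fixed before \<epsilon> is introduced. The bound is stated with C + 1 to make it
    positive.\<close>
  define C where "C = (1 + 6 * (c 0)\<^sup>2 * lattice_sum * (c 0 + c 2)) * infsum kwt UNIV"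
  have C: "0 \<le> C" unfolding C_def
    using c lattice_sum_nonneg by (intro mult_nonneg_nonneg add_nonneg_nonneg infsum_nonneg kwt_nonneg) auto
  show ?thesis
  proof (rule exI[of _ "C + 1"], rule conjI, use C in simp, intro allI impI)
    fix \<epsilon> :: real assume \<epsilon>: "\<epsilon> > 0"
    define L where "L = nat \<lceil>48 / \<epsilon>\<rceil> + 22"
    define X where "X = 8 * c 0 * lattice_sum * 2 ^ (L + 2) * (c (L + 2) + c 0)"
    \<comment> \<open>The first summand turns the lower bound on the width into N^(-\<epsilon>/4),
      the second absorbs the constants of order \<open>L\<close>, and the 2 excludes N = 0 and N =
      1.\<close>
    define N0 where "N0 = nat \<lceil>10 powr (4 / \<epsilon>)\<rceil> + nat \<lceil>X\<rceil> + 2"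
    have L: "48 / \<epsilon> + 22 \<le> real L" unfolding L_def by linarith
    have est: "op_norm (quantum_baker N [^]\<^bsub>mat_ring N\<^esub> n * weyl_op N (good_part ct (\<delta> N) n a) * quantum_baker N [^]\<^bsub>mat_ring N\<^esub> (- n)
             - weyl_op N (good_part ct (\<delta> N) n a \<circ> baker_pow (- n)))
          \<le> (C + 1) * (C0_norm a * real N powr (3/2) * exp (- pi * real N powr (\<epsilon> / 2))
                 + Cj_norm 4 a / real N powr (\<epsilon> / 2))"
      if a: "a \<in> smooth_torus"
        and \<delta>: "\<forall>N\<ge>1. 0 < \<delta> N \<and> \<delta> N < 1/4 \<and> \<delta> N \<ge> min (real N powr (- \<epsilon> / 4)) (1/10)"
        and N: "N0 \<le> N" "even N" and n: "\<bar>real_of_int n\<bar> \<le> (1 - \<epsilon>) * ehrenfest_time N"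
      for a \<delta> N and n :: int
    proof -
      have N2: "2 \<le> N" "10 powr (4 / \<epsilon>) \<le> real N" "X \<le> real N" using N(1) unfolding N0_def by linarith+
      have N1: "1 \<le> N" "0 < real N" using N2 by simp_all
      have fa: "smooth2 a" using a by (simp add: smooth_torus_def smooth2_def)
      have d: "0 < \<delta> N" "\<delta> N < 1 / 4" "min (real N powr (- \<epsilon> / 4)) (1/10) \<le> \<delta> N" using \<delta> N2 by auto
      \<comment> \<open>Beyond \<open>N0\<close> the power is at most 1/10, so it is the smaller
        argument of the minimum.\<close>
      have dN: "real N powr (- \<epsilon> / 4) \<le> \<delta> N"
      proof -
        have "(10 powr (4 / \<epsilon>)) powr (\<epsilon> / 4) \<le> real N powr (\<epsilon> / 4)" using N2 \<epsilon> by (intro powr_mono2) auto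
        then have "10 \<le> real N powr (\<epsilon> / 4)" using \<epsilon> by (simp add: powr_powr)
        then have "1 / real N powr (\<epsilon> / 4) \<le> 1 / 10" using N1 by (intro divide_left_mono) auto
        then show ?thesis using d(3) by (simp add: powr_minus_divide)
      qed
      have C0: "0 \<le> C0_norm a" using order_trans[OF norm_ge_zero C0_norm_bound[OF fa]] .
      have Cj: "0 \<le> Cj_norm 4 a" using C0 C0_norm_le_Cj[OF fa, of "(0, 0)" 4] by (simp add: partial_def)
      note egorov_good_part[where ct = ct and c = c, OF cut[OF d(1,2)] c fa \<epsilon> L N(2) N1(1) N2(3)[unfolded X_def] dN n, folded C_def]
      also have "C * (Cj_norm 4 a / real N powr (\<epsilon> / 2))
          \<le> (C + 1) * (C0_norm a * real N powr (3/2) * exp (- pi * real N powr (\<epsilon> / 2)) + Cj_norm 4 a / real N powr (\<epsilon> / 2))"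
        using C C0 Cj by (intro mult_mono) auto
      finally show ?thesis .
    qed
    show "\<exists>N0::nat. N0 > 0 \<and> (\<forall>a \<in> smooth_torus. \<forall>\<delta> :: nat \<Rightarrow> real.
      (\<forall>N\<ge>1. 0 < \<delta> N \<and> \<delta> N < 1/4 \<and> \<delta> N \<ge> min (real N powr (- \<epsilon> / 4)) (1/10)) \<longrightarrow>
      (\<forall>N\<ge>N0. even N \<longrightarrow>
        (\<forall>n::int. \<bar>real_of_int n\<bar> \<le> (1 - \<epsilon>) * ehrenfest_time N \<longrightarrow>
          op_norm
            (quantum_baker N [^]\<^bsub>mat_ring N\<^esub> n
               * weyl_op N (good_part ct (\<delta> N) n a)
               * quantum_baker N [^]\<^bsub>mat_ring N\<^esub> (- n)
             - weyl_op N (good_part ct (\<delta> N) n a \<circ> baker_pow (- n)))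
          \<le> (C + 1) * (C0_norm a * real N powr (3/2) * exp (- pi * real N powr (\<epsilon> / 2))
                 + Cj_norm 4 a / real N powr (\<epsilon> / 2)))))"
      by (intro exI[of _ N0] conjI ballI allI impI) (simp add: N0_def, rule est)
  qed
qed

end
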